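(* In homotopy type theory with function extensionality and propositional truncations, let $B$ be a groupoid ($1$-type) and $A$ any type. Then \[ (\|A\| \to B) \;\simeq\; \Sigma_{f:A\to B}\,\Sigma_{c:\mathsf{const}_f}\, \mathsf{coh}_{f,c}, \] where $\mathsf{const}_f :\equiv \Pi_{a^1,a^2:A}\, f(a^1)=f(a^2)$ and $\mathsf{coh}_{f,c} :\equiv \Pi_{a^1,a^2,a^3:A}\, c(a^1,a^2)\cdot c(a^2,a^3) = c(a^1,a^3)$.
   Context: $\|A\|$ is the propositional truncation: a type any two of whose elements are equal, with $|{-}|:A\to\|A\|$ such that precomposition gives $(\|A\|\to P)\simeq(A\to P)$ for every proposition $P$. A $1$-type is a type whose identity types are sets. $\cdot$ denotes path concatenation, $=$ the identity type, $\simeq$ type equivalence. *)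

theory Defs
  imports Main
begin

text \<open>
  Homotopy type theory is represented by its syntax and its derivable judgements. A shallow
  embedding, with arbitrary HOL functions as the elements of function types, would not do: it
  admits functions defined by cases on equality in HOL and thereby forces identity proofs
  to be unique.

  The theory consists of a cumulative hierarchy of Russell universes, dependent products (with
  judgemental beta and eta), dependent sums and identity types (with their dependent eliminators
  and judgemental computation on constructors), function extensionality, and propositional
  truncation. Univalence and further type formers are absent, so that whatever is derivable
  here is also derivable in any extension by them.
\<close>

section \<open>Raw terms\<close>

text \<open>
  Terms use de Bruijn indices. The second argument of \<open>TPi\<close>, \<open>TLam\<close> and \<open>TSigma\<close> binds one
  variable. In \<open>TIndSigma C g p\<close>, \<open>C\<close> binds one variable (the pair) and \<open>g\<close> binds two (the
  components; the second one has index 0). In \<open>TJ C c a b p\<close>, \<open>C\<close> binds three variables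
  (left endpoint 2, right endpoint 1, path 0) and \<open>c\<close> binds one.
\<close>

datatype tm =
    Var nat
  | TUniv nat
  | TPi tm tm
  | TLam tm tm
  | TApp tm tm
  | TSigma tm tm
  | TPair tm tm
  | TIndSigma tm tm tm
  | TId tm tm tm
  | TRefl tm
  | TJ tm tm tm tm tm
  | TFunext tm tm
  | TTrunc tm
  | TTruncIn tm
  | TTruncEq tm tm
  | TTruncUP tm tm tm

definition scons :: "'a \<Rightarrow> (nat \<Rightarrow> 'a) \<Rightarrow> nat \<Rightarrow> 'a" (infixr "\<bullet>" 65) where
  "a \<bullet> \<sigma> = case_nat a \<sigma>"

abbreviation up_ren :: "(nat \<Rightarrow> nat) \<Rightarrow> nat \<Rightarrow> nat" where
  "up_ren \<xi> \<equiv> 0 \<bullet> (\<lambda>n. Suc (\<xi> n))"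

primrec ren :: "(nat \<Rightarrow> nat) \<Rightarrow> tm \<Rightarrow> tm" where
  "ren \<xi> (Var n) = Var (\<xi> n)"
| "ren \<xi> (TUniv i) = TUniv i"
| "ren \<xi> (TPi A B) = TPi (ren \<xi> A) (ren (up_ren \<xi>) B)"
| "ren \<xi> (TLam A b) = TLam (ren \<xi> A) (ren (up_ren \<xi>) b)"
| "ren \<xi> (TApp f a) = TApp (ren \<xi> f) (ren \<xi> a)"
| "ren \<xi> (TSigma A B) = TSigma (ren \<xi> A) (ren (up_ren \<xi>) B)"
| "ren \<xi> (TPair a b) = TPair (ren \<xi> a) (ren \<xi> b)"
| "ren \<xi> (TIndSigma C g p) =
     TIndSigma (ren (up_ren \<xi>) C) (ren (up_ren (up_ren \<xi>)) g) (ren \<xi> p)"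
| "ren \<xi> (TId A a b) = TId (ren \<xi> A) (ren \<xi> a) (ren \<xi> b)"
| "ren \<xi> (TRefl a) = TRefl (ren \<xi> a)"
| "ren \<xi> (TJ C c a b p) =
     TJ (ren (up_ren (up_ren (up_ren \<xi>))) C) (ren (up_ren \<xi>) c) (ren \<xi> a) (ren \<xi> b) (ren \<xi> p)"
| "ren \<xi> (TFunext f g) = TFunext (ren \<xi> f) (ren \<xi> g)"
| "ren \<xi> (TTrunc A) = TTrunc (ren \<xi> A)"
| "ren \<xi> (TTruncIn a) = TTruncIn (ren \<xi> a)"
| "ren \<xi> (TTruncEq x y) = TTruncEq (ren \<xi> x) (ren \<xi> y)"
| "ren \<xi> (TTruncUP A P h) = TTruncUP (ren \<xi> A) (ren \<xi> P) (ren \<xi> h)"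

abbreviation wk :: "nat \<Rightarrow> tm \<Rightarrow> tm" where
  "wk k \<equiv> ren (\<lambda>n. n + k)"

abbreviation up :: "(nat \<Rightarrow> tm) \<Rightarrow> nat \<Rightarrow> tm" where
  "up \<sigma> \<equiv> Var 0 \<bullet> (\<lambda>n. wk 1 (\<sigma> n))"

primrec sub :: "(nat \<Rightarrow> tm) \<Rightarrow> tm \<Rightarrow> tm" where
  "sub \<sigma> (Var n) = \<sigma> n"
| "sub \<sigma> (TUniv i) = TUniv i"
| "sub \<sigma> (TPi A B) = TPi (sub \<sigma> A) (sub (up \<sigma>) B)"
| "sub \<sigma> (TLam A b) = TLam (sub \<sigma> A) (sub (up \<sigma>) b)"
| "sub \<sigma> (TApp f a) = TApp (sub \<sigma> f) (sub \<sigma> a)"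
| "sub \<sigma> (TSigma A B) = TSigma (sub \<sigma> A) (sub (up \<sigma>) B)"
| "sub \<sigma> (TPair a b) = TPair (sub \<sigma> a) (sub \<sigma> b)"
| "sub \<sigma> (TIndSigma C g p) =
     TIndSigma (sub (up \<sigma>) C) (sub (up (up \<sigma>)) g) (sub \<sigma> p)"
| "sub \<sigma> (TId A a b) = TId (sub \<sigma> A) (sub \<sigma> a) (sub \<sigma> b)"
| "sub \<sigma> (TRefl a) = TRefl (sub \<sigma> a)"
| "sub \<sigma> (TJ C c a b p) =
     TJ (sub (up (up (up \<sigma>))) C) (sub (up \<sigma>) c) (sub \<sigma> a) (sub \<sigma> b) (sub \<sigma> p)"
| "sub \<sigma> (TFunext f g) = TFunext (sub \<sigma> f) (sub \<sigma> g)"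
| "sub \<sigma> (TTrunc A) = TTrunc (sub \<sigma> A)"
| "sub \<sigma> (TTruncIn a) = TTruncIn (sub \<sigma> a)"
| "sub \<sigma> (TTruncEq x y) = TTruncEq (sub \<sigma> x) (sub \<sigma> y)"
| "sub \<sigma> (TTruncUP A P h) = TTruncUP (sub \<sigma> A) (sub \<sigma> P) (sub \<sigma> h)"

abbreviation inst :: "tm \<Rightarrow> tm \<Rightarrow> tm" where
  "inst B a \<equiv> sub (a \<bullet> Var) B"

section \<open>Defined types and operations\<close>

definition arr :: "tm \<Rightarrow> tm \<Rightarrow> tm" where
  "arr A B = TPi A (wk 1 B)"

definition prd :: "tm \<Rightarrow> tm \<Rightarrow> tm" where
  "prd A B = TSigma A (wk 1 B)"

definition is_prop :: "tm \<Rightarrow> tm" where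
  "is_prop A = TPi A (TPi (wk 1 A) (TId (wk 2 A) (Var 1) (Var 0)))"

definition is_set :: "tm \<Rightarrow> tm" where
  "is_set A = TPi A (TPi (wk 1 A) (is_prop (TId (wk 2 A) (Var 1) (Var 0))))"

definition is_groupoid :: "tm \<Rightarrow> tm" where
  "is_groupoid A = TPi A (TPi (wk 1 A) (is_set (TId (wk 2 A) (Var 1) (Var 0))))"

text \<open>\<open>f : A \<rightarrow> B\<close> has a right inverse \<open>g\<close> and a left inverse \<open>h\<close>, up to pointwise identity.\<close>

definition is_equiv :: "tm \<Rightarrow> tm \<Rightarrow> tm \<Rightarrow> tm" where
  "is_equiv A B f =
     prd (TSigma (arr B A)
            (TPi (wk 1 B) (TId (wk 2 B) (TApp (wk 2 f) (TApp (Var 1) (Var 0))) (Var 0))))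
         (TSigma (arr B A)
            (TPi (wk 1 A) (TId (wk 2 A) (TApp (Var 1) (TApp (wk 2 f) (Var 0))) (Var 0))))"

definition equiv_ty :: "tm \<Rightarrow> tm \<Rightarrow> tm" where
  "equiv_ty A B = TSigma (arr A B) (is_equiv (wk 1 A) (wk 1 B) (Var 0))"

text \<open>For \<open>p : x = y\<close> and \<open>q : y = z\<close> in \<open>A\<close>: path induction on \<open>p\<close> with motive
  \<open>(y = z) \<rightarrow> (x = z)\<close> and the identity function for reflexivity, applied to \<open>q\<close>.\<close>

definition concat_path :: "tm \<Rightarrow> tm \<Rightarrow> tm \<Rightarrow> tm \<Rightarrow> tm \<Rightarrow> tm \<Rightarrow> tm" where
  "concat_path A x y z p q =
     TApp (TJ (arr (TId (wk 3 A) (Var 1) (wk 3 z)) (TId (wk 3 A) (Var 2) (wk 3 z)))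
              (TLam (TId (wk 1 A) (Var 0) (wk 1 z)) (Var 0))
              x y p)
          q"

text \<open>In the next two definitions \<open>B\<close> lives in the context extended by \<open>A\<close>.\<close>

definition homotopy :: "tm \<Rightarrow> tm \<Rightarrow> tm \<Rightarrow> tm \<Rightarrow> tm" where
  "homotopy A B f g = TPi A (TId B (TApp (wk 1 f) (Var 0)) (TApp (wk 1 g) (Var 0)))"

definition happly :: "tm \<Rightarrow> tm \<Rightarrow> tm \<Rightarrow> tm \<Rightarrow> tm" where
  "happly A B f g =
     TLam (TId (TPi A B) f g)
       (TJ (homotopy (wk 4 A) (ren (up_ren (\<lambda>n. n + 4)) B) (Var 2) (Var 1))
           (TLam (wk 2 A) (TRefl (TApp (Var 1) (Var 0))))
           (wk 1 f) (wk 1 g) (Var 0))"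

definition precomp_trunc :: "tm \<Rightarrow> tm \<Rightarrow> tm" where
  "precomp_trunc A P =
     TLam (arr (TTrunc A) P) (TLam (wk 1 A) (TApp (Var 1) (TTruncIn (Var 0))))"

definition const_ty :: "tm \<Rightarrow> tm \<Rightarrow> tm \<Rightarrow> tm" where
  "const_ty A B f =
     TPi A (TPi (wk 1 A)
       (TId (wk 2 B) (TApp (wk 2 f) (Var 1)) (TApp (wk 2 f) (Var 0))))"

text \<open>The three points \<open>a\<^sup>1\<close>, \<open>a\<^sup>2\<close>, \<open>a\<^sup>3\<close> are \<open>Var 2\<close>, \<open>Var 1\<close>, \<open>Var 0\<close>.\<close>

definition coh_ty :: "tm \<Rightarrow> tm \<Rightarrow> tm \<Rightarrow> tm \<Rightarrow> tm" where
  "coh_ty A B f c =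
     (let fa = (\<lambda>i. TApp (wk 3 f) (Var i));
          ca = (\<lambda>i j. TApp (TApp (wk 3 c) (Var i)) (Var j))
      in TPi A (TPi (wk 1 A) (TPi (wk 2 A)
           (TId (TId (wk 3 B) (fa 2) (fa 0))
              (concat_path (wk 3 B) (fa 2) (fa 1) (fa 0) (ca 2 1) (ca 1 0))
              (ca 2 0)))))"

definition coherent_maps :: "tm \<Rightarrow> tm \<Rightarrow> tm" where
  "coherent_maps A B =
     TSigma (arr A B)
       (TSigma (const_ty (wk 1 A) (wk 1 B) (Var 0))
          (coh_ty (wk 2 A) (wk 2 B) (Var 1) (Var 0)))"

section \<open>Judgements\<close>

text \<open>
  The head of a context is the type of the variable with index 0. Weakening and substitution
  are admissible and hence not listed. The rules for truncation state only that the type is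
  a proposition and has the universal property with respect to propositions (in any universe);
  there is no judgemental computation rule.
\<close>

inductive
  wf_ctx :: "tm list \<Rightarrow> bool" and
  has_type :: "tm list \<Rightarrow> tm \<Rightarrow> tm \<Rightarrow> bool" ("_ \<turnstile> _ \<^bold>: _" [50, 50, 50] 50) and
  jeq :: "tm list \<Rightarrow> tm \<Rightarrow> tm \<Rightarrow> tm \<Rightarrow> bool" ("_ \<turnstile> _ \<^bold>\<equiv> _ \<^bold>: _" [50, 50, 50, 50] 50)
where
  ctx_empty: "wf_ctx []"
| ctx_extend: "\<Gamma> \<turnstile> A \<^bold>: TUniv i \<Longrightarrow> wf_ctx (A # \<Gamma>)"

| ty_var: "wf_ctx \<Gamma> \<Longrightarrow> n < length \<Gamma> \<Longrightarrow> \<Gamma> \<turnstile> Var n \<^bold>: wk (Suc n) (\<Gamma> ! n)"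
| ty_conv: "\<Gamma> \<turnstile> a \<^bold>: A \<Longrightarrow> \<Gamma> \<turnstile> A \<^bold>\<equiv> B \<^bold>: TUniv i \<Longrightarrow> \<Gamma> \<turnstile> a \<^bold>: B"

| ty_univ: "wf_ctx \<Gamma> \<Longrightarrow> \<Gamma> \<turnstile> TUniv i \<^bold>: TUniv (Suc i)"
| ty_cumul: "\<Gamma> \<turnstile> A \<^bold>: TUniv i \<Longrightarrow> \<Gamma> \<turnstile> A \<^bold>: TUniv (Suc i)"

| ty_pi: "\<Gamma> \<turnstile> A \<^bold>: TUniv i \<Longrightarrow> A # \<Gamma> \<turnstile> B \<^bold>: TUniv i \<Longrightarrow> \<Gamma> \<turnstile> TPi A B \<^bold>: TUniv i"
| ty_lam: "A # \<Gamma> \<turnstile> b \<^bold>: B \<Longrightarrow> \<Gamma> \<turnstile> TLam A b \<^bold>: TPi A B"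
| ty_app: "\<Gamma> \<turnstile> f \<^bold>: TPi A B \<Longrightarrow> \<Gamma> \<turnstile> a \<^bold>: A \<Longrightarrow> \<Gamma> \<turnstile> TApp f a \<^bold>: inst B a"

| ty_sigma: "\<Gamma> \<turnstile> A \<^bold>: TUniv i \<Longrightarrow> A # \<Gamma> \<turnstile> B \<^bold>: TUniv i \<Longrightarrow> \<Gamma> \<turnstile> TSigma A B \<^bold>: TUniv i"
| ty_pair: "A # \<Gamma> \<turnstile> B \<^bold>: TUniv i \<Longrightarrow> \<Gamma> \<turnstile> a \<^bold>: A \<Longrightarrow> \<Gamma> \<turnstile> b \<^bold>: inst B a \<Longrightarrow>
    \<Gamma> \<turnstile> TPair a b \<^bold>: TSigma A B"
| ty_ind_sigma: "TSigma A B # \<Gamma> \<turnstile> C \<^bold>: TUniv i \<Longrightarrow>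
    B # A # \<Gamma> \<turnstile> g \<^bold>: sub (TPair (Var 1) (Var 0) \<bullet> (\<lambda>n. Var (n + 2))) C \<Longrightarrow>
    \<Gamma> \<turnstile> p \<^bold>: TSigma A B \<Longrightarrow>
    \<Gamma> \<turnstile> TIndSigma C g p \<^bold>: inst C p"

| ty_id: "\<Gamma> \<turnstile> A \<^bold>: TUniv i \<Longrightarrow> \<Gamma> \<turnstile> a \<^bold>: A \<Longrightarrow> \<Gamma> \<turnstile> b \<^bold>: A \<Longrightarrow> \<Gamma> \<turnstile> TId A a b \<^bold>: TUniv i"
| ty_refl: "\<Gamma> \<turnstile> a \<^bold>: A \<Longrightarrow> \<Gamma> \<turnstile> TRefl a \<^bold>: TId A a a"
| ty_J: "TId (wk 2 A) (Var 1) (Var 0) # wk 1 A # A # \<Gamma> \<turnstile> C \<^bold>: TUniv i \<Longrightarrow>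
    A # \<Gamma> \<turnstile> c \<^bold>: sub (TRefl (Var 0) \<bullet> Var 0 \<bullet> Var 0 \<bullet> (\<lambda>n. Var (n + 1))) C \<Longrightarrow>
    \<Gamma> \<turnstile> a \<^bold>: A \<Longrightarrow> \<Gamma> \<turnstile> b \<^bold>: A \<Longrightarrow> \<Gamma> \<turnstile> p \<^bold>: TId A a b \<Longrightarrow>
    \<Gamma> \<turnstile> TJ C c a b p \<^bold>: sub (p \<bullet> b \<bullet> a \<bullet> Var) C"

| ty_funext: "\<Gamma> \<turnstile> f \<^bold>: TPi A B \<Longrightarrow> \<Gamma> \<turnstile> g \<^bold>: TPi A B \<Longrightarrow>
    \<Gamma> \<turnstile> TFunext f g \<^bold>: is_equiv (TId (TPi A B) f g) (homotopy A B f g) (happly A B f g)"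

| ty_trunc: "\<Gamma> \<turnstile> A \<^bold>: TUniv i \<Longrightarrow> \<Gamma> \<turnstile> TTrunc A \<^bold>: TUniv i"
| ty_trunc_in: "\<Gamma> \<turnstile> a \<^bold>: A \<Longrightarrow> \<Gamma> \<turnstile> TTruncIn a \<^bold>: TTrunc A"
| ty_trunc_eq: "\<Gamma> \<turnstile> x \<^bold>: TTrunc A \<Longrightarrow> \<Gamma> \<turnstile> y \<^bold>: TTrunc A \<Longrightarrow>
    \<Gamma> \<turnstile> TTruncEq x y \<^bold>: TId (TTrunc A) x y"
| ty_trunc_up: "\<Gamma> \<turnstile> A \<^bold>: TUniv i \<Longrightarrow> \<Gamma> \<turnstile> P \<^bold>: TUniv j \<Longrightarrow> \<Gamma> \<turnstile> h \<^bold>: is_prop P \<Longrightarrow>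
    \<Gamma> \<turnstile> TTruncUP A P h \<^bold>: is_equiv (arr (TTrunc A) P) (arr A P) (precomp_trunc A P)"

| eq_refl: "\<Gamma> \<turnstile> a \<^bold>: A \<Longrightarrow> \<Gamma> \<turnstile> a \<^bold>\<equiv> a \<^bold>: A"
| eq_sym: "\<Gamma> \<turnstile> a \<^bold>\<equiv> b \<^bold>: A \<Longrightarrow> \<Gamma> \<turnstile> b \<^bold>\<equiv> a \<^bold>: A"
| eq_trans: "\<Gamma> \<turnstile> a \<^bold>\<equiv> b \<^bold>: A \<Longrightarrow> \<Gamma> \<turnstile> b \<^bold>\<equiv> c \<^bold>: A \<Longrightarrow> \<Gamma> \<turnstile> a \<^bold>\<equiv> c \<^bold>: A"
| eq_conv: "\<Gamma> \<turnstile> a \<^bold>\<equiv> b \<^bold>: A \<Longrightarrow> \<Gamma> \<turnstile> A \<^bold>\<equiv> B \<^bold>: TUniv i \<Longrightarrow> \<Gamma> \<turnstile> a \<^bold>\<equiv> b \<^bold>: B"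
| eq_cumul: "\<Gamma> \<turnstile> A \<^bold>\<equiv> B \<^bold>: TUniv i \<Longrightarrow> \<Gamma> \<turnstile> A \<^bold>\<equiv> B \<^bold>: TUniv (Suc i)"

| beta_pi: "A # \<Gamma> \<turnstile> b \<^bold>: B \<Longrightarrow> \<Gamma> \<turnstile> a \<^bold>: A \<Longrightarrow>
    \<Gamma> \<turnstile> TApp (TLam A b) a \<^bold>\<equiv> inst b a \<^bold>: inst B a"
| eta_pi: "\<Gamma> \<turnstile> f \<^bold>: TPi A B \<Longrightarrow> \<Gamma> \<turnstile> f \<^bold>\<equiv> TLam A (TApp (wk 1 f) (Var 0)) \<^bold>: TPi A B"
| beta_sigma: "TSigma A B # \<Gamma> \<turnstile> C \<^bold>: TUniv i \<Longrightarrow>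
    B # A # \<Gamma> \<turnstile> g \<^bold>: sub (TPair (Var 1) (Var 0) \<bullet> (\<lambda>n. Var (n + 2))) C \<Longrightarrow>
    \<Gamma> \<turnstile> a \<^bold>: A \<Longrightarrow> \<Gamma> \<turnstile> b \<^bold>: inst B a \<Longrightarrow>
    \<Gamma> \<turnstile> TIndSigma C g (TPair a b) \<^bold>\<equiv> sub (b \<bullet> a \<bullet> Var) g \<^bold>: inst C (TPair a b)"
| beta_J: "TId (wk 2 A) (Var 1) (Var 0) # wk 1 A # A # \<Gamma> \<turnstile> C \<^bold>: TUniv i \<Longrightarrow>
    A # \<Gamma> \<turnstile> c \<^bold>: sub (TRefl (Var 0) \<bullet> Var 0 \<bullet> Var 0 \<bullet> (\<lambda>n. Var (n + 1))) C \<Longrightarrow>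
    \<Gamma> \<turnstile> a \<^bold>: A \<Longrightarrow>
    \<Gamma> \<turnstile> TJ C c a a (TRefl a) \<^bold>\<equiv> inst c a \<^bold>: sub (TRefl a \<bullet> a \<bullet> a \<bullet> Var) C"

| cong_pi: "\<Gamma> \<turnstile> A \<^bold>\<equiv> A' \<^bold>: TUniv i \<Longrightarrow> A # \<Gamma> \<turnstile> B \<^bold>\<equiv> B' \<^bold>: TUniv i \<Longrightarrow>
    \<Gamma> \<turnstile> TPi A B \<^bold>\<equiv> TPi A' B' \<^bold>: TUniv i"
| cong_lam: "\<Gamma> \<turnstile> A \<^bold>\<equiv> A' \<^bold>: TUniv i \<Longrightarrow> A # \<Gamma> \<turnstile> b \<^bold>\<equiv> b' \<^bold>: B \<Longrightarrow>
    \<Gamma> \<turnstile> TLam A b \<^bold>\<equiv> TLam A' b' \<^bold>: TPi A B"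
| cong_app: "\<Gamma> \<turnstile> f \<^bold>\<equiv> f' \<^bold>: TPi A B \<Longrightarrow> \<Gamma> \<turnstile> a \<^bold>\<equiv> a' \<^bold>: A \<Longrightarrow>
    \<Gamma> \<turnstile> TApp f a \<^bold>\<equiv> TApp f' a' \<^bold>: inst B a"
| cong_sigma: "\<Gamma> \<turnstile> A \<^bold>\<equiv> A' \<^bold>: TUniv i \<Longrightarrow> A # \<Gamma> \<turnstile> B \<^bold>\<equiv> B' \<^bold>: TUniv i \<Longrightarrow>
    \<Gamma> \<turnstile> TSigma A B \<^bold>\<equiv> TSigma A' B' \<^bold>: TUniv i"
| cong_pair: "A # \<Gamma> \<turnstile> B \<^bold>: TUniv i \<Longrightarrow> \<Gamma> \<turnstile> a \<^bold>\<equiv> a' \<^bold>: A \<Longrightarrow> \<Gamma> \<turnstile> b \<^bold>\<equiv> b' \<^bold>: inst B a \<Longrightarrow>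
    \<Gamma> \<turnstile> TPair a b \<^bold>\<equiv> TPair a' b' \<^bold>: TSigma A B"
| cong_ind_sigma: "TSigma A B # \<Gamma> \<turnstile> C \<^bold>\<equiv> C' \<^bold>: TUniv i \<Longrightarrow>
    B # A # \<Gamma> \<turnstile> g \<^bold>\<equiv> g' \<^bold>: sub (TPair (Var 1) (Var 0) \<bullet> (\<lambda>n. Var (n + 2))) C \<Longrightarrow>
    \<Gamma> \<turnstile> p \<^bold>\<equiv> p' \<^bold>: TSigma A B \<Longrightarrow>
    \<Gamma> \<turnstile> TIndSigma C g p \<^bold>\<equiv> TIndSigma C' g' p' \<^bold>: inst C p"
| cong_id: "\<Gamma> \<turnstile> A \<^bold>\<equiv> A' \<^bold>: TUniv i \<Longrightarrow> \<Gamma> \<turnstile> a \<^bold>\<equiv> a' \<^bold>: A \<Longrightarrow> \<Gamma> \<turnstile> b \<^bold>\<equiv> b' \<^bold>: A \<Longrightarrow>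
    \<Gamma> \<turnstile> TId A a b \<^bold>\<equiv> TId A' a' b' \<^bold>: TUniv i"
| cong_refl: "\<Gamma> \<turnstile> a \<^bold>\<equiv> a' \<^bold>: A \<Longrightarrow> \<Gamma> \<turnstile> TRefl a \<^bold>\<equiv> TRefl a' \<^bold>: TId A a a"
| cong_J: "TId (wk 2 A) (Var 1) (Var 0) # wk 1 A # A # \<Gamma> \<turnstile> C \<^bold>\<equiv> C' \<^bold>: TUniv i \<Longrightarrow>
    A # \<Gamma> \<turnstile> c \<^bold>\<equiv> c' \<^bold>: sub (TRefl (Var 0) \<bullet> Var 0 \<bullet> Var 0 \<bullet> (\<lambda>n. Var (n + 1))) C \<Longrightarrow>
    \<Gamma> \<turnstile> a \<^bold>\<equiv> a' \<^bold>: A \<Longrightarrow> \<Gamma> \<turnstile> b \<^bold>\<equiv> b' \<^bold>: A \<Longrightarrow> \<Gamma> \<turnstile> p \<^bold>\<equiv> p' \<^bold>: TId A a b \<Longrightarrow>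
    \<Gamma> \<turnstile> TJ C c a b p \<^bold>\<equiv> TJ C' c' a' b' p' \<^bold>: sub (p \<bullet> b \<bullet> a \<bullet> Var) C"
| cong_funext: "\<Gamma> \<turnstile> f \<^bold>\<equiv> f' \<^bold>: TPi A B \<Longrightarrow> \<Gamma> \<turnstile> g \<^bold>\<equiv> g' \<^bold>: TPi A B \<Longrightarrow>
    \<Gamma> \<turnstile> TFunext f g \<^bold>\<equiv> TFunext f' g' \<^bold>:
      is_equiv (TId (TPi A B) f g) (homotopy A B f g) (happly A B f g)"
| cong_trunc: "\<Gamma> \<turnstile> A \<^bold>\<equiv> A' \<^bold>: TUniv i \<Longrightarrow> \<Gamma> \<turnstile> TTrunc A \<^bold>\<equiv> TTrunc A' \<^bold>: TUniv i"
| cong_trunc_in: "\<Gamma> \<turnstile> a \<^bold>\<equiv> a' \<^bold>: A \<Longrightarrow> \<Gamma> \<turnstile> TTruncIn a \<^bold>\<equiv> TTruncIn a' \<^bold>: TTrunc A"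
| cong_trunc_eq: "\<Gamma> \<turnstile> x \<^bold>\<equiv> x' \<^bold>: TTrunc A \<Longrightarrow> \<Gamma> \<turnstile> y \<^bold>\<equiv> y' \<^bold>: TTrunc A \<Longrightarrow>
    \<Gamma> \<turnstile> TTruncEq x y \<^bold>\<equiv> TTruncEq x' y' \<^bold>: TId (TTrunc A) x y"
| cong_trunc_up: "\<Gamma> \<turnstile> A \<^bold>\<equiv> A' \<^bold>: TUniv i \<Longrightarrow> \<Gamma> \<turnstile> P \<^bold>\<equiv> P' \<^bold>: TUniv j \<Longrightarrow> \<Gamma> \<turnstile> h \<^bold>\<equiv> h' \<^bold>: is_prop P \<Longrightarrow>
    \<Gamma> \<turnstile> TTruncUP A P h \<^bold>\<equiv> TTruncUP A' P' h' \<^bold>: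
      is_equiv (arr (TTrunc A) P) (arr A P) (precomp_trunc A P)"

end

theory Submission
  imports Defs
begin

text \<open>
  Let \<open>(f, c)\<close> be a coherent map. A cocone at \<open>b\<close> consists of legs \<open>p a : f a = b\<close> with \<open>c a a'
  \<cdot> p a' = p a\<close>, and the apex type collects all \<open>b\<close> with a cocone. Given \<open>a : A\<close>, the apex type
  is contractible: its centre is \<open>f a\<close> with legs \<open>c x a\<close> (a cocone by coherence), any other
  element is reached by path induction on its leg at \<open>a\<close>, and the conditions on legs are
  propositions because \<open>B\<close> is a groupoid. Since being a proposition is a proposition, the apex
  type is an inhabited proposition for every \<open>x : \<parallel>A\<parallel>\<close>. Hence exactly one \<open>h : \<parallel>A\<parallel> \<rightarrow> B\<close> extends
  \<open>(f, c)\<close> in the sense that there is a cocone at every \<open>h x\<close>.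

  Conversely, each \<open>h\<close> extends exactly one coherent map, its restriction \<open>a \<mapsto> h |a|\<close> with the
  paths \<open>ap h\<close>; uniqueness is induction on homotopies. A relation that is total and
  single-valued in both directions gives, by choice for dependent sums, two mutually inverse
  functions.

  Terms are produced only up to existence: \<open>inh \<Gamma> T\<close> says that \<open>T\<close> is inhabited, so that
  identity types become equivalence relations on terms.
\<close>

text \<open>The truncation eliminates only into propositions, and \<open>B\<close> need not be one,
  so \<open>f\<close> cannot be extended directly. The apex type is the proposition that stands in
  for \<open>B\<close>: it packages a value with enough data to pin that value down. Each part of
  the hypothesis is spent on it: \<open>c\<close> gives the legs of the centre, coherence makes them
  a cocone, and the groupoid condition lets cocones be compared by their legs alone. Arguing with a
  relation instead of two explicit maps avoids computing the round trips: each follows from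
  uniqueness on one side.

  The syntactic setting adds an obstacle. HOL does not quantify over the elements of an object type,
  so a statement about all elements of \<open>A\<close> is a judgement in a context extended by
  \<open>A\<close>. Facts are therefore often proved for an arbitrary context and arbitrary terms
  and then used at variables over weakened data. Since \<open>inh\<close> forgets terms, whatever
  occurs in a later type (legs, paths, projections) is kept as an explicit term, and its computation
  rules as judgemental equalities.\<close>

section \<open>The substitution calculus\<close>

text \<open>
  Terms are kept in the normal form of the \<open>\<sigma>\<close>-calculus: renamings and weakenings become
  substitutions, \<open>sh k\<close> shifts by \<open>k\<close>, and \<open>\<sigma> \<Zsemi> \<tau>\<close> applies \<open>\<sigma>\<close> first. The simplifier then
  decides equality of substituted terms. For this, the index 1 must not be rewritten to \<open>Suc 0\<close>.
\<close>

declare One_nat_def [simp del]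

definition cmp :: "(nat \<Rightarrow> tm) \<Rightarrow> (nat \<Rightarrow> tm) \<Rightarrow> nat \<Rightarrow> tm" (infixr "\<Zsemi>" 64) where
  "\<sigma> \<Zsemi> \<tau> = (\<lambda>n. sub \<tau> (\<sigma> n))"

definition sh :: "nat \<Rightarrow> nat \<Rightarrow> tm" where
  "sh k = (\<lambda>n. Var (n + k))"

abbreviation lift :: "(nat \<Rightarrow> tm) \<Rightarrow> nat \<Rightarrow> tm" where
  "lift \<sigma> \<equiv> Var 0 \<bullet> (\<sigma> \<Zsemi> sh 1)"

notation TApp (infixl "$" 190)

abbreviation wkn :: "tm \<Rightarrow> nat \<Rightarrow> tm" (infixl "\<Up>" 200) where
  "t \<Up> k \<equiv> sub (sh k) t"

lemma scons_simps [simp]: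
  "(a \<bullet> \<sigma>) 0 = a" "(a \<bullet> \<sigma>) (Suc n) = \<sigma> n" "(a \<bullet> \<sigma>) 1 = \<sigma> 0"
  "(a \<bullet> \<sigma>) (numeral v) = \<sigma> (pred_numeral v)"
  by (simp_all add: scons_def One_nat_def numeral_eq_Suc)

lemma scons_ext: "f 0 = g 0 \<Longrightarrow> (\<And>n. f (Suc n) = g (Suc n)) \<Longrightarrow> f = g"
  by (rule ext) (case_tac x; simp)

text \<open>\<open>up\<close> and \<open>up_ren\<close> are abbreviations that unfold to
  \<open>\<bullet>\<close>. As constants they stay folded during the inductions on terms, where only
  their values at \<open>0\<close> and at successors matter.\<close>

definition ups :: "(nat \<Rightarrow> tm) \<Rightarrow> nat \<Rightarrow> tm" where "ups \<sigma> = up \<sigma>"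
definition upr :: "(nat \<Rightarrow> nat) \<Rightarrow> nat \<Rightarrow> nat" where "upr \<xi> = up_ren \<xi>"

lemmas sub_ups = sub.simps[folded ups_def]
lemmas ren_upr = ren.simps[folded upr_def]

declare sub.simps(2-) [simp del] ren.simps(2-) [simp del]

lemma ups_simps: "ups \<sigma> 0 = Var 0" "ups \<sigma> (Suc n) = ren Suc (\<sigma> n)"
  by (simp_all add: ups_def One_nat_def)

lemma upr_simps: "upr \<xi> 0 = 0" "upr \<xi> (Suc n) = Suc (\<xi> n)"
  by (simp_all add: upr_def)

lemma ups_Var_comp: "ups (\<lambda>n. Var (\<xi> n)) = (\<lambda>n. Var (upr \<xi> n))"
  by (rule scons_ext) (simp_all add: ups_simps upr_simps)

lemma ren_as_sub: "ren \<xi> t = sub (\<lambda>n. Var (\<xi> n)) t"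
  by (induction t arbitrary: \<xi>) (simp_all add: ren_upr sub_ups ups_Var_comp)

lemma ups_Var: "ups Var = Var"
  by (rule scons_ext) (simp_all add: ups_simps)

lemma sub_Var [simp]: "sub Var t = t"
  by (induction t) (simp_all add: sub_ups ups_Var)

lemma ups_upr: "(\<lambda>n. ups \<sigma> (upr \<xi> n)) = ups (\<lambda>n. \<sigma> (\<xi> n))"
  by (rule scons_ext) (simp_all add: ups_simps upr_simps)

text \<open>Lifting a substitution weakens its terms, so composing two substitutions under a binder
  presupposes that weakening commutes with substitution. Hence the stages: a renaming applied first,
  a renaming applied last, then two substitutions.\<close>

lemma sub_ren: "sub \<sigma> (ren \<xi> t) = sub (\<lambda>n. \<sigma> (\<xi> n)) t"
  by (induction t arbitrary: \<sigma> \<xi>)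
    (simp_all add: ren_upr sub_ups ups_upr)

lemma ren_ren: "ren \<xi> (ren \<zeta> t) = ren (\<xi> \<circ> \<zeta>) t"
  by (simp add: ren_as_sub[of \<xi>] sub_ren) (simp add: ren_as_sub o_def)

lemma upr_ups: "(\<lambda>n. ren (upr \<xi>) (ups \<sigma> n)) = ups (\<lambda>n. ren \<xi> (\<sigma> n))"
  by (rule scons_ext) (simp_all add: ups_simps upr_simps ren_ren o_def)

lemma ren_sub: "ren \<xi> (sub \<sigma> t) = sub (\<lambda>n. ren \<xi> (\<sigma> n)) t"
  by (induction t arbitrary: \<sigma> \<xi>)
    (simp_all add: ren_upr sub_ups upr_ups)

lemma ups_ups: "(\<lambda>n. sub (ups \<sigma>) (ups \<tau> n)) = ups (\<lambda>n. sub \<sigma> (\<tau> n))"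
  by (rule scons_ext) (simp_all add: ups_simps sub_ren ren_sub)

lemma sub_sub [simp]: "sub \<sigma> (sub \<tau> t) = sub (\<tau> \<Zsemi> \<sigma>) t"
  unfolding cmp_def
  by (induction t arbitrary: \<sigma> \<tau>)
    (simp_all add: sub_ups ups_ups)

lemma wk_sh: "ren (\<lambda>n. n + k) t = t \<Up> k" "ren Suc t = t \<Up> 1"
  by (simp_all add: ren_as_sub sh_def One_nat_def)

lemma fold_sh: "(\<lambda>n. Var (n + k)) = sh k"
  by (simp add: sh_def)

lemma up_lift: "up \<sigma> = lift \<sigma>"
  unfolding wk_sh cmp_def ..

lemma cmp_simps [simp]:
  "(a \<bullet> \<sigma>) \<Zsemi> \<tau> = sub \<tau> a \<bullet> (\<sigma> \<Zsemi> \<tau>)"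
  "Var \<Zsemi> \<sigma> = \<sigma>" "\<sigma> \<Zsemi> Var = \<sigma>"
  "(\<sigma> \<Zsemi> \<tau>) \<Zsemi> \<rho> = \<sigma> \<Zsemi> \<tau> \<Zsemi> \<rho>"
  "(\<sigma> \<Zsemi> \<tau>) n = sub \<tau> (\<sigma> n)"
  by (auto simp: cmp_def intro!: scons_ext)

lemma sh_simps [simp]:
  "sh k n = Var (n + k)" "sh 0 = Var"
  "sh k \<Zsemi> sh l = sh (k + l)"
  "sh k \<Zsemi> sh l \<Zsemi> \<sigma> = sh (k + l) \<Zsemi> \<sigma>"
  "sh (Suc k) \<Zsemi> (a \<bullet> \<sigma>) = sh k \<Zsemi> \<sigma>"
  "sh 1 \<Zsemi> (a \<bullet> \<sigma>) = \<sigma>"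
  "sh (numeral v) \<Zsemi> (a \<bullet> \<sigma>) = sh (pred_numeral v) \<Zsemi> \<sigma>"
  by (auto simp: cmp_def sh_def fun_eq_iff ac_simps numeral_eq_Suc One_nat_def)

text \<open>The last equation is the general \<eta>-law. Its instances at shifts are listed because
  their left-hand sides are evaluated first and then no longer match it.\<close>

lemma scons_eta [simp]:
  "Var 0 \<bullet> sh 1 = Var" "Var 1 \<bullet> sh 2 = sh 1" "Var 2 \<bullet> sh 3 = sh 2" "Var 3 \<bullet> sh 4 = sh 3"
  "\<sigma> 0 \<bullet> (sh 1 \<Zsemi> \<sigma>) = \<sigma>"
  by (auto simp: cmp_def sh_def numeral_eq_Suc One_nat_def intro!: scons_ext)

lemma sub_binders [simp]:
  "sub \<sigma> (TPi A B) = TPi (sub \<sigma> A) (sub (lift \<sigma>) B)"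
  "sub \<sigma> (TLam A b) = TLam (sub \<sigma> A) (sub (lift \<sigma>) b)"
  "sub \<sigma> (TSigma A B) = TSigma (sub \<sigma> A) (sub (lift \<sigma>) B)"
  "sub \<sigma> (TIndSigma C g p) =
     TIndSigma (sub (lift \<sigma>) C) (sub (lift (lift \<sigma>)) g) (sub \<sigma> p)"
  "sub \<sigma> (TJ C c a b p) =
     TJ (sub (lift (lift (lift \<sigma>))) C) (sub (lift \<sigma>) c) (sub \<sigma> a) (sub \<sigma> b) (sub \<sigma> p)"
  by (simp_all only: sub.simps up_lift)

declare sub.simps(2,5,7,9,10,12-16) [simp]

lemma ren_sh: "ren (up_ren (\<lambda>n. n + k)) t = sub (Var 0 \<bullet> sh (Suc k)) t"
  by (subst ren_as_sub, rule arg_cong[where f="\<lambda>\<sigma>. sub \<sigma> t"], rule scons_ext) auto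

text \<open>The given definitions express weakening by \<open>ren\<close>; these variants are in the
  normal form of the calculus.\<close>

lemmas arr_def' = arr_def[unfolded wk_sh]
lemmas prd_def' = prd_def[unfolded wk_sh]
lemmas is_prop_def' = is_prop_def[unfolded wk_sh]
lemmas is_set_def' = is_set_def[unfolded wk_sh]
lemmas is_groupoid_def' = is_groupoid_def[unfolded wk_sh]
lemmas is_equiv_def' = is_equiv_def[unfolded wk_sh]
lemmas equiv_ty_def' = equiv_ty_def[unfolded wk_sh]
lemmas concat_path_def' = concat_path_def[unfolded wk_sh]
lemmas homotopy_def' = homotopy_def[unfolded wk_sh]
lemmas happly_def' = happly_def[unfolded wk_sh ren_sh]
lemmas precomp_trunc_def' = precomp_trunc_def[unfolded wk_sh]
lemmas const_ty_def' = const_ty_def[unfolded wk_sh]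
lemmas coh_ty_def' = coh_ty_def[unfolded wk_sh Let_def]
lemmas coherent_maps_def' = coherent_maps_def[unfolded wk_sh]

lemma sub_defs1 [simp]:
  "sub \<sigma> (arr A B) = arr (sub \<sigma> A) (sub \<sigma> B)"
  "sub \<sigma> (prd A B) = prd (sub \<sigma> A) (sub \<sigma> B)"
  "sub \<sigma> (is_prop A) = is_prop (sub \<sigma> A)"
  by (simp_all add: arr_def' prd_def' is_prop_def')

lemma sub_defs2 [simp]:
  "sub \<sigma> (is_set A) = is_set (sub \<sigma> A)"
  "sub \<sigma> (concat_path A x y z p q) =
     concat_path (sub \<sigma> A) (sub \<sigma> x) (sub \<sigma> y) (sub \<sigma> z) (sub \<sigma> p) (sub \<sigma> q)"
  by (simp_all add: is_set_def' concat_path_def')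

lemma sub_defs [simp]:
  "sub \<sigma> (is_groupoid A) = is_groupoid (sub \<sigma> A)"
  "sub \<sigma> (is_equiv A B f) = is_equiv (sub \<sigma> A) (sub \<sigma> B) (sub \<sigma> f)"
  "sub \<sigma> (homotopy A C f g) = homotopy (sub \<sigma> A) (sub (lift \<sigma>) C) (sub \<sigma> f) (sub \<sigma> g)"
  "sub \<sigma> (precomp_trunc A B) = precomp_trunc (sub \<sigma> A) (sub \<sigma> B)"
  "sub \<sigma> (const_ty A B f) = const_ty (sub \<sigma> A) (sub \<sigma> B) (sub \<sigma> f)"
  "sub \<sigma> (coh_ty A B f c) = coh_ty (sub \<sigma> A) (sub \<sigma> B) (sub \<sigma> f) (sub \<sigma> c)"
  by (simp_all add: is_groupoid_def' homotopy_def' is_equiv_def'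
   precomp_trunc_def' const_ty_def' coh_ty_def')

lemma sub_happly [simp]:
  "sub \<sigma> (happly A C f g) = happly (sub \<sigma> A) (sub (lift \<sigma>) C) (sub \<sigma> f) (sub \<sigma> g)"
  by (simp add: happly_def')

lemma sub_coherent_maps [simp]:
  "sub \<sigma> (coherent_maps A B) = coherent_maps (sub \<sigma> A) (sub \<sigma> B)"
  "sub \<sigma> (equiv_ty A B) = equiv_ty (sub \<sigma> A) (sub \<sigma> B)"
  by (simp_all add: coherent_maps_def' equiv_ty_def')

section \<open>Stability of the judgements under substitution\<close>

definition subst_ok :: "tm list \<Rightarrow> (nat \<Rightarrow> tm) \<Rightarrow> tm list \<Rightarrow> bool" where
  "subst_ok \<Delta> \<sigma> \<Gamma> \<longleftrightarrow> wf_ctx \<Delta> \<and> (\<forall>n < length \<Gamma>. \<Delta> \<turnstile> \<sigma> n \<^bold>: sub \<sigma> ((\<Gamma> ! n) \<Up> Suc n))"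

text \<open>
  \<open>K\<close> stands for a class of substitutions closed under lifting: first the renamings, then, since
  lifting a substitution weakens its terms, all well-typed substitutions. As \<open>ty_lam\<close> has no
  premise on the type of the bound variable, the induction must carry the stability of the types
  in the context.
\<close>

primrec stable_ctx :: "(tm list \<Rightarrow> (nat \<Rightarrow> tm) \<Rightarrow> tm list \<Rightarrow> bool) \<Rightarrow> tm list \<Rightarrow> bool" where
  "stable_ctx K [] \<longleftrightarrow> True"
| "stable_ctx K (A # \<Gamma>) \<longleftrightarrow> stable_ctx K \<Gamma> \<and>
     (\<forall>\<Delta> \<sigma>. K \<Delta> \<sigma> \<Gamma> \<longrightarrow> (\<exists>i. \<Delta> \<turnstile> sub \<sigma> A \<^bold>: TUniv i))"

lemma stable_ctx_lift:
  assumes "\<And>\<Delta> \<sigma> \<Gamma> A i. K \<Delta> \<sigma> \<Gamma> \<Longrightarrow> \<Delta> \<turnstile> sub \<sigma> A \<^bold>: TUniv i \<Longrightarrow> K (sub \<sigma> A # \<Delta>) (lift \<sigma>) (A # \<Gamma>)"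
    and "K \<Delta> \<sigma> \<Gamma>" and "stable_ctx K (A # \<Gamma>)"
  shows "K (sub \<sigma> A # \<Delta>) (lift \<sigma>) (A # \<Gamma>)"
  using assms(2,3) by (auto intro: assms(1))

theorem judgements_stable:
  assumes ok: "\<And>\<Delta> \<sigma> \<Gamma>. K \<Delta> \<sigma> \<Gamma> \<Longrightarrow> subst_ok \<Delta> \<sigma> \<Gamma>"
    and ext: "\<And>\<Delta> \<sigma> \<Gamma> A i. K \<Delta> \<sigma> \<Gamma> \<Longrightarrow> \<Delta> \<turnstile> sub \<sigma> A \<^bold>: TUniv i \<Longrightarrow> K (sub \<sigma> A # \<Delta>) (lift \<sigma>) (A # \<Gamma>)"
  shows "wf_ctx \<Gamma> \<Longrightarrow> stable_ctx K \<Gamma>"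
    and "\<Gamma> \<turnstile> a \<^bold>: A \<Longrightarrow> stable_ctx K \<Gamma> \<and> (\<forall>\<Delta> \<sigma>. K \<Delta> \<sigma> \<Gamma> \<longrightarrow> \<Delta> \<turnstile> sub \<sigma> a \<^bold>: sub \<sigma> A)"
    and "\<Gamma> \<turnstile> a \<^bold>\<equiv> b \<^bold>: A \<Longrightarrow>
      stable_ctx K \<Gamma> \<and> (\<forall>\<Delta> \<sigma>. K \<Delta> \<sigma> \<Gamma> \<longrightarrow> \<Delta> \<turnstile> sub \<sigma> a \<^bold>\<equiv> sub \<sigma> b \<^bold>: sub \<sigma> A)"
proof (induction rule: wf_ctx_has_type_jeq.inducts)
  case ctx_empty
  show ?case by simp
next
  case ctx_extend
  then show ?case by auto
next
  case ty_var
  then show ?case using ok unfolding wk_sh by (simp add: subst_ok_def)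
next
  case ty_univ
  then show ?case using ok unfolding subst_ok_def by (auto intro: wf_ctx_has_type_jeq.ty_univ)
next
  case ty_cumul
  then show ?case by (simp add: wf_ctx_has_type_jeq.ty_cumul)
next
  case (ty_pi \<Gamma> A i B)
  note IH = ty_pi.IH[THEN conjunct2, rule_format, unfolded wk_sh fold_sh]
      and st = ty_pi.IH[THEN conjunct1, unfolded wk_sh]
  show ?case
  proof (intro conjI allI impI, goal_cases)
    case K: (2 \<Delta> \<sigma>)
    \<comment> \<open>Lifting needs a universe for the type of the bound variable. It comes from the
      first half of the induction hypothesis, the stability of the extended context.\<close>
    have K1: "K (sub \<sigma> A # \<Delta>) (lift \<sigma>) (A # \<Gamma>)"
      by (rule stable_ctx_lift[of K, OF _ K]) (use st in \<open>auto intro: ext\<close>)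
    show ?case
      using IH(1)[OF K] IH(2)[OF K1]
        wf_ctx_has_type_jeq.ty_pi[unfolded wk_sh fold_sh, where \<Gamma> = \<Delta> and A = "sub \<sigma> A"
            and B = "sub (lift \<sigma>) B"]
      by (simp add: wk_sh fold_sh)
  qed (use st in auto)
next
  case (ty_lam A \<Gamma> b B)
  note IH = ty_lam.IH[THEN conjunct2, rule_format, unfolded wk_sh fold_sh]
      and st = ty_lam.IH[THEN conjunct1, unfolded wk_sh]
  show ?case
  proof (intro conjI allI impI, goal_cases)
    case K: (2 \<Delta> \<sigma>)
    have K1: "K (sub \<sigma> A # \<Delta>) (lift \<sigma>) (A # \<Gamma>)"
      by (rule stable_ctx_lift[of K, OF _ K]) (use st in \<open>auto intro: ext\<close>)
    show ?case
      using IH[OF K1]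
        wf_ctx_has_type_jeq.ty_lam[unfolded wk_sh fold_sh, where \<Gamma> = \<Delta> and A = "sub \<sigma> A"
            and b = "sub (lift \<sigma>) b" and B = "sub (lift \<sigma>) B"]
      by (simp add: wk_sh fold_sh)
  qed (use st in auto)
next
  case (ty_app \<Gamma> f A B a)
  note IH = ty_app.IH[THEN conjunct2, rule_format, unfolded wk_sh fold_sh]
      and st = ty_app.IH[THEN conjunct1, unfolded wk_sh]
  show ?case
  proof (intro conjI allI impI, goal_cases)
    case K: (2 \<Delta> \<sigma>)
    show ?case
      using IH(1)[OF K] IH(2)[OF K]
        wf_ctx_has_type_jeq.ty_app[unfolded wk_sh fold_sh, where \<Gamma> = \<Delta> and f = "sub \<sigma> f"
            and A = "sub \<sigma> A" and B = "sub (lift \<sigma>) B" and a = "sub \<sigma> a"]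
      by (simp add: wk_sh fold_sh)
  qed (use st in auto)
next
  case (ty_sigma \<Gamma> A i B)
  note IH = ty_sigma.IH[THEN conjunct2, rule_format, unfolded wk_sh fold_sh]
      and st = ty_sigma.IH[THEN conjunct1, unfolded wk_sh]
  show ?case
  proof (intro conjI allI impI, goal_cases)
    case K: (2 \<Delta> \<sigma>)
    have K1: "K (sub \<sigma> A # \<Delta>) (lift \<sigma>) (A # \<Gamma>)"
      by (rule stable_ctx_lift[of K, OF _ K]) (use st in \<open>auto intro: ext\<close>)
    show ?case
      using IH(1)[OF K] IH(2)[OF K1]
        wf_ctx_has_type_jeq.ty_sigma[unfolded wk_sh fold_sh, where \<Gamma> = \<Delta> and A = "sub \<sigma> A"
            and B = "sub (lift \<sigma>) B"]
      by (simp add: wk_sh fold_sh)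
  qed (use st in auto)
next
  case (ty_pair A \<Gamma> B i a b)
  note IH = ty_pair.IH[THEN conjunct2, rule_format, unfolded wk_sh fold_sh]
      and st = ty_pair.IH[THEN conjunct1, unfolded wk_sh]
  show ?case
  proof (intro conjI allI impI, goal_cases)
    case K: (2 \<Delta> \<sigma>)
    have K1: "K (sub \<sigma> A # \<Delta>) (lift \<sigma>) (A # \<Gamma>)"
      by (rule stable_ctx_lift[of K, OF _ K]) (use st in \<open>auto intro: ext\<close>)
    show ?case
      using IH(1)[OF K1] IH(2)[OF K] IH(3)[OF K]
        wf_ctx_has_type_jeq.ty_pair[unfolded wk_sh fold_sh, where \<Gamma> = \<Delta> and A = "sub \<sigma> A"
            and B = "sub (lift \<sigma>) B" and a = "sub \<sigma> a" and b = "sub \<sigma> b"]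
      by (simp add: wk_sh fold_sh)
  qed (use st in auto)
next
  case (ty_ind_sigma A B \<Gamma> C i g p)
  note IH = ty_ind_sigma.IH[THEN conjunct2, rule_format, unfolded wk_sh fold_sh]
      and st = ty_ind_sigma.IH[THEN conjunct1, unfolded wk_sh]
  show ?case
  proof (intro conjI allI impI, goal_cases)
    case K: (2 \<Delta> \<sigma>)
    have K1: "K (sub \<sigma> A # \<Delta>) (lift \<sigma>) (A # \<Gamma>)"
      by (rule stable_ctx_lift[of K, OF _ K]) (use st in \<open>auto intro: ext\<close>)
    have K2: "K (sub (lift \<sigma>) B # sub \<sigma> A # \<Delta>) (lift (lift \<sigma>)) (B # A # \<Gamma>)"
      by (rule stable_ctx_lift[of K, OF _ K1]) (use st in \<open>auto intro: ext\<close>)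
    \<comment> \<open>The motive lives over the whole sum and the branch over its two components, so
      they need different lifts.\<close>
    have Ks: "K (sub \<sigma> (TSigma A B) # \<Delta>) (lift \<sigma>) (TSigma A B # \<Gamma>)"
      by (rule stable_ctx_lift[of K, OF _ K]) (use st in \<open>auto intro: ext\<close>)
    show ?case
      using IH(1)[OF Ks] IH(2)[OF K2] IH(3)[OF K]
        wf_ctx_has_type_jeq.ty_ind_sigma[unfolded wk_sh fold_sh, where \<Gamma> = \<Delta> and A = "sub \<sigma> A"
            and B = "sub (lift \<sigma>) B" and C = "sub (lift \<sigma>) C" and g = "sub (lift (lift \<sigma>)) g"
            and p = "sub \<sigma> p"]
      by (simp add: wk_sh fold_sh)
  qed (use st in auto)
next
  case ty_id
  then show ?case by (simp add: wf_ctx_has_type_jeq.ty_id)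
next
  case ty_refl
  then show ?case by (simp add: wf_ctx_has_type_jeq.ty_refl)
next
  case (ty_J A \<Gamma> C i c a b p)
  note IH = ty_J.IH[THEN conjunct2, rule_format, unfolded wk_sh fold_sh]
      and st = ty_J.IH[THEN conjunct1, unfolded wk_sh]
  show ?case
  proof (intro conjI allI impI, goal_cases)
    case K: (2 \<Delta> \<sigma>)
    have K1: "K (sub \<sigma> A # \<Delta>) (lift \<sigma>) (A # \<Gamma>)"
      by (rule stable_ctx_lift[of K, OF _ K]) (use st in \<open>auto intro: ext\<close>)
    have K2: "K (sub (lift \<sigma>) (A \<Up> 1) # sub \<sigma> A # \<Delta>) (lift (lift \<sigma>)) (A \<Up> 1 # A # \<Gamma>)"
      by (rule stable_ctx_lift[of K, OF _ K1]) (use st in \<open>auto intro: ext\<close>)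
    have Kj: "K (sub (lift (lift \<sigma>)) (TId (A \<Up> 2) (Var 1) (Var 0)) # sub (lift \<sigma>) (A \<Up> 1) # sub \<sigma>
        A # \<Delta>)
      (lift (lift (lift \<sigma>))) (TId (A \<Up> 2) (Var 1) (Var 0) # A \<Up> 1 # A # \<Gamma>)"
      by (rule stable_ctx_lift[of K, OF _ K2]) (use st in \<open>auto intro: ext\<close>)
    show ?case
      using IH(1)[OF Kj] IH(2)[OF K1] IH(3)[OF K] IH(4)[OF K] IH(5)[OF K]
        wf_ctx_has_type_jeq.ty_J[unfolded wk_sh fold_sh, where \<Gamma> = \<Delta> and A = "sub \<sigma> A"
            and C = "sub (lift (lift (lift \<sigma>))) C" and c = "sub (lift \<sigma>) c" and a = "sub \<sigma> a"
            and b = "sub \<sigma> b" and p = "sub \<sigma> p"]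
      by (simp add: wk_sh fold_sh)
  qed (use st in auto)
next
  case ty_funext
  then show ?case by (simp add: wf_ctx_has_type_jeq.ty_funext)
next
  case ty_trunc
  then show ?case by (simp add: wf_ctx_has_type_jeq.ty_trunc)
next
  case ty_trunc_in
  then show ?case by (simp add: wf_ctx_has_type_jeq.ty_trunc_in)
next
  case ty_trunc_eq
  then show ?case by (simp add: wf_ctx_has_type_jeq.ty_trunc_eq)
next
  case ty_trunc_up
  then show ?case by (auto intro!: wf_ctx_has_type_jeq.ty_trunc_up)
next
  case ty_conv
  then show ?case by (metis wf_ctx_has_type_jeq.ty_conv sub.simps(2))
next
  case eq_refl
  then show ?case by (simp add: wf_ctx_has_type_jeq.eq_refl)
next
  case eq_sym
  then show ?case by (metis wf_ctx_has_type_jeq.eq_sym)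
next
  case eq_trans
  then show ?case by (metis wf_ctx_has_type_jeq.eq_trans)
next
  case eq_conv
  then show ?case by (metis wf_ctx_has_type_jeq.eq_conv sub.simps(2))
next
  case eq_cumul
  then show ?case by (simp add: wf_ctx_has_type_jeq.eq_cumul)
next
  case (beta_pi A \<Gamma> b B a)
  note IH = beta_pi.IH[THEN conjunct2, rule_format, unfolded wk_sh fold_sh]
      and st = beta_pi.IH[THEN conjunct1, unfolded wk_sh]
  show ?case
  proof (intro conjI allI impI, goal_cases)
    case K: (2 \<Delta> \<sigma>)
    have K1: "K (sub \<sigma> A # \<Delta>) (lift \<sigma>) (A # \<Gamma>)"
      by (rule stable_ctx_lift[of K, OF _ K]) (use st in \<open>auto intro: ext\<close>)
    show ?case
      using IH(1)[OF K1] IH(2)[OF K]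
        wf_ctx_has_type_jeq.beta_pi[unfolded wk_sh fold_sh, where \<Gamma> = \<Delta> and A = "sub \<sigma> A"
            and b = "sub (lift \<sigma>) b" and B = "sub (lift \<sigma>) B" and a = "sub \<sigma> a"]
      by (simp add: wk_sh fold_sh)
  qed (use st in auto)
next
  case (eta_pi \<Gamma> f A B)
  note IH = eta_pi.IH[THEN conjunct2, rule_format, unfolded wk_sh fold_sh]
      and st = eta_pi.IH[THEN conjunct1, unfolded wk_sh]
  show ?case
  proof (intro conjI allI impI, goal_cases)
    case K: (2 \<Delta> \<sigma>)
    show ?case
      using IH[OF K]
        wf_ctx_has_type_jeq.eta_pi[unfolded wk_sh fold_sh, where \<Gamma> = \<Delta> and f = "sub \<sigma> f"
            and A = "sub \<sigma> A" and B = "sub (lift \<sigma>) B"]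
      by (simp add: wk_sh fold_sh)
  qed (use st in auto)
next
  case (beta_sigma A B \<Gamma> C i g a b)
  note IH = beta_sigma.IH[THEN conjunct2, rule_format, unfolded wk_sh fold_sh]
      and st = beta_sigma.IH[THEN conjunct1, unfolded wk_sh]
  show ?case
  proof (intro conjI allI impI, goal_cases)
    case K: (2 \<Delta> \<sigma>)
    have K1: "K (sub \<sigma> A # \<Delta>) (lift \<sigma>) (A # \<Gamma>)"
      by (rule stable_ctx_lift[of K, OF _ K]) (use st in \<open>auto intro: ext\<close>)
    have K2: "K (sub (lift \<sigma>) B # sub \<sigma> A # \<Delta>) (lift (lift \<sigma>)) (B # A # \<Gamma>)"
      by (rule stable_ctx_lift[of K, OF _ K1]) (use st in \<open>auto intro: ext\<close>)
    have Ks: "K (sub \<sigma> (TSigma A B) # \<Delta>) (lift \<sigma>) (TSigma A B # \<Gamma>)"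
      by (rule stable_ctx_lift[of K, OF _ K]) (use st in \<open>auto intro: ext\<close>)
    show ?case
      using IH(1)[OF Ks] IH(2)[OF K2] IH(3)[OF K] IH(4)[OF K]
        wf_ctx_has_type_jeq.beta_sigma[unfolded wk_sh fold_sh, where \<Gamma> = \<Delta> and A = "sub \<sigma> A"
            and B = "sub (lift \<sigma>) B" and C = "sub (lift \<sigma>) C" and g = "sub (lift (lift \<sigma>)) g"
            and a = "sub \<sigma> a" and b = "sub \<sigma> b"]
      by (simp add: wk_sh fold_sh)
  qed (use st in auto)
next
  case (beta_J A \<Gamma> C i c a)
  note IH = beta_J.IH[THEN conjunct2, rule_format, unfolded wk_sh fold_sh]
      and st = beta_J.IH[THEN conjunct1, unfolded wk_sh]
  show ?case
  proof (intro conjI allI impI, goal_cases)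
    case K: (2 \<Delta> \<sigma>)
    have K1: "K (sub \<sigma> A # \<Delta>) (lift \<sigma>) (A # \<Gamma>)"
      by (rule stable_ctx_lift[of K, OF _ K]) (use st in \<open>auto intro: ext\<close>)
    have K2: "K (sub (lift \<sigma>) (A \<Up> 1) # sub \<sigma> A # \<Delta>) (lift (lift \<sigma>)) (A \<Up> 1 # A # \<Gamma>)"
      by (rule stable_ctx_lift[of K, OF _ K1]) (use st in \<open>auto intro: ext\<close>)
    have Kj: "K (sub (lift (lift \<sigma>)) (TId (A \<Up> 2) (Var 1) (Var 0)) # sub (lift \<sigma>) (A \<Up> 1) # sub \<sigma>
        A # \<Delta>)
      (lift (lift (lift \<sigma>))) (TId (A \<Up> 2) (Var 1) (Var 0) # A \<Up> 1 # A # \<Gamma>)"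
      by (rule stable_ctx_lift[of K, OF _ K2]) (use st in \<open>auto intro: ext\<close>)
    show ?case
      using IH(1)[OF Kj] IH(2)[OF K1] IH(3)[OF K]
        wf_ctx_has_type_jeq.beta_J[unfolded wk_sh fold_sh, where \<Gamma> = \<Delta> and A = "sub \<sigma> A"
            and C = "sub (lift (lift (lift \<sigma>))) C" and c = "sub (lift \<sigma>) c" and a = "sub \<sigma> a"]
      by (simp add: wk_sh fold_sh)
  qed (use st in auto)
next
  case (cong_pi \<Gamma> A A' i B B')
  note IH = cong_pi.IH[THEN conjunct2, rule_format, unfolded wk_sh fold_sh]
      and st = cong_pi.IH[THEN conjunct1, unfolded wk_sh]
  show ?case
  proof (intro conjI allI impI, goal_cases)
    case K: (2 \<Delta> \<sigma>)
    have K1: "K (sub \<sigma> A # \<Delta>) (lift \<sigma>) (A # \<Gamma>)"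
      by (rule stable_ctx_lift[of K, OF _ K]) (use st in \<open>auto intro: ext\<close>)
    show ?case
      using IH(1)[OF K] IH(2)[OF K1]
        wf_ctx_has_type_jeq.cong_pi[unfolded wk_sh fold_sh, where \<Gamma> = \<Delta> and A = "sub \<sigma> A"
            and A' = "sub \<sigma> A'" and B = "sub (lift \<sigma>) B" and B' = "sub (lift \<sigma>) B'"]
      by (simp add: wk_sh fold_sh)
  qed (use st in auto)
next
  case (cong_lam \<Gamma> A A' i b b' B)
  note IH = cong_lam.IH[THEN conjunct2, rule_format, unfolded wk_sh fold_sh]
      and st = cong_lam.IH[THEN conjunct1, unfolded wk_sh]
  show ?case
  proof (intro conjI allI impI, goal_cases)
    case K: (2 \<Delta> \<sigma>)
    have K1: "K (sub \<sigma> A # \<Delta>) (lift \<sigma>) (A # \<Gamma>)"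
      by (rule stable_ctx_lift[of K, OF _ K]) (use st in \<open>auto intro: ext\<close>)
    show ?case
      using IH(1)[OF K] IH(2)[OF K1]
        wf_ctx_has_type_jeq.cong_lam[unfolded wk_sh fold_sh, where \<Gamma> = \<Delta> and A = "sub \<sigma> A"
            and A' = "sub \<sigma> A'" and b = "sub (lift \<sigma>) b" and b' = "sub (lift \<sigma>) b'"
            and B = "sub (lift \<sigma>) B"]
      by (simp add: wk_sh fold_sh)
  qed (use st in auto)
next
  case (cong_app \<Gamma> f f' A B a a')
  note IH = cong_app.IH[THEN conjunct2, rule_format, unfolded wk_sh fold_sh]
      and st = cong_app.IH[THEN conjunct1, unfolded wk_sh]
  show ?case
  proof (intro conjI allI impI, goal_cases)
    case K: (2 \<Delta> \<sigma>)
    show ?case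
      using IH(1)[OF K] IH(2)[OF K]
        wf_ctx_has_type_jeq.cong_app[unfolded wk_sh fold_sh, where \<Gamma> = \<Delta> and f = "sub \<sigma> f"
            and f' = "sub \<sigma> f'" and A = "sub \<sigma> A" and B = "sub (lift \<sigma>) B" and a = "sub \<sigma> a"
            and a' = "sub \<sigma> a'"]
      by (simp add: wk_sh fold_sh)
  qed (use st in auto)
next
  case (cong_sigma \<Gamma> A A' i B B')
  note IH = cong_sigma.IH[THEN conjunct2, rule_format, unfolded wk_sh fold_sh]
      and st = cong_sigma.IH[THEN conjunct1, unfolded wk_sh]
  show ?case
  proof (intro conjI allI impI, goal_cases)
    case K: (2 \<Delta> \<sigma>)
    have K1: "K (sub \<sigma> A # \<Delta>) (lift \<sigma>) (A # \<Gamma>)"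
      by (rule stable_ctx_lift[of K, OF _ K]) (use st in \<open>auto intro: ext\<close>)
    show ?case
      using IH(1)[OF K] IH(2)[OF K1]
        wf_ctx_has_type_jeq.cong_sigma[unfolded wk_sh fold_sh, where \<Gamma> = \<Delta> and A = "sub \<sigma> A"
            and A' = "sub \<sigma> A'" and B = "sub (lift \<sigma>) B" and B' = "sub (lift \<sigma>) B'"]
      by (simp add: wk_sh fold_sh)
  qed (use st in auto)
next
  case (cong_pair A \<Gamma> B i a a' b b')
  note IH = cong_pair.IH[THEN conjunct2, rule_format, unfolded wk_sh fold_sh]
      and st = cong_pair.IH[THEN conjunct1, unfolded wk_sh]
  show ?case
  proof (intro conjI allI impI, goal_cases)
    case K: (2 \<Delta> \<sigma>)
    have K1: "K (sub \<sigma> A # \<Delta>) (lift \<sigma>) (A # \<Gamma>)"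
      by (rule stable_ctx_lift[of K, OF _ K]) (use st in \<open>auto intro: ext\<close>)
    show ?case
      using IH(1)[OF K1] IH(2)[OF K] IH(3)[OF K]
        wf_ctx_has_type_jeq.cong_pair[unfolded wk_sh fold_sh, where \<Gamma> = \<Delta> and A = "sub \<sigma> A"
            and B = "sub (lift \<sigma>) B" and a = "sub \<sigma> a" and a' = "sub \<sigma> a'" and b = "sub \<sigma> b"
            and b' = "sub \<sigma> b'"]
      by (simp add: wk_sh fold_sh)
  qed (use st in auto)
next
  case (cong_ind_sigma A B \<Gamma> C C' i g g' p p')
  note IH = cong_ind_sigma.IH[THEN conjunct2, rule_format, unfolded wk_sh fold_sh]
      and st = cong_ind_sigma.IH[THEN conjunct1, unfolded wk_sh]
  show ?case
  proof (intro conjI allI impI, goal_cases)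
    case K: (2 \<Delta> \<sigma>)
    have K1: "K (sub \<sigma> A # \<Delta>) (lift \<sigma>) (A # \<Gamma>)"
      by (rule stable_ctx_lift[of K, OF _ K]) (use st in \<open>auto intro: ext\<close>)
    have K2: "K (sub (lift \<sigma>) B # sub \<sigma> A # \<Delta>) (lift (lift \<sigma>)) (B # A # \<Gamma>)"
      by (rule stable_ctx_lift[of K, OF _ K1]) (use st in \<open>auto intro: ext\<close>)
    have Ks: "K (sub \<sigma> (TSigma A B) # \<Delta>) (lift \<sigma>) (TSigma A B # \<Gamma>)"
      by (rule stable_ctx_lift[of K, OF _ K]) (use st in \<open>auto intro: ext\<close>)
    show ?case
      using IH(1)[OF Ks] IH(2)[OF K2] IH(3)[OF K]
        wf_ctx_has_type_jeq.cong_ind_sigma[unfolded wk_sh fold_sh, where \<Gamma> = \<Delta> and A = "sub \<sigma> A"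
            and B = "sub (lift \<sigma>) B" and C = "sub (lift \<sigma>) C" and C' = "sub (lift \<sigma>) C'"
            and g = "sub (lift (lift \<sigma>)) g" and g' = "sub (lift (lift \<sigma>)) g'" and p = "sub \<sigma> p"
            and p' = "sub \<sigma> p'"]
      by (simp add: wk_sh fold_sh)
  qed (use st in auto)
next
  case cong_id
  then show ?case by (simp add: wf_ctx_has_type_jeq.cong_id)
next
  case cong_refl
  then show ?case by (simp add: wf_ctx_has_type_jeq.cong_refl)
next
  case (cong_J A \<Gamma> C C' i c c' a a' b b' p p')
  note IH = cong_J.IH[THEN conjunct2, rule_format, unfolded wk_sh fold_sh]
      and st = cong_J.IH[THEN conjunct1, unfolded wk_sh]
  show ?case
  proof (intro conjI allI impI, goal_cases)
    case K: (2 \<Delta> \<sigma>)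
    have K1: "K (sub \<sigma> A # \<Delta>) (lift \<sigma>) (A # \<Gamma>)"
      by (rule stable_ctx_lift[of K, OF _ K]) (use st in \<open>auto intro: ext\<close>)
    have K2: "K (sub (lift \<sigma>) (A \<Up> 1) # sub \<sigma> A # \<Delta>) (lift (lift \<sigma>)) (A \<Up> 1 # A # \<Gamma>)"
      by (rule stable_ctx_lift[of K, OF _ K1]) (use st in \<open>auto intro: ext\<close>)
    have Kj: "K (sub (lift (lift \<sigma>)) (TId (A \<Up> 2) (Var 1) (Var 0)) # sub (lift \<sigma>) (A \<Up> 1) # sub \<sigma>
        A # \<Delta>)
      (lift (lift (lift \<sigma>))) (TId (A \<Up> 2) (Var 1) (Var 0) # A \<Up> 1 # A # \<Gamma>)"
      by (rule stable_ctx_lift[of K, OF _ K2]) (use st in \<open>auto intro: ext\<close>)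
    show ?case
      using IH(1)[OF Kj] IH(2)[OF K1] IH(3)[OF K] IH(4)[OF K] IH(5)[OF K]
        wf_ctx_has_type_jeq.cong_J[unfolded wk_sh fold_sh, where \<Gamma> = \<Delta> and A = "sub \<sigma> A"
            and C = "sub (lift (lift (lift \<sigma>))) C" and C' = "sub (lift (lift (lift \<sigma>))) C'"
            and c = "sub (lift \<sigma>) c" and c' = "sub (lift \<sigma>) c'" and a = "sub \<sigma> a"
            and a' = "sub \<sigma> a'" and b = "sub \<sigma> b" and b' = "sub \<sigma> b'" and p = "sub \<sigma> p"
            and p' = "sub \<sigma> p'"]
      by (simp add: wk_sh fold_sh)
  qed (use st in auto)
next
  case cong_funext
  then show ?case by (simp add: wf_ctx_has_type_jeq.cong_funext)
next
  case cong_trunc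
  then show ?case by (simp add: wf_ctx_has_type_jeq.cong_trunc)
next
  case cong_trunc_in
  then show ?case by (simp add: wf_ctx_has_type_jeq.cong_trunc_in)
next
  case cong_trunc_eq
  then show ?case by (simp add: wf_ctx_has_type_jeq.cong_trunc_eq)
next
  case cong_trunc_up
  then show ?case by (auto intro!: wf_ctx_has_type_jeq.cong_trunc_up)
qed

text \<open>From here \<open>Suc 0\<close> normalises to \<open>1\<close> and \<open>n + 1\<close>
  to \<open>Suc n\<close>, the forms in which the rules for concrete contexts are written.\<close>

declare One_nat_def [symmetric, simp] Suc_eq_plus1 [symmetric, simp]

section \<open>Weakening and instantiation\<close>

text \<open>Claimed for all suffixes because the only premise of \<open>ty_lam\<close> lives in the
  extended context; the context of its conclusion is recovered by dropping the bound
  variable.\<close>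

lemma wf_ctx_drop:
  shows "wf_ctx \<Gamma> \<Longrightarrow> \<forall>n. wf_ctx (drop n \<Gamma>)"
    and "\<Gamma> \<turnstile> a \<^bold>: A \<Longrightarrow> \<forall>n. wf_ctx (drop n \<Gamma>)"
    and "\<Gamma> \<turnstile> a \<^bold>\<equiv> b \<^bold>: A \<Longrightarrow> \<forall>n. wf_ctx (drop n \<Gamma>)"
proof (induction rule: wf_ctx_has_type_jeq.inducts)
  case (ctx_extend \<Gamma> A i)
  then have "wf_ctx (drop n (A # \<Gamma>))" for n
    by (cases n) (auto intro: wf_ctx_has_type_jeq.ctx_extend)
  then show ?case ..
qed (auto intro: wf_ctx_has_type_jeq.ctx_empty, metis drop_Suc_Cons)

lemma wf_ctxI: "\<Gamma> \<turnstile> a \<^bold>: A \<Longrightarrow> wf_ctx \<Gamma>"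
  using wf_ctx_drop(2)[of \<Gamma> a A] by (metis drop_0)

text \<open>Variables go to variables whose declared types agree syntactically, so extending such a
  map under a binder requires no typing derivation to be weakened. This makes renamings the base
  case for all substitutions.\<close>

definition ren_ok :: "tm list \<Rightarrow> (nat \<Rightarrow> tm) \<Rightarrow> tm list \<Rightarrow> bool" where
  "ren_ok \<Delta> \<sigma> \<Gamma> \<longleftrightarrow> wf_ctx \<Delta> \<and> (\<forall>n < length \<Gamma>. \<exists>m < length \<Delta>.
     \<sigma> n = Var m \<and> (\<Delta> ! m) \<Up> Suc m = sub \<sigma> ((\<Gamma> ! n) \<Up> Suc n))"

lemma ren_ok_subst_ok: "ren_ok \<Delta> \<sigma> \<Gamma> \<Longrightarrow> subst_ok \<Delta> \<sigma> \<Gamma>"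
  unfolding ren_ok_def subst_ok_def using ty_var[unfolded wk_sh] by metis

lemma ren_ok_lift:
  assumes "ren_ok \<Delta> \<sigma> \<Gamma>" "\<Delta> \<turnstile> sub \<sigma> A \<^bold>: TUniv i"
  shows "ren_ok (sub \<sigma> A # \<Delta>) (lift \<sigma>) (A # \<Gamma>)"
  unfolding ren_ok_def
proof (intro conjI allI impI)
  show "wf_ctx (sub \<sigma> A # \<Delta>)" using assms(2) by (rule ctx_extend)
  fix n assume n: "n < length (A # \<Gamma>)"
  show "\<exists>m < length (sub \<sigma> A # \<Delta>). lift \<sigma> n = Var m \<and>
     ((sub \<sigma> A # \<Delta>) ! m) \<Up> Suc m = sub (lift \<sigma>) (((A # \<Gamma>) ! n) \<Up> Suc n)"
  proof (cases n)
    case 0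
    then show ?thesis by (intro exI[of _ 0]) simp
  next
    case (Suc l)
    with n assms(1) obtain m where m: "m < length \<Delta>" "\<sigma> l = Var m"
      "(\<Delta> ! m) \<Up> Suc m = sub \<sigma> ((\<Gamma> ! l) \<Up> Suc l)"
      unfolding ren_ok_def by auto
    have "(\<Delta> ! m) \<Up> Suc m \<Up> 1 = sub \<sigma> ((\<Gamma> ! l) \<Up> Suc l) \<Up> 1"
      using m(3) by simp
    then show ?thesis using m(1,2) Suc by (intro exI[of _ "Suc m"]) simp
  qed
qed

lemma has_type_ren: "\<Gamma> \<turnstile> a \<^bold>: A \<Longrightarrow> ren_ok \<Delta> \<sigma> \<Gamma> \<Longrightarrow> \<Delta> \<turnstile> sub \<sigma> a \<^bold>: sub \<sigma> A"
  using judgements_stable(2)[of ren_ok \<Gamma> a A] ren_ok_lift ren_ok_subst_ok by blast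

lemma ren_ok_sh:
  assumes "wf_ctx (\<Xi> @ \<Gamma>)"
  shows "ren_ok (\<Xi> @ \<Gamma>) (sh (length \<Xi>)) \<Gamma>"
  unfolding ren_ok_def
proof (intro conjI allI impI assms)
  fix n assume "n < length \<Gamma>"
  then show "\<exists>m<length (\<Xi> @ \<Gamma>). sh (length \<Xi>) n = Var m \<and>
      ((\<Xi> @ \<Gamma>) ! m) \<Up> Suc m = sub (sh (length \<Xi>)) ((\<Gamma> ! n) \<Up> Suc n)"
    by (intro exI[of _ "n + length \<Xi>"]) (simp add: nth_append)
qed

text \<open>Weakening is by now available through the renamings; it moves the substituted terms
  under the new binder.\<close>

lemma subst_ok_lift:
  assumes "subst_ok \<Delta> \<sigma> \<Gamma>" "\<Delta> \<turnstile> sub \<sigma> A \<^bold>: TUniv i"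
  shows "subst_ok (sub \<sigma> A # \<Delta>) (lift \<sigma>) (A # \<Gamma>)"
  unfolding subst_ok_def
proof (intro conjI allI impI)
  show wf: "wf_ctx (sub \<sigma> A # \<Delta>)" using assms(2) by (rule ctx_extend)
  fix n assume n: "n < length (A # \<Gamma>)"
  show "sub \<sigma> A # \<Delta> \<turnstile> lift \<sigma> n \<^bold>: sub (lift \<sigma>) (((A # \<Gamma>) ! n) \<Up> Suc n)"
  proof (cases n)
    case 0
    then show ?thesis using ty_var[OF wf, of 0, unfolded wk_sh] by simp
  next
    case (Suc l)
    with n assms(1) have "\<Delta> \<turnstile> \<sigma> l \<^bold>: sub \<sigma> ((\<Gamma> ! l) \<Up> Suc l)"
      unfolding subst_ok_def by auto
    from has_type_ren[OF this ren_ok_sh[of "[sub \<sigma> A]", simplified, OF wf]] Suc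
    show ?thesis by simp
  qed
qed

lemma has_type_sub: "\<Gamma> \<turnstile> a \<^bold>: A \<Longrightarrow> subst_ok \<Delta> \<sigma> \<Gamma> \<Longrightarrow> \<Delta> \<turnstile> sub \<sigma> a \<^bold>: sub \<sigma> A"
  using judgements_stable(2)[of subst_ok \<Gamma> a A] subst_ok_lift by blast

lemma jeq_sub: "\<Gamma> \<turnstile> a \<^bold>\<equiv> b \<^bold>: A \<Longrightarrow> subst_ok \<Delta> \<sigma> \<Gamma> \<Longrightarrow> \<Delta> \<turnstile> sub \<sigma> a \<^bold>\<equiv> sub \<sigma> b \<^bold>: sub \<sigma> A"
  using judgements_stable(3)[of subst_ok \<Gamma> a b A] subst_ok_lift by blast

lemma nth_Cons_1 [simp]: "(x # xs) ! 1 = xs ! 0"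
  by (simp add: One_nat_def del: One_nat_def[symmetric])

lemma subst_ok_Var: "wf_ctx \<Gamma> \<Longrightarrow> subst_ok \<Gamma> Var \<Gamma>"
  using ren_ok_subst_ok[OF ren_ok_sh[of "[]"]] by simp

lemma subst_ok_scons:
  assumes "subst_ok \<Delta> \<sigma> \<Gamma>" "\<Delta> \<turnstile> a \<^bold>: sub \<sigma> A"
  shows "subst_ok \<Delta> (a \<bullet> \<sigma>) (A # \<Gamma>)"
  using assms unfolding subst_ok_def
  by (auto simp: nth_Cons split: nat.split)

lemma subst_ok_sh:
  "wf_ctx (X # \<Gamma>) \<Longrightarrow> subst_ok (X # \<Gamma>) (sh 1) \<Gamma>"
  "wf_ctx (Y # X # \<Gamma>) \<Longrightarrow> subst_ok (Y # X # \<Gamma>) (sh 2) \<Gamma>"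
  "wf_ctx (Z # Y # X # \<Gamma>) \<Longrightarrow> subst_ok (Z # Y # X # \<Gamma>) (sh 3) \<Gamma>"
  "wf_ctx (W # Z # Y # X # \<Gamma>) \<Longrightarrow> subst_ok (W # Z # Y # X # \<Gamma>) (sh 4) \<Gamma>"
  "wf_ctx (V # W # Z # Y # X # \<Gamma>) \<Longrightarrow> subst_ok (V # W # Z # Y # X # \<Gamma>) (sh 5) \<Gamma>"
  using ren_ok_subst_ok[OF ren_ok_sh[of "[X]"]] ren_ok_subst_ok[OF ren_ok_sh[of "[Y, X]"]]
    ren_ok_subst_ok[OF ren_ok_sh[of "[Z, Y, X]"]] ren_ok_subst_ok[OF ren_ok_sh[of "[W, Z, Y, X]"]]
    ren_ok_subst_ok[OF ren_ok_sh[of "[V, W, Z, Y, X]"]]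
  by simp_all

lemma has_type_sub_eq:
  "\<Gamma> \<turnstile> a \<^bold>: A \<Longrightarrow> subst_ok \<Delta> \<sigma> \<Gamma> \<Longrightarrow> sub \<sigma> a = a' \<Longrightarrow> sub \<sigma> A = A' \<Longrightarrow> \<Delta> \<turnstile> a' \<^bold>: A'"
  using has_type_sub by blast

lemma inst_ty: "X # \<Gamma> \<turnstile> t \<^bold>: T \<Longrightarrow> \<Gamma> \<turnstile> a \<^bold>: X \<Longrightarrow> \<Gamma> \<turnstile> inst t a \<^bold>: inst T a"
  using has_type_sub[of "X # \<Gamma>" t T \<Gamma> "a \<bullet> Var"]
      subst_ok_scons[OF subst_ok_Var[OF wf_ctxI], of \<Gamma> a X a X]
  by simp

text \<open>Here and in \<open>weak_ty\<close> and \<open>app_ty\<close> the expected type enters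
  through an equation that the simplifier settles, since a substituted type seldom unifies with the
  goal as written. Collected in \<open>ty_rules\<close>, these facts act as a type checker for
  explicit contexts.\<close>

lemma var_ty:
  "wf_ctx (X # \<Gamma>) \<Longrightarrow> X \<Up> 1 = T \<Longrightarrow> X # \<Gamma> \<turnstile> Var 0 \<^bold>: T"
  "wf_ctx (Y # X # \<Gamma>) \<Longrightarrow> X \<Up> 2 = T \<Longrightarrow> Y # X # \<Gamma> \<turnstile> Var 1 \<^bold>: T"
  "wf_ctx (Z # Y # X # \<Gamma>) \<Longrightarrow> X \<Up> 3 = T \<Longrightarrow> Z # Y # X # \<Gamma> \<turnstile> Var 2 \<^bold>: T"
  "wf_ctx (W # Z # Y # X # \<Gamma>) \<Longrightarrow> X \<Up> 4 = T \<Longrightarrow> W # Z # Y # X # \<Gamma> \<turnstile> Var 3 \<^bold>: T"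
  "wf_ctx (V # W # Z # Y # X # \<Gamma>) \<Longrightarrow> X \<Up> 5 = T \<Longrightarrow> V # W # Z # Y # X # \<Gamma> \<turnstile> Var 4 \<^bold>: T"
  by (drule ty_var[where n = 0, unfolded wk_sh], simp, simp,
      drule ty_var[where n = 1, unfolded wk_sh], simp, simp,
      drule ty_var[where n = 2, unfolded wk_sh], simp, simp,
      drule ty_var[where n = 3, unfolded wk_sh], simp, simp,
      drule ty_var[where n = 4, unfolded wk_sh], simp, simp)

lemma weak_ty:
  "\<Gamma> \<turnstile> a \<^bold>: A \<Longrightarrow> wf_ctx (X # \<Gamma>) \<Longrightarrow> A \<Up> 1 = T \<Longrightarrow> X # \<Gamma> \<turnstile> a \<Up> 1 \<^bold>: T"
  "\<Gamma> \<turnstile> a \<^bold>: A \<Longrightarrow> wf_ctx (Y # X # \<Gamma>) \<Longrightarrow> A \<Up> 2 = T \<Longrightarrow> Y # X # \<Gamma> \<turnstile> a \<Up> 2 \<^bold>: T"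
  "\<Gamma> \<turnstile> a \<^bold>: A \<Longrightarrow> wf_ctx (Z # Y # X # \<Gamma>) \<Longrightarrow> A \<Up> 3 = T \<Longrightarrow> Z # Y # X # \<Gamma> \<turnstile> a \<Up> 3 \<^bold>: T"
  "\<Gamma> \<turnstile> a \<^bold>: A \<Longrightarrow> wf_ctx (W # Z # Y # X # \<Gamma>) \<Longrightarrow> A \<Up> 4 = T \<Longrightarrow> W # Z # Y # X # \<Gamma> \<turnstile> a \<Up> 4 \<^bold>: T"
  "\<Gamma> \<turnstile> a \<^bold>: A \<Longrightarrow> wf_ctx (V # W # Z # Y # X # \<Gamma>) \<Longrightarrow> A \<Up> 5 = T \<Longrightarrow> V # W # Z # Y # X # \<Gamma> \<turnstile> a \<Up> 5 \<^bold>: T"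
  by (erule has_type_sub_eq, erule subst_ok_sh, rule refl, assumption)+

lemma app_ty: "\<Gamma> \<turnstile> f \<^bold>: TPi A B \<Longrightarrow> \<Gamma> \<turnstile> a \<^bold>: A \<Longrightarrow> inst B a = T \<Longrightarrow> \<Gamma> \<turnstile> f $ a \<^bold>: T"
  using ty_app by blast

lemma fam_ty:
  "X # \<Gamma> \<turnstile> t \<^bold>: T \<Longrightarrow> subst_ok \<Delta> \<sigma> \<Gamma> \<Longrightarrow> \<Delta> \<turnstile> a \<^bold>: sub \<sigma> X \<Longrightarrow> sub (a \<bullet> \<sigma>) T = T' \<Longrightarrow>
    \<Delta> \<turnstile> sub (a \<bullet> \<sigma>) t \<^bold>: T'"
  using has_type_sub subst_ok_scons by blast

lemmas ty_J' = ty_J[unfolded wk_sh fold_sh]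
lemmas beta_J' = beta_J[unfolded wk_sh fold_sh]
lemmas ty_ind_sigma' = ty_ind_sigma[unfolded fold_sh]
lemmas beta_sigma' = beta_sigma[unfolded fold_sh]

lemmas ty_rules = ctx_extend var_ty weak_ty ty_pi ty_sigma ty_id ty_univ ty_refl app_ty ty_trunc

lemma beta_pi_eq: "A # \<Gamma> \<turnstile> b \<^bold>: B \<Longrightarrow> \<Gamma> \<turnstile> a \<^bold>: A \<Longrightarrow> inst b a = b' \<Longrightarrow> inst B a = B' \<Longrightarrow>
    \<Gamma> \<turnstile> TLam A b $ a \<^bold>\<equiv> b' \<^bold>: B'"
  using beta_pi by blast

text \<open>
  Judgemental equality of instances is the congruence rule for application between two
  \<open>\<beta>\<close>-expansions.
\<close>

lemma inst_cong_ty: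
  assumes T: "X # \<Gamma> \<turnstile> T \<^bold>: TUniv l" and e: "\<Gamma> \<turnstile> a \<^bold>\<equiv> a' \<^bold>: X"
    and a: "\<Gamma> \<turnstile> a \<^bold>: X" and a': "\<Gamma> \<turnstile> a' \<^bold>: X"
  shows "\<Gamma> \<turnstile> inst T a \<^bold>\<equiv> inst T a' \<^bold>: TUniv l"
    using eq_trans[OF eq_sym[OF beta_pi[OF T a]]
      eq_trans[OF cong_app[OF eq_refl[OF ty_lam[OF T]] e] beta_pi_eq[OF T a' refl]]] by simp

text \<open>Pushing \<sigma> under the binder of the family first leaves a single instantiation, to
  which \<open>inst_cong_ty\<close> applies.\<close>

lemma fam_cong:
  assumes B: "A # \<Gamma> \<turnstile> B \<^bold>: TUniv k" and s: "subst_ok \<Delta> \<sigma> \<Gamma>" and A: "\<Gamma> \<turnstile> A \<^bold>: TUniv l"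
    and e: "\<Delta> \<turnstile> a \<^bold>\<equiv> a' \<^bold>: sub \<sigma> A" and a: "\<Delta> \<turnstile> a \<^bold>: sub \<sigma> A" and a': "\<Delta> \<turnstile> a' \<^bold>: sub \<sigma> A"
  shows "\<Delta> \<turnstile> sub (a \<bullet> \<sigma>) B \<^bold>\<equiv> sub (a' \<bullet> \<sigma>) B \<^bold>: TUniv k"
proof -
  have "sub \<sigma> A # \<Delta> \<turnstile> sub (lift \<sigma>) B \<^bold>: TUniv k"
    using has_type_sub[OF B subst_ok_lift[OF s]] has_type_sub[OF A s] by simp
  from inst_cong_ty[OF this e a a'] show ?thesis by simp
qed

section \<open>Projections\<close>

text \<open>Projections are derived from the eliminator, whose motive depends on the component
  types; hence the type arguments.\<close>

definition fst_tm :: "tm \<Rightarrow> tm \<Rightarrow> tm" where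
  "fst_tm A p = TIndSigma (A \<Up> 1) (Var 1) p"

definition snd_tm :: "tm \<Rightarrow> tm \<Rightarrow> tm \<Rightarrow> tm" where
  "snd_tm A B p = TIndSigma (sub (fst_tm (A \<Up> 1) (Var 0) \<bullet> sh 1) B) (Var 0) p"

lemma sub_fst_snd [simp]:
  "sub \<sigma> (fst_tm A p) = fst_tm (sub \<sigma> A) (sub \<sigma> p)"
  "sub \<sigma> (snd_tm A B p) = snd_tm (sub \<sigma> A) (sub (lift \<sigma>) B) (sub \<sigma> p)"
  by (simp_all add: fst_tm_def snd_tm_def)

lemma fst_ty:
  assumes A: "\<Gamma> \<turnstile> A \<^bold>: TUniv k" and B: "A # \<Gamma> \<turnstile> B \<^bold>: TUniv k"
    and p: "\<Gamma> \<turnstile> p \<^bold>: TSigma A B"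
  shows "\<Gamma> \<turnstile> fst_tm A p \<^bold>: A"
proof -
  have wf: "wf_ctx (TSigma A B # \<Gamma>)" "wf_ctx (B # A # \<Gamma>)"
    by (rule ty_rules A B)+
  have "\<Gamma> \<turnstile> fst_tm A p \<^bold>: inst (A \<Up> 1) p"
    unfolding fst_tm_def
    by (rule ty_ind_sigma'[OF _ _ p]) (rule ty_rules wf A | simp)+
  then show ?thesis by simp
qed

lemma fst_pair:
  assumes A: "\<Gamma> \<turnstile> A \<^bold>: TUniv k" and B: "A # \<Gamma> \<turnstile> B \<^bold>: TUniv k"
    and a: "\<Gamma> \<turnstile> a \<^bold>: A" and b: "\<Gamma> \<turnstile> b \<^bold>: inst B a"
  shows "\<Gamma> \<turnstile> fst_tm A (TPair a b) \<^bold>\<equiv> a \<^bold>: A"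
proof -
  have wf: "wf_ctx (TSigma A B # \<Gamma>)" "wf_ctx (B # A # \<Gamma>)"
    by (rule ty_rules A B)+
  have "\<Gamma> \<turnstile> fst_tm A (TPair a b) \<^bold>\<equiv> sub (b \<bullet> a \<bullet> Var) (Var 1) \<^bold>: inst (A \<Up> 1) (TPair a b)"
    unfolding fst_tm_def
    by (rule beta_sigma'[OF _ _ a b]) (rule ty_rules wf A | simp)+
  then show ?thesis by simp
qed

text \<open>The variable for the second component has type \<open>B\<close> at the first component,
  but the motive asks for \<open>B\<close> at the projection of the pair. The computation rule of
  \<open>fst_tm\<close> makes the two types judgementally equal, and \<open>fam_cong\<close> carries
  this through \<open>B\<close>.\<close>

lemma snd_aux:
  assumes A: "\<Gamma> \<turnstile> A \<^bold>: TUniv k" and B: "A # \<Gamma> \<turnstile> B \<^bold>: TUniv k"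
  shows "TSigma A B # \<Gamma> \<turnstile> sub (fst_tm (A \<Up> 1) (Var 0) \<bullet> sh 1) B \<^bold>: TUniv k"
    and "B # A # \<Gamma> \<turnstile> Var 0 \<^bold>:
      sub (TPair (Var 1) (Var 0) \<bullet> sh 2) (sub (fst_tm (A \<Up> 1) (Var 0) \<bullet> sh 1) B)"
proof -
  have wf: "wf_ctx (TSigma A B # \<Gamma>)" "wf_ctx (A # \<Gamma>)" "wf_ctx (B # A # \<Gamma>)"
    by (rule ty_rules A B)+
  show "TSigma A B # \<Gamma> \<turnstile> sub (fst_tm (A \<Up> 1) (Var 0) \<bullet> sh 1) B \<^bold>: TUniv k"
    by (rule fam_ty[OF B subst_ok_sh(1)[OF wf(1)]], rule fst_ty[where k = k], rule
        weak_ty(1)[OF A wf(1)], simp,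
       rule fam_ty[OF B, where \<sigma> = "sh 2"])
      (rule subst_ok_sh ty_rules A B wf | simp)+
  have p: "B # A # \<Gamma> \<turnstile> TPair (Var 1) (Var 0) \<^bold>: TSigma (A \<Up> 2) (sub (Var 0 \<bullet> sh 3) B)"
    by (rule ty_pair, rule fam_ty[OF B, where \<sigma> = "sh 3"])
     (rule subst_ok_sh ty_rules A B wf | simp)+
  have f: "B # A # \<Gamma> \<turnstile> fst_tm (A \<Up> 2) (TPair (Var 1) (Var 0)) \<^bold>\<equiv> Var 1 \<^bold>: A \<Up> 2"
    "B # A # \<Gamma> \<turnstile> fst_tm (A \<Up> 2) (TPair (Var 1) (Var 0)) \<^bold>: A \<Up> 2"
    using p
    by - (rule fst_pair[where k = k and B = "sub (Var 0 \<bullet> sh 3) B"] fst_ty[where k = k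
        and B = "sub (Var 0 \<bullet> sh 3) B"] fam_ty[OF B, where \<sigma> = "sh 3"]
       subst_ok_sh ty_rules A B wf p | simp)+
  have v: "B # A # \<Gamma> \<turnstile> Var 1 \<^bold>: A \<Up> 2" "B # A # \<Gamma> \<turnstile> Var 0 \<^bold>: B \<Up> 1"
    by (rule ty_rules wf | simp)+
  from ty_conv[OF v(2)]
    fam_cong[OF B subst_ok_sh(2)[OF wf(3)] A eq_sym[OF f(1)] v(1) f(2)]
  show "B # A # \<Gamma> \<turnstile> Var 0 \<^bold>:
      sub (TPair (Var 1) (Var 0) \<bullet> sh 2) (sub (fst_tm (A \<Up> 1) (Var 0) \<bullet> sh 1) B)"
    by simp
qed

lemma snd_ty:
  assumes "\<Gamma> \<turnstile> A \<^bold>: TUniv k" "A # \<Gamma> \<turnstile> B \<^bold>: TUniv k" "\<Gamma> \<turnstile> p \<^bold>: TSigma A B"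
  shows "\<Gamma> \<turnstile> snd_tm A B p \<^bold>: inst B (fst_tm A p)"
  using ty_ind_sigma'[OF snd_aux[OF assms(1,2)] assms(3)] by (simp add: snd_tm_def)

lemma snd_pair:
  assumes A: "\<Gamma> \<turnstile> A \<^bold>: TUniv k" and B: "A # \<Gamma> \<turnstile> B \<^bold>: TUniv k"
    and a: "\<Gamma> \<turnstile> a \<^bold>: A" and b: "\<Gamma> \<turnstile> b \<^bold>: inst B a"
  shows "\<Gamma> \<turnstile> snd_tm A B (TPair a b) \<^bold>\<equiv> b \<^bold>: inst B a"
proof -
  have p: "\<Gamma> \<turnstile> TPair a b \<^bold>: TSigma A B"
    using B a b by (rule ty_pair)
  have "\<Gamma> \<turnstile> snd_tm A B (TPair a b) \<^bold>\<equiv> b \<^bold>: inst B (fst_tm A (TPair a b))"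
    using beta_sigma'[OF snd_aux[OF A B] a b] by (simp add: snd_tm_def)
  moreover have "\<Gamma> \<turnstile> inst B (fst_tm A (TPair a b)) \<^bold>\<equiv> inst B a \<^bold>: TUniv k"
    using inst_cong_ty[OF B fst_pair[OF A B a b] fst_ty[OF A B p] a] .
  ultimately show ?thesis by (rule eq_conv)
qed

lemma beta2:
  assumes A: "\<Gamma> \<turnstile> A \<^bold>: TUniv k" and B: "A # \<Gamma> \<turnstile> B \<^bold>: TUniv l"
    and t: "B # A # \<Gamma> \<turnstile> t \<^bold>: T" and a: "\<Gamma> \<turnstile> a \<^bold>: A" and b: "\<Gamma> \<turnstile> b \<^bold>: inst B a"
  shows "\<Gamma> \<turnstile> TLam A (TLam B t) $ a $ b \<^bold>\<equiv> sub (b \<bullet> a \<bullet> Var) t \<^bold>: sub (b \<bullet> a \<bullet> Var) T"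
proof -
  have 1: "\<Gamma> \<turnstile> TLam A (TLam B t) $ a \<^bold>\<equiv> TLam (inst B a) (sub (lift (a \<bullet> Var)) t) \<^bold>:
      TPi (inst B a) (sub (lift (a \<bullet> Var)) T)"
    by (rule beta_pi_eq[OF ty_lam[OF t] a]) simp_all
  have s: "subst_ok \<Gamma> (a \<bullet> Var) (A # \<Gamma>)"
    using subst_ok_scons[OF subst_ok_Var[OF wf_ctxI[OF A]], of a A] a by simp
  have "inst B a # \<Gamma> \<turnstile> sub (lift (a \<bullet> Var)) t \<^bold>: sub (lift (a \<bullet> Var)) T"
    using has_type_sub[OF t subst_ok_lift[OF s]] has_type_sub[OF B s] by simp
  from beta_pi[OF this b] have "\<Gamma> \<turnstile> TLam (inst B a) (sub (lift (a \<bullet> Var)) t) $ b \<^bold>\<equiv>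
      sub (b \<bullet> a \<bullet> Var) t \<^bold>: sub (b \<bullet> a \<bullet> Var) T" by simp
  moreover have "\<Gamma> \<turnstile> TLam A (TLam B t) $ a $ b \<^bold>\<equiv>
      TLam (inst B a) (sub (lift (a \<bullet> Var)) t) $ b \<^bold>: sub (b \<bullet> a \<bullet> Var) T"
    using cong_app[OF 1 eq_refl[OF b]] by simp
  ultimately show ?thesis by (meson eq_trans)
qed

section \<open>Inhabited types and path induction\<close>

definition inh :: "tm list \<Rightarrow> tm \<Rightarrow> bool" where
  "inh \<Gamma> T \<longleftrightarrow> (\<exists>t. \<Gamma> \<turnstile> t \<^bold>: T)"

abbreviation ideq :: "tm list \<Rightarrow> tm \<Rightarrow> tm \<Rightarrow> tm \<Rightarrow> bool" where
  "ideq \<Gamma> A a b \<equiv> inh \<Gamma> (TId A a b)"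

lemma inhI: "\<Gamma> \<turnstile> t \<^bold>: T \<Longrightarrow> inh \<Gamma> T"
  by (auto simp: inh_def)

lemma inhE: "inh \<Gamma> T \<Longrightarrow> (\<And>t. \<Gamma> \<turnstile> t \<^bold>: T \<Longrightarrow> P) \<Longrightarrow> P"
  by (auto simp: inh_def)

lemma inh_conv: "inh \<Gamma> T \<Longrightarrow> \<Gamma> \<turnstile> T \<^bold>\<equiv> T' \<^bold>: TUniv k \<Longrightarrow> inh \<Gamma> T'"
  unfolding inh_def using ty_conv by blast

lemma inh_lam: "inh (A # \<Gamma>) B \<Longrightarrow> inh \<Gamma> (TPi A B)"
  unfolding inh_def using ty_lam by blast

lemma inh_app: "inh \<Gamma> (TPi A B) \<Longrightarrow> \<Gamma> \<turnstile> a \<^bold>: A \<Longrightarrow> inst B a = T \<Longrightarrow> inh \<Gamma> T"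
  unfolding inh_def using ty_app by blast

text \<open>
  The motive for \<open>TJ\<close> quantifies over all families \<open>P\<close> on the paths starting at the left
  endpoint, and the result is applied to the family \<open>C\<close>.
\<close>

lemma based_J:
  assumes A: "\<Gamma> \<turnstile> A \<^bold>: TUniv k" and a: "\<Gamma> \<turnstile> a \<^bold>: A"
    and C: "TId (A \<Up> 1) (a \<Up> 1) (Var 0) # A # \<Gamma> \<turnstile> C \<^bold>: TUniv k"
    and d: "inh \<Gamma> (sub (TRefl a \<bullet> a \<bullet> Var) C)"
    and b: "\<Gamma> \<turnstile> b \<^bold>: A" and p: "\<Gamma> \<turnstile> p \<^bold>: TId A a b"
  shows "inh \<Gamma> (sub (p \<bullet> b \<bullet> Var) C)"
proof -
  \<comment> \<open>The families on the paths that start at \<open>x\<close>. Quantifying over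
    families valued in \<open>TUniv k\<close> raises the level, so the eliminator is used with a
    motive in \<open>TUniv (Suc k)\<close>.\<close>
  define PT where "PT = (\<lambda>A x. TPi A (TPi (TId (A \<Up> 1) (x \<Up> 1) (Var 0)) (TUniv k)))"
  define M where "M = TPi (PT (A \<Up> 3) (Var 2)) (TPi (Var 0 $ Var 3 $ TRefl (Var 3))
     (Var 1 $ Var 3 $ Var 2))"
  define c where "c = TLam (PT (A \<Up> 1) (Var 0))
     (TLam (Var 0 $ Var 1 $ TRefl (Var 1)) (Var 0))"
  define L where "L = TLam A (TLam (TId (A \<Up> 1) (a \<Up> 1) (Var 0)) C)"
  have A': "\<Gamma> \<turnstile> A \<^bold>: TUniv (Suc k)" using A by (rule ty_cumul)
  have wf0: "wf_ctx \<Gamma>" using A by (rule wf_ctxI)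
  have wf1: "wf_ctx (A # \<Gamma>)" using A by (rule ctx_extend)
  have wf2: "wf_ctx (A \<Up> 1 # A # \<Gamma>)" by (rule ty_rules A wf1 | simp)+
  have wf3: "wf_ctx (TId (A \<Up> 2) (Var 1) (Var 0) # A \<Up> 1 # A # \<Gamma>)"
    by (rule ty_rules A wf1 wf2 | simp)+
  have PT: "\<Delta> \<turnstile> PT A x \<^bold>: TUniv (Suc k)" if "\<Delta> \<turnstile> A \<^bold>: TUniv (Suc k)" "\<Delta> \<turnstile> x \<^bold>: A" for \<Delta> A x
  proof -
    have w: "wf_ctx (A # \<Delta>)" using that(1) by (rule ctx_extend)
    show ?thesis unfolding PT_def by (rule ty_rules that w | simp)+
  qed
  have [simp]: "sub \<sigma> (PT A x) = PT (sub \<sigma> A) (sub \<sigma> x)" for \<sigma> A x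
    by (simp add: PT_def)
  have PT_app: "\<Delta> \<turnstile> P $ y $ q \<^bold>: TUniv k"
    if P: "\<Delta> \<turnstile> P \<^bold>: PT A x" and y: "\<Delta> \<turnstile> y \<^bold>: A" and q: "\<Delta> \<turnstile> q \<^bold>: TId A x y" for \<Delta> A x P y q
    by (rule app_ty[OF app_ty[OF P[unfolded PT_def] y] q]) (simp, simp)
  have wf4: "wf_ctx (PT (A \<Up> 3) (Var 2) # TId (A \<Up> 2) (Var 1) (Var 0) # A \<Up> 1 # A # \<Gamma>)"
    by (rule ctx_extend PT ty_rules A' wf1 wf2 wf3 | simp)+
  have q1: "PT (A \<Up> 3) (Var 2) # TId (A \<Up> 2) (Var 1) (Var 0) # A \<Up> 1 # A # \<Gamma> \<turnstile>
     Var 0 $ Var 3 $ TRefl (Var 3) \<^bold>: TUniv (Suc k)"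
    by (rule ty_cumul, rule PT_app[where A = "A \<Up> 4" and x = "Var 3"])
       (rule ty_rules A' wf1 wf2 wf3 wf4 | simp)+
  note wf5 = ctx_extend[OF q1]
  have q2: "Var 0 $ Var 3 $ TRefl (Var 3) # PT (A \<Up> 3) (Var 2) # TId (A \<Up> 2) (Var 1) (Var 0) #
      A \<Up> 1 # A # \<Gamma> \<turnstile>
     Var 1 $ Var 3 $ Var 2 \<^bold>: TUniv (Suc k)"
    by (rule ty_cumul, rule PT_app[where A = "A \<Up> 5" and x = "Var 4"])
       (rule ty_rules A' wf5 | simp)+
  have M: "TId (A \<Up> 2) (Var 1) (Var 0) # A \<Up> 1 # A # \<Gamma> \<turnstile> M \<^bold>: TUniv (Suc k)"
    unfolding M_def
    by (rule ty_rules PT A' wf3 q1 q2 | simp)+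
  have w1: "wf_ctx (PT (A \<Up> 1) (Var 0) # A # \<Gamma>)"
    by (rule ctx_extend PT ty_rules A' wf1 | simp)+
  have w2: "wf_ctx (Var 0 $ Var 1 $ TRefl (Var 1) # PT (A \<Up> 1) (Var 0) # A # \<Gamma>)"
    by (rule ctx_extend, rule PT_app[where A = "A \<Up> 2" and x = "Var 1"])
       (rule ctx_extend ty_rules A' wf1 w1 | simp)+
  have "A # \<Gamma> \<turnstile> c \<^bold>: sub (TRefl (Var 0) \<bullet> Var 0 \<bullet> Var 0 \<bullet> sh 1) M"
    unfolding c_def M_def by simp (rule ty_lam ty_rules w2 | simp)+
  from ty_J'[OF M this a b p]
  have t: "\<Gamma> \<turnstile> TJ M c a b p \<^bold>: TPi (PT A a) (TPi (Var 0 $ a \<Up> 1 $ TRefl (a \<Up> 1))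
     (Var 1 $ b \<Up> 2 $ p \<Up> 2))"
    by (simp add: M_def)
  have L: "\<Gamma> \<turnstile> L \<^bold>: PT A a"
    unfolding PT_def L_def by (rule ty_lam C)+
  have t': "\<Gamma> \<turnstile> TJ M c a b p $ L \<^bold>: TPi (L $ a $ TRefl a) (L \<Up> 1 $ b \<Up> 1 $ p \<Up> 1)"
    by (rule app_ty[OF t L]) simp
  have TId: "A # \<Gamma> \<turnstile> TId (A \<Up> 1) (a \<Up> 1) (Var 0) \<^bold>: TUniv k"
    by (rule ty_rules A a wf1 | simp)+
  \<comment> \<open>\<beta> undoes the abstraction of \<open>C\<close>, so that applications of
    \<open>L\<close> become the instances in the statement.\<close>
  have e1: "\<Gamma> \<turnstile> L $ x $ y \<^bold>\<equiv> sub (y \<bullet> x \<bullet> Var) C \<^bold>: TUniv k"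
    if "\<Gamma> \<turnstile> x \<^bold>: A" "\<Gamma> \<turnstile> y \<^bold>: TId A a x" for x y
    unfolding L_def using beta2[OF A TId C that(1)] that(2) by simp
  obtain d' where d': "\<Gamma> \<turnstile> d' \<^bold>: sub (TRefl a \<bullet> a \<bullet> Var) C"
    using d by (rule inhE)
  have "\<Gamma> \<turnstile> TJ M c a b p $ L $ d' \<^bold>: L $ b $ p"
    by (rule app_ty[OF t' ty_conv[OF d' eq_sym[OF e1[OF a ty_refl[OF a]]]]]) simp
  from ty_conv[OF this e1[OF b p]] show ?thesis by (rule inhI)
qed

lemma id_jeq: "\<Gamma> \<turnstile> A \<^bold>: TUniv k \<Longrightarrow> \<Gamma> \<turnstile> a \<^bold>: A \<Longrightarrow> \<Gamma> \<turnstile> a \<^bold>\<equiv> b \<^bold>: A \<Longrightarrow> ideq \<Gamma> A a b"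
  by (rule inhI, rule ty_conv[OF ty_refl cong_id[OF eq_refl eq_refl]])

lemma id_conv:
  "ideq \<Gamma> A a b \<Longrightarrow> \<Gamma> \<turnstile> A \<^bold>: TUniv k \<Longrightarrow> \<Gamma> \<turnstile> a \<^bold>\<equiv> a' \<^bold>: A \<Longrightarrow> \<Gamma> \<turnstile> b \<^bold>\<equiv> b' \<^bold>: A \<Longrightarrow>
    ideq \<Gamma> A a' b'"
  by (rule inh_conv, assumption, rule cong_id[OF eq_refl])

lemma transport:
  assumes A: "\<Gamma> \<turnstile> A \<^bold>: TUniv k" and D: "A # \<Gamma> \<turnstile> D \<^bold>: TUniv k"
    and a: "\<Gamma> \<turnstile> a \<^bold>: A" and b: "\<Gamma> \<turnstile> b \<^bold>: A"
    and p: "ideq \<Gamma> A a b" and d: "inh \<Gamma> (inst D a)"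
  shows "inh \<Gamma> (inst D b)"
proof -
  obtain p where p: "\<Gamma> \<turnstile> p \<^bold>: TId A a b" using p by (rule inhE)
  have wf: "wf_ctx (A # \<Gamma>)" "wf_ctx (TId (A \<Up> 1) (a \<Up> 1) (Var 0) # A # \<Gamma>)"
    by (rule ty_rules A a | simp)+
  have "TId (A \<Up> 1) (a \<Up> 1) (Var 0) # A # \<Gamma> \<turnstile> sub (Var 1 \<bullet> sh 2) D \<^bold>: TUniv k"
    by (rule fam_ty[OF D subst_ok_sh(2)] var_ty wf | simp)+
  from based_J[OF A a this _ b p] d show ?thesis by simp
qed

lemma ap_id:
  assumes A: "\<Gamma> \<turnstile> A \<^bold>: TUniv k" and T: "\<Gamma> \<turnstile> T \<^bold>: TUniv k" and t: "A # \<Gamma> \<turnstile> t \<^bold>: T \<Up> 1"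
    and a: "\<Gamma> \<turnstile> a \<^bold>: A" and b: "\<Gamma> \<turnstile> b \<^bold>: A"
    and p: "ideq \<Gamma> A a b"
  shows "ideq \<Gamma> T (inst t a) (inst t b)"
proof -
  have wf: "wf_ctx (A # \<Gamma>)" by (rule ty_rules A)+
  have ta: "\<Gamma> \<turnstile> inst t a \<^bold>: T" using inst_ty[OF t a] by simp
  have D: "A # \<Gamma> \<turnstile> TId (T \<Up> 1) (inst t a \<Up> 1) t \<^bold>: TUniv k"
    by (rule ty_id t weak_ty(1)[OF T wf] weak_ty(1)[OF ta wf] | simp only: sub.simps)+
  have "ideq \<Gamma> T (inst t a) (inst t a)" using ty_refl[OF ta] by (rule inhI)
  then show ?thesis using transport[OF A D a b p] by simp
qed

lemma id_sym:
  assumes A: "\<Gamma> \<turnstile> A \<^bold>: TUniv k" and a: "\<Gamma> \<turnstile> a \<^bold>: A" and b: "\<Gamma> \<turnstile> b \<^bold>: A"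
    and p: "ideq \<Gamma> A a b"
  shows "ideq \<Gamma> A b a"
proof -
  have wf: "wf_ctx (A # \<Gamma>)" by (rule ty_rules A)+
  have D: "A # \<Gamma> \<turnstile> TId (A \<Up> 1) (Var 0) (a \<Up> 1) \<^bold>: TUniv k"
    by (rule ty_rules A a wf | simp)+
  show ?thesis using transport[OF A D a b p] inhI[OF ty_refl[OF a]] by simp
qed

lemma id_trans:
  assumes A: "\<Gamma> \<turnstile> A \<^bold>: TUniv k" and a: "\<Gamma> \<turnstile> a \<^bold>: A" and b: "\<Gamma> \<turnstile> b \<^bold>: A" and c: "\<Gamma> \<turnstile> c \<^bold>: A"
    and p: "ideq \<Gamma> A a b" and q: "ideq \<Gamma> A b c"
  shows "ideq \<Gamma> A a c"
proof -
  have wf: "wf_ctx (A # \<Gamma>)" by (rule ty_rules A)+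
  have D: "A # \<Gamma> \<turnstile> TId (A \<Up> 1) (a \<Up> 1) (Var 0) \<^bold>: TUniv k"
    by (rule ty_rules A a wf | simp)+
  show ?thesis using transport[OF A D b c q] p by simp
qed

section \<open>Path concatenation and its laws\<close>

lemma concat_motive:
  assumes A: "\<Gamma> \<turnstile> A \<^bold>: TUniv k" and z: "\<Gamma> \<turnstile> z \<^bold>: A"
  shows "TId (A \<Up> 2) (Var 1) (Var 0) # A \<Up> 1 # A # \<Gamma> \<turnstile>
      arr (TId (A \<Up> 3) (Var 1) (z \<Up> 3)) (TId (A \<Up> 3) (Var 2) (z \<Up> 3)) \<^bold>: TUniv k"
    and "A # \<Gamma> \<turnstile> TLam (TId (A \<Up> 1) (Var 0) (z \<Up> 1)) (Var 0) \<^bold>: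
      sub (TRefl (Var 0) \<bullet> Var 0 \<bullet> Var 0 \<bullet> sh 1)
          (arr (TId (A \<Up> 3) (Var 1) (z \<Up> 3)) (TId (A \<Up> 3) (Var 2) (z \<Up> 3)))"
proof -
  have wf1: "wf_ctx (A # \<Gamma>)" using A by (rule ctx_extend)
  have wf2: "wf_ctx (A \<Up> 1 # A # \<Gamma>)" by (rule ty_rules A wf1 | simp)+
  have wf3: "wf_ctx (TId (A \<Up> 2) (Var 1) (Var 0) # A \<Up> 1 # A # \<Gamma>)"
    by (rule ty_rules A wf1 wf2 | simp)+
  have wf4: "wf_ctx (TId (A \<Up> 3) (Var 1) (z \<Up> 3) # TId (A \<Up> 2) (Var 1) (Var 0) # A \<Up> 1 # A # \<Gamma>)"
    by (rule ty_rules A z wf3 | simp)+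
  show "TId (A \<Up> 2) (Var 1) (Var 0) # A \<Up> 1 # A # \<Gamma> \<turnstile>
      arr (TId (A \<Up> 3) (Var 1) (z \<Up> 3)) (TId (A \<Up> 3) (Var 2) (z \<Up> 3)) \<^bold>: TUniv k"
    unfolding arr_def' by simp (rule ty_rules A z wf3 wf4 | simp)+
  show "A # \<Gamma> \<turnstile> TLam (TId (A \<Up> 1) (Var 0) (z \<Up> 1)) (Var 0) \<^bold>:
      sub (TRefl (Var 0) \<bullet> Var 0 \<bullet> Var 0 \<bullet> sh 1)
          (arr (TId (A \<Up> 3) (Var 1) (z \<Up> 3)) (TId (A \<Up> 3) (Var 2) (z \<Up> 3)))"
    unfolding arr_def' by simp (rule ty_lam ty_rules A z wf1 | simp)+
qed

lemma concat_ty: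
  assumes A: "\<Gamma> \<turnstile> A \<^bold>: TUniv k" and x: "\<Gamma> \<turnstile> x \<^bold>: A" and y: "\<Gamma> \<turnstile> y \<^bold>: A" and z: "\<Gamma> \<turnstile> z \<^bold>: A"
    and p: "\<Gamma> \<turnstile> p \<^bold>: TId A x y" and q: "\<Gamma> \<turnstile> q \<^bold>: TId A y z"
  shows "\<Gamma> \<turnstile> concat_path A x y z p q \<^bold>: TId A x z"
  using app_ty[OF ty_J'[OF concat_motive[OF A z] x y p, simplified, unfolded arr_def'] q]
  by (simp add: concat_path_def' arr_def')

text \<open>Concatenation eliminates its first path, which makes this unit law judgemental. The law
  on the other side is proved up to a path, by an induction of its own.\<close>

lemma concat_refl_jeq:
  assumes A: "\<Gamma> \<turnstile> A \<^bold>: TUniv k" and x: "\<Gamma> \<turnstile> x \<^bold>: A" and z: "\<Gamma> \<turnstile> z \<^bold>: A"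
    and q: "\<Gamma> \<turnstile> q \<^bold>: TId A x z"
  shows "\<Gamma> \<turnstile> concat_path A x x z (TRefl x) q \<^bold>\<equiv> q \<^bold>: TId A x z"
proof -
  have wf: "wf_ctx (TId A x z # \<Gamma>)" by (rule ty_rules A x z)+
  have "\<Gamma> \<turnstile> concat_path A x x z (TRefl x) q \<^bold>\<equiv> TLam (TId A x z) (Var 0) $ q \<^bold>: TId A x z"
    using cong_app[OF beta_J'[OF concat_motive[OF A z] x, simplified, unfolded arr_def']
        eq_refl[OF q]]
    by (simp add: concat_path_def' arr_def')
  moreover have "\<Gamma> \<turnstile> TLam (TId A x z) (Var 0) $ q \<^bold>\<equiv> q \<^bold>: TId A x z"
    by (rule beta_pi_eq[OF _ q, where B = "TId (A \<Up> 1) (x \<Up> 1) (z \<Up> 1)"]) (rule var_ty wf | simp)+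
  ultimately show ?thesis by (rule eq_trans)
qed

text \<open>The endpoint \<open>z\<close> sits in the motive and in the branch of the eliminator, so
  the congruence rule for \<open>TJ\<close> is used in full. The result allows endpoints and paths
  to be replaced by their \<beta>-reducts inside a concatenation.\<close>

lemma concat_cong:
  assumes A: "\<Gamma> \<turnstile> A \<^bold>: TUniv k" and z: "\<Gamma> \<turnstile> z \<^bold>: A"
    and xx: "\<Gamma> \<turnstile> x \<^bold>\<equiv> x' \<^bold>: A" and yy: "\<Gamma> \<turnstile> y \<^bold>\<equiv> y' \<^bold>: A" and zz: "\<Gamma> \<turnstile> z \<^bold>\<equiv> z' \<^bold>: A"
    and pp: "\<Gamma> \<turnstile> p \<^bold>\<equiv> p' \<^bold>: TId A x y" and qq: "\<Gamma> \<turnstile> q \<^bold>\<equiv> q' \<^bold>: TId A y z"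
  shows "\<Gamma> \<turnstile> concat_path A x y z p q \<^bold>\<equiv> concat_path A x' y' z' p' q' \<^bold>: TId A x z"
proof -
  have wf1: "wf_ctx (A # \<Gamma>)" using A by (rule ctx_extend)
  have wf2: "wf_ctx (A \<Up> 1 # A # \<Gamma>)" by (rule ty_rules A wf1 | simp)+
  have wf3: "wf_ctx (TId (A \<Up> 2) (Var 1) (Var 0) # A \<Up> 1 # A # \<Gamma>)"
    by (rule ty_rules A wf1 wf2 | simp)+
  have wf4: "wf_ctx (TId (A \<Up> 3) (Var 1) (z \<Up> 3) # TId (A \<Up> 2) (Var 1) (Var 0) # A \<Up> 1 # A # \<Gamma>)"
    by (rule ty_rules A z wf3 | simp)+
  have wf5: "wf_ctx (TId (A \<Up> 1) (Var 0) (z \<Up> 1) # A # \<Gamma>)"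
    by (rule ty_rules A z wf1 | simp)+
  have z3: "TId (A \<Up> 2) (Var 1) (Var 0) # A \<Up> 1 # A # \<Gamma> \<turnstile> z \<Up> 3 \<^bold>\<equiv> z' \<Up> 3 \<^bold>: A \<Up> 3"
    using jeq_sub[OF zz subst_ok_sh(3)[OF wf3]] .
  have z4: "TId (A \<Up> 3) (Var 1) (z \<Up> 3) # TId (A \<Up> 2) (Var 1) (Var 0) # A \<Up> 1 # A # \<Gamma> \<turnstile> z \<Up> 4 \<^bold>\<equiv>
      z' \<Up> 4 \<^bold>: A \<Up> 4"
    using jeq_sub[OF zz subst_ok_sh(4)[OF wf4]] .
  have z1: "A # \<Gamma> \<turnstile> z \<Up> 1 \<^bold>\<equiv> z' \<Up> 1 \<^bold>: A \<Up> 1"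
    using jeq_sub[OF zz subst_ok_sh(1)[OF wf1]] .
  have C: "TId (A \<Up> 2) (Var 1) (Var 0) # A \<Up> 1 # A # \<Gamma> \<turnstile>
      arr (TId (A \<Up> 3) (Var 1) (z \<Up> 3)) (TId (A \<Up> 3) (Var 2) (z \<Up> 3)) \<^bold>\<equiv>
      arr (TId (A \<Up> 3) (Var 1) (z' \<Up> 3)) (TId (A \<Up> 3) (Var 2) (z' \<Up> 3)) \<^bold>: TUniv k"
    unfolding arr_def'
    by simp (rule cong_pi cong_id z3 z4 | rule eq_refl, (rule ty_rules A z wf3 wf4 | simp)+)+
  have c: "A # \<Gamma> \<turnstile> TLam (TId (A \<Up> 1) (Var 0) (z \<Up> 1)) (Var 0) \<^bold>\<equiv> TLam (TId (A \<Up> 1) (Var 0) (z' \<Up> 1))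
      (Var 0) \<^bold>:
      sub (TRefl (Var 0) \<bullet> Var 0 \<bullet> Var 0 \<bullet> sh 1)
          (arr (TId (A \<Up> 3) (Var 1) (z \<Up> 3)) (TId (A \<Up> 3) (Var 2) (z \<Up> 3)))"
    unfolding arr_def'
    by simp (rule cong_lam cong_id z1 | rule eq_refl, (rule ty_rules A z wf1 wf5 | simp)+)+
  show ?thesis
    using cong_app[OF cong_J[unfolded wk_sh fold_sh, OF C c xx yy pp, simplified, unfolded arr_def']
        qq]
    by (simp add: concat_path_def' arr_def')
qed

lemma concat_id:
  assumes A: "\<Gamma> \<turnstile> A \<^bold>: TUniv k" and x: "\<Gamma> \<turnstile> x \<^bold>: A" and y: "\<Gamma> \<turnstile> y \<^bold>: A" and z: "\<Gamma> \<turnstile> z \<^bold>: A"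
    and p: "\<Gamma> \<turnstile> p \<^bold>: TId A x y" and q: "\<Gamma> \<turnstile> q \<^bold>: TId A y z"
    and p': "\<Gamma> \<turnstile> p' \<^bold>: TId A x y" and q': "\<Gamma> \<turnstile> q' \<^bold>: TId A y z"
    and pp: "ideq \<Gamma> (TId A x y) p p'" and qq: "ideq \<Gamma> (TId A y z) q q'"
  shows "ideq \<Gamma> (TId A x z) (concat_path A x y z p q) (concat_path A x y z p' q')"
proof -
  note h = A x y z p q p' q'
  have wf: "wf_ctx (TId A x y # \<Gamma>)" "wf_ctx (TId A y z # \<Gamma>)" by (rule ty_rules h)+
  have T: "\<Gamma> \<turnstile> TId A x y \<^bold>: TUniv k" "\<Gamma> \<turnstile> TId A y z \<^bold>: TUniv k" "\<Gamma> \<turnstile> TId A x z \<^bold>: TUniv k"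
    by (rule ty_rules h)+
  have 1: "TId A x y # \<Gamma> \<turnstile> concat_path (A \<Up> 1) (x \<Up> 1) (y \<Up> 1) (z \<Up> 1) (Var 0) (q \<Up> 1) \<^bold>: TId A x
      z \<Up> 1"
    by simp (rule concat_ty ty_rules h wf | simp)+
  have 2: "TId A y z # \<Gamma> \<turnstile> concat_path (A \<Up> 1) (x \<Up> 1) (y \<Up> 1) (z \<Up> 1) (p' \<Up> 1) (Var 0) \<^bold>: TId A x
      z \<Up> 1"
    by simp (rule concat_ty ty_rules h wf | simp)+
  show ?thesis
    by (rule id_trans[OF T(3) _ _ _ ap_id[OF T(1,3) 1 p p' pp, simplified]
        ap_id[OF T(2,3) 2 q q' qq, simplified]])
      (rule concat_ty h)+
qed

lemma concat_refl_right:
  assumes A: "\<Gamma> \<turnstile> A \<^bold>: TUniv k" and x: "\<Gamma> \<turnstile> x \<^bold>: A" and y: "\<Gamma> \<turnstile> y \<^bold>: A" and p: "\<Gamma> \<turnstile> p \<^bold>: TId A x y"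
  shows "ideq \<Gamma> (TId A x y) (concat_path A x y y p (TRefl y)) p"
proof -
  have wf1: "wf_ctx (A # \<Gamma>)" using A by (rule ctx_extend)
  have wf2: "wf_ctx (TId (A \<Up> 1) (x \<Up> 1) (Var 0) # A # \<Gamma>)" by (rule ty_rules A x wf1 | simp)+
  have C: "TId (A \<Up> 1) (x \<Up> 1) (Var 0) # A # \<Gamma> \<turnstile>
     TId (TId (A \<Up> 2) (x \<Up> 2) (Var 1))
         (concat_path (A \<Up> 2) (x \<Up> 2) (Var 1) (Var 1) (Var 0) (TRefl (Var 1))) (Var 0) \<^bold>: TUniv k"
    by (rule concat_ty ty_rules A x wf2 | simp)+
  have "ideq \<Gamma> (TId A x x) (concat_path A x x x (TRefl x) (TRefl x)) (TRefl x)"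
    by (rule id_jeq[OF _ _ concat_refl_jeq[OF A x x]]) (rule concat_ty ty_rules A x | simp)+
  then show ?thesis using based_J[OF A x C _ y p] by simp
qed

text \<open>Path induction on \<open>r\<close>. The paths \<open>p\<close> and \<open>q\<close>
  start at the endpoint that varies, so the motive quantifies over them and over the assumed
  equality. When \<open>r\<close> is reflexivity, the left unit law turns the assumption into the
  claim. This takes the place of inverse paths and associativity.\<close>

lemma concat_cancel_left:
  assumes A: "\<Gamma> \<turnstile> A \<^bold>: TUniv k" and x: "\<Gamma> \<turnstile> x \<^bold>: A" and y: "\<Gamma> \<turnstile> y \<^bold>: A" and z: "\<Gamma> \<turnstile> z \<^bold>: A"
    and r: "\<Gamma> \<turnstile> r \<^bold>: TId A x y" and p: "\<Gamma> \<turnstile> p \<^bold>: TId A y z" and q: "\<Gamma> \<turnstile> q \<^bold>: TId A y z"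
    and e: "ideq \<Gamma> (TId A x z) (concat_path A x y z r p) (concat_path A x y z r q)"
  shows "ideq \<Gamma> (TId A y z) p q"
proof -
  let ?G = "TId (A \<Up> 1) (x \<Up> 1) (Var 0) # A # \<Gamma>"
  let ?P = "TId (A \<Up> 2) (Var 1) (z \<Up> 2)"
  let ?Q = "TId (A \<Up> 3) (Var 2) (z \<Up> 3)"
  let ?E = "TId (TId (A \<Up> 4) (x \<Up> 4) (z \<Up> 4))
      (concat_path (A \<Up> 4) (x \<Up> 4) (Var 3) (z \<Up> 4) (Var 2) (Var 1))
     (concat_path (A \<Up> 4) (x \<Up> 4) (Var 3) (z \<Up> 4) (Var 2) (Var 0))"
  let ?C = "TPi ?P (TPi ?Q (TPi ?E (TId (TId (A \<Up> 5) (Var 4) (z \<Up> 5)) (Var 2) (Var 1))))"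
  have wf1: "wf_ctx (A # \<Gamma>)" using A by (rule ctx_extend)
  have wf2: "wf_ctx ?G" by (rule ty_rules A x wf1 | simp)+
  have wf3: "wf_ctx (?P # ?G)" by (rule ty_rules A x z wf2 | simp)+
  have wf4: "wf_ctx (?Q # ?P # ?G)" by (rule ty_rules A x z wf3 | simp)+
  have wf5: "wf_ctx (?E # ?Q # ?P # ?G)" by (rule concat_ty ty_rules A x z wf4 | simp)+
  have C: "?G \<turnstile> ?C \<^bold>: TUniv k"
    by (rule concat_ty ty_rules A x z wf2 wf3 wf4 wf5 | simp)+
  let ?P' = "TId A x z" and ?Q' = "TId (A \<Up> 1) (x \<Up> 1) (z \<Up> 1)"
  let ?E' = "TId (TId (A \<Up> 2) (x \<Up> 2) (z \<Up> 2))
      (concat_path (A \<Up> 2) (x \<Up> 2) (x \<Up> 2) (z \<Up> 2) (TRefl (x \<Up> 2)) (Var 1))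
     (concat_path (A \<Up> 2) (x \<Up> 2) (x \<Up> 2) (z \<Up> 2) (TRefl (x \<Up> 2)) (Var 0))"
  have v1: "wf_ctx (?P' # \<Gamma>)" by (rule ty_rules A x z | simp)+
  have v2: "wf_ctx (?Q' # ?P' # \<Gamma>)" by (rule ty_rules A x z v1 | simp)+
  have v3: "wf_ctx (?E' # ?Q' # ?P' # \<Gamma>)" by (rule concat_ty ty_rules A x z v2 | simp)+
  have e0: "?E' # ?Q' # ?P' # \<Gamma> \<turnstile> Var 0 \<^bold>:
     TId (TId (A \<Up> 3) (x \<Up> 3) (z \<Up> 3))
         (concat_path (A \<Up> 3) (x \<Up> 3) (x \<Up> 3) (z \<Up> 3) (TRefl (x \<Up> 3)) (Var 2))
     (concat_path (A \<Up> 3) (x \<Up> 3) (x \<Up> 3) (z \<Up> 3) (TRefl (x \<Up> 3)) (Var 1))"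
    by (rule var_ty v3 | simp)+
  have "ideq (?E' # ?Q' # ?P' # \<Gamma>) (TId (A \<Up> 3) (x \<Up> 3) (z \<Up> 3)) (Var 2) (Var 1)"
    by (rule id_conv[OF inhI[OF e0]]) (rule concat_refl_jeq ty_rules A x z v3 | simp)+
  then have "inh \<Gamma> (sub (TRefl x \<bullet> x \<bullet> Var) ?C)"
    by simp (intro inh_lam, assumption)
  from based_J[OF A x C this y r]
  have "inh \<Gamma> (sub (r \<bullet> y \<bullet> Var) ?C)" .
  from inh_app[OF this[simplified] p refl] have
      "inh \<Gamma> (sub (p \<bullet> r \<bullet> y \<bullet> Var)
      (TPi ?Q (TPi ?E (TId (TId (A \<Up> 5) (Var 4) (z \<Up> 5)) (Var 2) (Var 1)))))"
    by simp
  from inh_app[OF this[simplified] q refl] have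
      "inh \<Gamma> (sub (q \<bullet> p \<bullet> r \<bullet> y \<bullet> Var)
      (TPi ?E (TId (TId (A \<Up> 5) (Var 4) (z \<Up> 5)) (Var 2) (Var 1))))"
    by simp
  moreover obtain e where e: "\<Gamma> \<turnstile> e \<^bold>: TId (TId A x z) (concat_path A x y z r p)
      (concat_path A x y z r q)"
    using e by (rule inhE)
  ultimately show ?thesis by simp (rule inh_app, assumption, rule e, simp)
qed

section \<open>Propositions and function extensionality\<close>

lemma arr_app_ty: "\<Gamma> \<turnstile> f \<^bold>: arr A B \<Longrightarrow> \<Gamma> \<turnstile> a \<^bold>: A \<Longrightarrow> \<Gamma> \<turnstile> f $ a \<^bold>: B"
  unfolding arr_def' by (erule app_ty) simp_all

lemma weak_univ: "\<Gamma> \<turnstile> A \<^bold>: TUniv k \<Longrightarrow> wf_ctx (X # \<Gamma>) \<Longrightarrow> X # \<Gamma> \<turnstile> A \<Up> 1 \<^bold>: TUniv k"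
  by (erule weak_ty) simp_all

lemma arr_ty: "\<Gamma> \<turnstile> A \<^bold>: TUniv k \<Longrightarrow> \<Gamma> \<turnstile> B \<^bold>: TUniv k \<Longrightarrow> \<Gamma> \<turnstile> arr A B \<^bold>: TUniv k"
  unfolding arr_def' by (intro ty_pi weak_univ ctx_extend)

lemma prd_ty: "\<Gamma> \<turnstile> A \<^bold>: TUniv k \<Longrightarrow> \<Gamma> \<turnstile> B \<^bold>: TUniv k \<Longrightarrow> \<Gamma> \<turnstile> prd A B \<^bold>: TUniv k"
  unfolding prd_def' by (intro ty_sigma weak_univ ctx_extend)

lemma is_prop_ty:
  assumes "\<Gamma> \<turnstile> X \<^bold>: TUniv k" shows "\<Gamma> \<turnstile> is_prop X \<^bold>: TUniv k"
proof -
  have wf: "wf_ctx (X # \<Gamma>)" "wf_ctx (X \<Up> 1 # X # \<Gamma>)" by (rule ty_rules assms | simp)+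
  show ?thesis unfolding is_prop_def' by (rule ty_rules assms wf | simp)+
qed

lemma is_groupoid_ty:
  assumes "\<Gamma> \<turnstile> X \<^bold>: TUniv k" shows "\<Gamma> \<turnstile> is_groupoid X \<^bold>: TUniv k"
proof -
  \<comment> \<open>One argument types both levels: \<open>P\<close> is first \<open>is_prop\<close>
    and then \<open>is_set\<close>.\<close>
  have *: "\<Gamma> \<turnstile> TPi X (TPi (X \<Up> 1) (P (TId (X \<Up> 2) (Var 1) (Var 0)))) \<^bold>: TUniv k"
    if P: "\<And>\<Delta> T. \<Delta> \<turnstile> T \<^bold>: TUniv k \<Longrightarrow> \<Delta> \<turnstile> P T \<^bold>: TUniv k" and X: "\<Gamma> \<turnstile> X \<^bold>: TUniv k" for P \<Gamma> X
  proof -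
    have wf: "wf_ctx (X # \<Gamma>)" "wf_ctx (X \<Up> 1 # X # \<Gamma>)" by (rule ty_rules X | simp)+
    show ?thesis by (rule ty_pi P ty_rules X wf | simp)+
  qed
  have "\<Delta> \<turnstile> is_set T \<^bold>: TUniv k" if "\<Delta> \<turnstile> T \<^bold>: TUniv k" for \<Delta> T
    unfolding is_set_def' using is_prop_ty that by (rule *)
  then show ?thesis
    unfolding is_groupoid_def' using assms by (rule *)
qed

lemma is_prop_app_ty:
  "\<Gamma> \<turnstile> u \<^bold>: is_prop X \<Longrightarrow> \<Gamma> \<turnstile> a \<^bold>: X \<Longrightarrow> \<Gamma> \<turnstile> b \<^bold>: X \<Longrightarrow> \<Gamma> \<turnstile> u $ a $ b \<^bold>: TId X a b"
  unfolding is_prop_def' by (rule app_ty, rule app_ty) (assumption | simp)+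

lemma is_propD: "inh \<Gamma> (is_prop X) \<Longrightarrow> \<Gamma> \<turnstile> a \<^bold>: X \<Longrightarrow> \<Gamma> \<turnstile> b \<^bold>: X \<Longrightarrow> ideq \<Gamma> X a b"
  by (meson inh_def is_prop_app_ty)

lemma is_propI: "ideq (X \<Up> 1 # X # \<Gamma>) (X \<Up> 2) (Var 1) (Var 0) \<Longrightarrow> inh \<Gamma> (is_prop X)"
  unfolding is_prop_def' by (intro inh_lam)

lemma inh_weak: "inh \<Gamma> T \<Longrightarrow> subst_ok \<Delta> \<sigma> \<Gamma> \<Longrightarrow> inh \<Delta> (sub \<sigma> T)"
  unfolding inh_def using has_type_sub by blast

text \<open>Let \<open>r\<close> be the path from \<open>y\<close> to itself given by
  \<open>u\<close>. Every \<open>p\<close> satisfies \<open>r \<cdot> p = u y z\<close>, by path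
  induction on \<open>p\<close> with the right unit law as base case. Hence any two such paths agree
  after concatenation with \<open>r\<close>, which cancels.\<close>

lemma prop_is_set:
  assumes X: "\<Gamma> \<turnstile> X \<^bold>: TUniv k" and u: "inh \<Gamma> (is_prop X)"
    and y: "\<Gamma> \<turnstile> y \<^bold>: X" and z: "\<Gamma> \<turnstile> z \<^bold>: X" and p: "\<Gamma> \<turnstile> p \<^bold>: TId X y z" and q: "\<Gamma> \<turnstile> q \<^bold>: TId X y z"
  shows "ideq \<Gamma> (TId X y z) p q"
proof -
  obtain u where u: "\<Gamma> \<turnstile> u \<^bold>: is_prop X" using u by (rule inhE)
  let ?r = "u $ y $ y"
  have r: "\<Gamma> \<turnstile> ?r \<^bold>: TId X y y" by (rule is_prop_app_ty u y)+
  let ?G = "TId (X \<Up> 1) (y \<Up> 1) (Var 0) # X # \<Gamma>"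
  let ?C = "TId (TId (X \<Up> 2) (y \<Up> 2) (Var 1))
      (concat_path (X \<Up> 2) (y \<Up> 2) (y \<Up> 2) (Var 1) (?r \<Up> 2) (Var 0))
      (u \<Up> 2 $ y \<Up> 2 $ Var 1)"
  have wf1: "wf_ctx (X # \<Gamma>)" using X by (rule ctx_extend)
  have wf2: "wf_ctx ?G" by (rule ty_rules X y wf1 | simp)+
  have C: "?G \<turnstile> ?C \<^bold>: TUniv k"
    by (rule is_prop_app_ty concat_ty weak_ty(2)[OF r] ty_rules X y u wf2 | simp only: sub.simps
        sub_defs1 | simp)+
  have base: "inh \<Gamma> (sub (TRefl y \<bullet> y \<bullet> Var) ?C)"
    using concat_refl_right[OF X y y r] by simp
  have *: "ideq \<Gamma> (TId X y z) (concat_path X y y z ?r p) (u $ y $ z)" if p: "\<Gamma> \<turnstile> p \<^bold>: TId X y z"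
      for p
    using based_J[OF X y C base z p] by simp
  have T: "\<Gamma> \<turnstile> TId X y z \<^bold>: TUniv k" by (rule ty_rules X y z)+
  have "ideq \<Gamma> (TId X y z) (concat_path X y y z ?r p) (concat_path X y y z ?r q)"
    by (rule id_trans[OF T _ _ _ *[OF p] id_sym[OF T _ _ *[OF q]]])
       (rule concat_ty X y z r p q is_prop_app_ty u)+
  then show ?thesis using concat_cancel_left[OF X y y z r p q] by simp
qed

lemma groupoidD:
  assumes "inh \<Gamma> (is_groupoid B)" "\<Gamma> \<turnstile> x \<^bold>: B" "\<Gamma> \<turnstile> y \<^bold>: B" "\<Gamma> \<turnstile> p \<^bold>: TId B x y"
      "\<Gamma> \<turnstile> q \<^bold>: TId B x y"
  shows "inh \<Gamma> (is_prop (TId (TId B x y) p q))"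
proof -
  have "inh \<Gamma> (is_set (TId B x y))"
    using inh_app[OF inh_app[OF assms(1)[unfolded is_groupoid_def'] assms(2) refl, simplified]
        assms(3) refl] by simp
  from inh_app[OF inh_app[OF this[unfolded is_set_def'] assms(4) refl, simplified] assms(5) refl]
  show ?thesis by simp
qed

lemma fam_app_ty: "\<Gamma> \<turnstile> f \<^bold>: TPi A B \<Longrightarrow> wf_ctx (A # \<Gamma>) \<Longrightarrow> A # \<Gamma> \<turnstile> f \<Up> 1 $ Var 0 \<^bold>: B"
  by (rule app_ty[where A = "A \<Up> 1" and B = "sub (Var 0 \<bullet> sh 2) B"])
      (rule weak_ty var_ty | assumption | simp)+

lemma homotopy_ty:
  assumes "\<Gamma> \<turnstile> A \<^bold>: TUniv k" "A # \<Gamma> \<turnstile> B \<^bold>: TUniv k" "\<Gamma> \<turnstile> f \<^bold>: TPi A B" "\<Gamma> \<turnstile> g \<^bold>: TPi A B"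
  shows "\<Gamma> \<turnstile> homotopy A B f g \<^bold>: TUniv k"
  unfolding homotopy_def' by (rule ty_pi ty_id fam_app_ty ctx_extend assms)+

section \<open>Building and using equivalences\<close>

lemma inverse_ty:
  assumes X: "\<Gamma> \<turnstile> X \<^bold>: TUniv k" and Y: "\<Gamma> \<turnstile> Y \<^bold>: TUniv k" and h: "\<Gamma> \<turnstile> h \<^bold>: arr X Y"
  shows "arr Y X # \<Gamma> \<turnstile> TPi (Y \<Up> 1) (TId (Y \<Up> 2) (h \<Up> 2 $ (Var 1 $ Var 0)) (Var 0)) \<^bold>: TUniv k"
    and "arr Y X # \<Gamma> \<turnstile> TPi (X \<Up> 1) (TId (X \<Up> 2) (Var 1 $ (h \<Up> 2 $ Var 0)) (Var 0)) \<^bold>: TUniv k"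
proof -
  have wY: "wf_ctx (arr Y X # \<Gamma>)" by (rule ctx_extend arr_ty X Y)+
  have wY2: "wf_ctx (Y \<Up> 1 # arr Y X # \<Gamma>)" "wf_ctx (X \<Up> 1 # arr Y X # \<Gamma>)"
      by (rule ty_rules wY X Y | simp)+
  show "arr Y X # \<Gamma> \<turnstile> TPi (Y \<Up> 1) (TId (Y \<Up> 2) (h \<Up> 2 $ (Var 1 $ Var 0)) (Var 0)) \<^bold>: TUniv k"
    and "arr Y X # \<Gamma> \<turnstile> TPi (X \<Up> 1) (TId (X \<Up> 2) (Var 1 $ (h \<Up> 2 $ Var 0)) (Var 0)) \<^bold>: TUniv k"
    by (rule ty_rules(1-10) ty_id ty_pi arr_app_ty wY wY2 X Y h | simp)+
qed

lemma is_equiv_ty: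
  assumes X: "\<Gamma> \<turnstile> X \<^bold>: TUniv k" and Y: "\<Gamma> \<turnstile> Y \<^bold>: TUniv k" and h: "\<Gamma> \<turnstile> h \<^bold>: arr X Y"
  shows "\<Gamma> \<turnstile> is_equiv X Y h \<^bold>: TUniv k"
  unfolding is_equiv_def' by (rule prd_ty ty_sigma arr_ty X Y inverse_ty[OF X Y h])+

lemma is_equivI:
  assumes X: "\<Gamma> \<turnstile> X \<^bold>: TUniv k" and Y: "\<Gamma> \<turnstile> Y \<^bold>: TUniv k" and h: "\<Gamma> \<turnstile> h \<^bold>: arr X Y"
      and g: "\<Gamma> \<turnstile> g \<^bold>: arr Y X"
    and hg: "ideq (Y # \<Gamma>) (Y \<Up> 1) (h \<Up> 1 $ (g \<Up> 1 $ Var 0)) (Var 0)"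
    and gh: "ideq (X # \<Gamma>) (X \<Up> 1) (g \<Up> 1 $ (h \<Up> 1 $ Var 0)) (Var 0)"
  shows "inh \<Gamma> (is_equiv X Y h)"
proof -
  note P = inverse_ty[OF X Y h]
  have S: "\<Gamma> \<turnstile> TSigma (arr Y X) (TPi (Y \<Up> 1) (TId (Y \<Up> 2) (h \<Up> 2 $ (Var 1 $ Var 0)) (Var 0))) \<^bold>:
      TUniv k"
    "\<Gamma> \<turnstile> TSigma (arr Y X) (TPi (X \<Up> 1) (TId (X \<Up> 2) (Var 1 $ (h \<Up> 2 $ Var 0)) (Var 0))) \<^bold>: TUniv k"
    by (rule ty_sigma arr_ty X Y P)+
  obtain p where p: "\<Gamma> \<turnstile> p \<^bold>: TPi Y (TId (Y \<Up> 1) (h \<Up> 1 $ (g \<Up> 1 $ Var 0)) (Var 0))"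
    using inh_lam[OF hg] by (rule inhE)
  obtain q where q: "\<Gamma> \<turnstile> q \<^bold>: TPi X (TId (X \<Up> 1) (g \<Up> 1 $ (h \<Up> 1 $ Var 0)) (Var 0))"
    using inh_lam[OF gh] by (rule inhE)
  have "\<Gamma> \<turnstile> TPair (TPair g p) (TPair g q) \<^bold>: is_equiv X Y h"
    unfolding is_equiv_def' prd_def'
    by (rule ty_pair[OF weak_univ[OF S(2) ctx_extend[OF S(1)]] ty_pair[OF P(1) g]])
      (use p ty_pair[OF P(2) g, of q] q in simp_all)
  then show ?thesis by (rule inhI)
qed

text \<open>The right inverse is what later arguments extract from an equivalence: it turns a
  homotopy into a path, and a map on \<open>A\<close> into a map on its truncation.\<close>

lemma is_equiv_section:
  assumes X: "\<Gamma> \<turnstile> X \<^bold>: TUniv k" and Y: "\<Gamma> \<turnstile> Y \<^bold>: TUniv k" and h: "\<Gamma> \<turnstile> h \<^bold>: arr X Y"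
    and E: "inh \<Gamma> (is_equiv X Y h)"
  obtains s where "\<Gamma> \<turnstile> s \<^bold>: arr Y X"
    "\<And>y. \<Gamma> \<turnstile> y \<^bold>: Y \<Longrightarrow> ideq \<Gamma> Y (h $ (s $ y)) y"
proof -
  obtain E where E: "\<Gamma> \<turnstile> E \<^bold>: is_equiv X Y h" using E by (rule inhE)
  let ?P1 = "TPi (Y \<Up> 1) (TId (Y \<Up> 2) (h \<Up> 2 $ (Var 1 $ Var 0)) (Var 0))"
  let ?P2 = "TPi (X \<Up> 1) (TId (X \<Up> 2) (Var 1 $ (h \<Up> 2 $ Var 0)) (Var 0))"
  note P1 = inverse_ty(1)[OF X Y h] and P2 = inverse_ty(2)[OF X Y h]
  have A1: "\<Gamma> \<turnstile> arr Y X \<^bold>: TUniv k" by (rule arr_ty X Y)+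
  have S1: "\<Gamma> \<turnstile> TSigma (arr Y X) ?P1 \<^bold>: TUniv k" and S2: "\<Gamma> \<turnstile> TSigma (arr Y X) ?P2 \<^bold>: TUniv k"
    by (rule ty_sigma A1 P1 P2)+
  have E1: "\<Gamma> \<turnstile> fst_tm (TSigma (arr Y X) ?P1) E \<^bold>: TSigma (arr Y X) ?P1"
    by (rule fst_ty[OF S1 weak_univ[OF S2 ctx_extend[OF S1]]])
      (use E in \<open>simp add: is_equiv_def' prd_def'\<close>)
  note s = fst_ty[OF A1 P1 E1]
  note r = snd_ty[OF A1 P1 E1]
  show ?thesis
  proof (rule that[OF s])
    fix y assume y: "\<Gamma> \<turnstile> y \<^bold>: Y"
    show "ideq \<Gamma> Y (h $ (fst_tm (arr Y X) (fst_tm (TSigma (arr Y X) ?P1) E) $ y)) y"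
      by (rule inh_app[OF inhI[OF r[simplified]] y]) simp
  qed
qed

section \<open>From paths between functions to homotopies and back\<close>

lemma happly_motive:
  assumes A: "\<Gamma> \<turnstile> A \<^bold>: TUniv k" and B: "A # \<Gamma> \<turnstile> B \<^bold>: TUniv k"
  shows "TId (TPi A B \<Up> 2) (Var 1) (Var 0) # TPi A B \<Up> 1 # TPi A B # \<Gamma> \<turnstile>
      homotopy (A \<Up> 3) (sub (Var 0 \<bullet> sh 4) B) (Var 2) (Var 1) \<^bold>: TUniv k"
    and "TPi A B # \<Gamma> \<turnstile> TLam (A \<Up> 1) (TRefl (Var 1 $ Var 0)) \<^bold>:
      sub (TRefl (Var 0) \<bullet> Var 0 \<bullet> Var 0 \<bullet> sh 1)
          (homotopy (A \<Up> 3) (sub (Var 0 \<bullet> sh 4) B) (Var 2) (Var 1))"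
proof -
  let ?P = "TPi A B"
  have P: "\<Gamma> \<turnstile> ?P \<^bold>: TUniv k" by (rule ty_pi A B)+
  have w1: "wf_ctx (?P # \<Gamma>)" using P by (rule ctx_extend)
  have w2: "wf_ctx (?P \<Up> 1 # ?P # \<Gamma>)" by (rule ctx_extend weak_univ w1 P)+
  have w3: "wf_ctx (TId (?P \<Up> 2) (Var 1) (Var 0) # ?P \<Up> 1 # ?P # \<Gamma>)"
    by (rule ctx_extend ty_id weak_ty(2)[OF P] var_ty w1 w2 | simp)+
  have w4: "wf_ctx (A \<Up> 3 # TId (?P \<Up> 2) (Var 1) (Var 0) # ?P \<Up> 1 # ?P # \<Gamma>)"
    by (rule ctx_extend weak_ty(3)[OF A] w3 | simp only: sub.simps)+
  show "TId (?P \<Up> 2) (Var 1) (Var 0) # ?P \<Up> 1 # ?P # \<Gamma> \<turnstile>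
      homotopy (A \<Up> 3) (sub (Var 0 \<bullet> sh 4) B) (Var 2) (Var 1) \<^bold>: TUniv k"
  proof (rule homotopy_ty)
    show "TId (?P \<Up> 2) (Var 1) (Var 0) # ?P \<Up> 1 # ?P # \<Gamma> \<turnstile> A \<Up> 3 \<^bold>: TUniv k"
      by (rule weak_ty(3)[OF A w3]) simp
    show "A \<Up> 3 # TId (?P \<Up> 2) (Var 1) (Var 0) # ?P \<Up> 1 # ?P # \<Gamma> \<turnstile> sub (Var 0 \<bullet> sh 4) B \<^bold>: TUniv k"
      by (rule fam_ty[OF B subst_ok_sh(4)[OF w4]] var_ty w4 | simp)+
  qed (rule var_ty w3 | simp)+
  have v1: "wf_ctx (A \<Up> 1 # ?P # \<Gamma>)" by (rule ctx_extend weak_univ[OF A] w1)+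
  have "A \<Up> 1 # ?P # \<Gamma> \<turnstile> Var 0 \<Up> 1 $ Var 0 \<^bold>: sub (Var 0 \<bullet> sh 2) B"
    by (rule fam_app_ty v1 var_ty w1 | simp)+
  then show "?P # \<Gamma> \<turnstile> TLam (A \<Up> 1) (TRefl (Var 1 $ Var 0)) \<^bold>:
      sub (TRefl (Var 0) \<bullet> Var 0 \<bullet> Var 0 \<bullet> sh 1)
          (homotopy (A \<Up> 3) (sub (Var 0 \<bullet> sh 4) B) (Var 2) (Var 1))"
    unfolding homotopy_def' by simp (intro ty_lam ty_refl)
qed

lemma TId_TPi_ty:
  assumes A: "\<Gamma> \<turnstile> A \<^bold>: TUniv k" and B: "A # \<Gamma> \<turnstile> B \<^bold>: TUniv k"
    and f: "\<Gamma> \<turnstile> f \<^bold>: TPi A B" and g: "\<Gamma> \<turnstile> g \<^bold>: TPi A B"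
  shows "\<Gamma> \<turnstile> TId (TPi A B) f g \<^bold>: TUniv k"
  by (rule ty_id ty_pi assms)+

text \<open>The second clause is the computation rule that later makes the trivial homotopy the base
  case of an induction on homotopies.\<close>

lemma happly_ty:
  assumes A: "\<Gamma> \<turnstile> A \<^bold>: TUniv k" and B: "A # \<Gamma> \<turnstile> B \<^bold>: TUniv k"
    and f: "\<Gamma> \<turnstile> f \<^bold>: TPi A B" and g: "\<Gamma> \<turnstile> g \<^bold>: TPi A B"
  shows "\<Gamma> \<turnstile> happly A B f g \<^bold>: arr (TId (TPi A B) f g) (homotopy A B f g)"
    and "\<Gamma> \<turnstile> happly A B f f $ TRefl f \<^bold>\<equiv> TLam A (TRefl (f \<Up> 1 $ Var 0)) \<^bold>: homotopy A B f f"
proof -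
  let ?body = "\<lambda>f g. TJ (homotopy (A \<Up> 4) (sub (Var 0 \<bullet> sh 5) B) (Var 2) (Var 1))
           (TLam (A \<Up> 2) (TRefl (Var 1 $ Var 0))) (f \<Up> 1) (g \<Up> 1) (Var 0)"
  have *: "TId (TPi A B) f g # \<Gamma> \<turnstile> ?body f g \<^bold>: homotopy A B f g \<Up> 1"
    if f: "\<Gamma> \<turnstile> f \<^bold>: TPi A B" and g: "\<Gamma> \<turnstile> g \<^bold>: TPi A B" for f g
  proof -
    let ?D = "TId (TPi A B) f g # \<Gamma>"
    have w: "wf_ctx ?D" by (rule ctx_extend TId_TPi_ty A B f g)+
    have A1: "?D \<turnstile> A \<Up> 1 \<^bold>: TUniv k" by (rule weak_univ A w)+
    have w': "wf_ctx (A \<Up> 1 # ?D)" using A1 by (rule ctx_extend)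
    have B1: "A \<Up> 1 # ?D \<turnstile> sub (Var 0 \<bullet> sh 2) B \<^bold>: TUniv k"
      by (rule fam_ty[OF B subst_ok_sh(2)[OF w']] var_ty w' | simp)+
    have "?D \<turnstile> Var 0 \<^bold>: TId (TPi (A \<Up> 1) (sub (Var 0 \<bullet> sh 2) B)) (f \<Up> 1) (g \<Up> 1)"
      "?D \<turnstile> f \<Up> 1 \<^bold>: TPi (A \<Up> 1) (sub (Var 0 \<bullet> sh 2) B)"
      "?D \<turnstile> g \<Up> 1 \<^bold>: TPi (A \<Up> 1) (sub (Var 0 \<bullet> sh 2) B)"
      by (rule var_ty weak_ty(1)[OF f] weak_ty(1)[OF g] w | simp)+
    from ty_J'[OF happly_motive[OF A1 B1] this(2,3,1)] show ?thesis
      by simp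
  qed
  show "\<Gamma> \<turnstile> happly A B f g \<^bold>: arr (TId (TPi A B) f g) (homotopy A B f g)"
    unfolding happly_def' arr_def' using ty_lam[OF *[OF f g]] by simp
  have "\<Gamma> \<turnstile> happly A B f f $ TRefl f \<^bold>\<equiv> inst (?body f f) (TRefl f) \<^bold>: homotopy A B f f"
    using beta_pi_eq[OF *[OF f f] ty_refl[OF f] refl] by (simp add: happly_def')
  moreover have "\<Gamma> \<turnstile> inst (?body f f) (TRefl f) \<^bold>\<equiv> TLam A (TRefl (f \<Up> 1 $ Var 0)) \<^bold>: homotopy A B f
      f"
    using beta_J'[OF happly_motive[OF A B] f] by simp
  ultimately show "\<Gamma> \<turnstile> happly A B f f $ TRefl f \<^bold>\<equiv> TLam A (TRefl (f \<Up> 1 $ Var 0)) \<^bold>: homotopy A B f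
      f"
    by (rule eq_trans)
qed

lemma refl_homotopy_ty:
  assumes A: "\<Gamma> \<turnstile> A \<^bold>: TUniv k" and f: "\<Gamma> \<turnstile> f \<^bold>: TPi A B"
  shows "\<Gamma> \<turnstile> TLam A (TRefl (f \<Up> 1 $ Var 0)) \<^bold>: homotopy A B f f"
  unfolding homotopy_def' by (intro ty_lam ty_refl fam_app_ty f ctx_extend[OF A])

lemma homotopy_inverse:
  assumes A: "\<Gamma> \<turnstile> A \<^bold>: TUniv k" and B: "A # \<Gamma> \<turnstile> B \<^bold>: TUniv k"
    and f: "\<Gamma> \<turnstile> f \<^bold>: TPi A B" and g: "\<Gamma> \<turnstile> g \<^bold>: TPi A B" and P: "\<Gamma> \<turnstile> P \<^bold>: homotopy A B f g"
  obtains e where "\<Gamma> \<turnstile> e \<^bold>: TId (TPi A B) f g" "ideq \<Gamma> (homotopy A B f g) (happly A B f g $ e) P"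
proof -
  obtain s where s: "\<Gamma> \<turnstile> s \<^bold>: arr (homotopy A B f g) (TId (TPi A B) f g)"
    "ideq \<Gamma> (homotopy A B f g) (happly A B f g $ (s $ P)) P"
    using is_equiv_section[OF TId_TPi_ty[OF A B f g] homotopy_ty[OF A B f g]
        happly_ty(1)[OF A B f g]
      inhI[OF ty_funext[OF f g]]] P by metis
  show ?thesis using that[OF arr_app_ty[OF s(1) P] s(2)] .
qed

text \<open>Function extensionality presents \<open>P\<close> as \<open>happly e\<close>, up to a
  path. Path induction on \<open>e\<close> settles the family at \<open>happly e\<close>, with the
  base case supplied by the computation of \<open>happly\<close> at reflexivity; transport along
  that path moves the result to \<open>P\<close>.\<close>

lemma homotopy_ind:
  assumes A: "\<Gamma> \<turnstile> A \<^bold>: TUniv k" and B: "A # \<Gamma> \<turnstile> B \<^bold>: TUniv k"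
    and f: "\<Gamma> \<turnstile> f \<^bold>: TPi A B" and g: "\<Gamma> \<turnstile> g \<^bold>: TPi A B" and P: "\<Gamma> \<turnstile> P \<^bold>: homotopy A B f g"
    and C: "homotopy (A \<Up> 1) (sub (Var 0 \<bullet> sh 2) B) (f \<Up> 1) (Var 0) # TPi A B # \<Gamma> \<turnstile> C \<^bold>: TUniv k"
    and base: "inh \<Gamma> (sub (TLam A (TRefl (f \<Up> 1 $ Var 0)) \<bullet> f \<bullet> Var) C)"
  shows "inh \<Gamma> (sub (P \<bullet> g \<bullet> Var) C)"
proof -
  let ?P = "TPi A B"
  let ?H = "homotopy (A \<Up> 1) (sub (Var 0 \<bullet> sh 2) B) (f \<Up> 1) (Var 0)"
  let ?G = "TId (?P \<Up> 1) (f \<Up> 1) (Var 0) # ?P # \<Gamma>"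
  obtain e where e: "\<Gamma> \<turnstile> e \<^bold>: TId (TPi A B) f g"
      and eP: "ideq \<Gamma> (homotopy A B f g) (happly A B f g $ e) P"
    using homotopy_inverse[OF A B f g P] .
  have T: "\<Gamma> \<turnstile> ?P \<^bold>: TUniv k" by (rule ty_pi A B)+
  have w1: "wf_ctx (?P # \<Gamma>)" using T by (rule ctx_extend)
  have w2: "wf_ctx ?G" by (rule ctx_extend ty_id weak_univ T w1 weak_ty(1)[OF f] var_ty(1) refl)+
  have A2: "?G \<turnstile> A \<Up> 2 \<^bold>: TUniv k" by (rule weak_ty(2)[OF A w2]) simp
  have w3: "wf_ctx (A \<Up> 2 # ?G)" using A2 by (rule ctx_extend)
  have B2: "A \<Up> 2 # ?G \<turnstile> sub (Var 0 \<bullet> sh 3) B \<^bold>: TUniv k"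
    by (rule fam_ty[OF B subst_ok_sh(3)[OF w3]] var_ty w3 | simp)+
  have f2: "?G \<turnstile> f \<Up> 2 \<^bold>: TPi (A \<Up> 2) (sub (Var 0 \<bullet> sh 3) B)" by (rule weak_ty(2)[OF f w2]) simp
  have g2: "?G \<turnstile> Var 1 \<^bold>: TPi (A \<Up> 2) (sub (Var 0 \<bullet> sh 3) B)" by (rule var_ty w2 | simp)+
  let ?h = "happly (A \<Up> 2) (sub (Var 0 \<bullet> sh 3) B) (f \<Up> 2) (Var 1)"
  have h: "?G \<turnstile> ?h $ Var 0 \<^bold>: homotopy (A \<Up> 2) (sub (Var 0 \<bullet> sh 3) B) (f \<Up> 2) (Var 1)"
    by (rule arr_app_ty[OF happly_ty(1)[OF A2 B2 f2 g2]] var_ty w2 | simp)+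
  \<comment> \<open>\<open>C\<close> pulled back along \<open>happly\<close>, which makes it a
    family on paths.\<close>
  have C1: "?G \<turnstile> sub (?h $ Var 0 \<bullet> Var 1 \<bullet> sh 2) C \<^bold>: TUniv k"
    using has_type_sub[OF C subst_ok_scons[OF subst_ok_scons[OF subst_ok_sh(2)[OF w2]]], of "Var 1"
        "?h $ Var 0"]
      g2 h by simp
  have R: "\<Gamma> \<turnstile> TLam A (TRefl (f \<Up> 1 $ Var 0)) \<^bold>: homotopy A B f f"
    using A f by (rule refl_homotopy_ty)
  have D: "homotopy A B f g # \<Gamma> \<turnstile> sub (Var 0 \<bullet> g \<Up> 1 \<bullet> sh 1) C \<^bold>: TUniv k"
    if g: "\<Gamma> \<turnstile> g \<^bold>: TPi A B" for g
  proof -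
    have w: "wf_ctx (homotopy A B f g # \<Gamma>)" by (rule ctx_extend homotopy_ty A B f g)+
    have "homotopy A B f g # \<Gamma> \<turnstile> g \<Up> 1 \<^bold>: sub (sh 1) ?P" by (rule weak_ty g w refl)+
    moreover have "homotopy A B f g # \<Gamma> \<turnstile> Var 0 \<^bold>: sub (g \<Up> 1 \<bullet> sh 1) ?H"
      by (rule var_ty w | simp)+
    ultimately show ?thesis
      using has_type_sub[OF C subst_ok_scons[OF subst_ok_scons[OF subst_ok_sh(1)[OF w]]]] by simp
  qed
  have hr: "\<Gamma> \<turnstile> happly A B f f $ TRefl f \<^bold>: homotopy A B f f"
    using arr_app_ty[OF happly_ty(1)[OF A B f f] ty_refl[OF f]] .
  have "inh \<Gamma> (sub (happly A B f f $ TRefl f \<bullet> f \<bullet> Var) C)"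
    using inh_conv[OF base] eq_sym[OF inst_cong_ty[OF D[OF f] happly_ty(2)[OF A B f f] hr R]]
        by simp
  then have "inh \<Gamma> (sub (happly A B f g $ e \<bullet> g \<bullet> Var) C)"
    using based_J[OF T f C1 _ g e] by simp
  then show ?thesis
    using transport[OF homotopy_ty[OF A B f g] D[OF g] arr_app_ty[OF happly_ty(1)[OF A B f g] e] P
        eP] by simp
qed

lemma funext:
  assumes A: "\<Gamma> \<turnstile> A \<^bold>: TUniv k" and B: "A # \<Gamma> \<turnstile> B \<^bold>: TUniv k"
    and f: "\<Gamma> \<turnstile> f \<^bold>: TPi A B" and g: "\<Gamma> \<turnstile> g \<^bold>: TPi A B"
    and P: "ideq (A # \<Gamma>) B (f \<Up> 1 $ Var 0) (g \<Up> 1 $ Var 0)"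
  shows "ideq \<Gamma> (TPi A B) f g"
proof -
  obtain P where "\<Gamma> \<turnstile> P \<^bold>: homotopy A B f g"
    using inh_lam[OF P] unfolding homotopy_def' by (rule inhE)
  from homotopy_inverse[OF A B f g this] show ?thesis by (metis inhI)
qed

lemma is_prop_pi:
  assumes A: "\<Gamma> \<turnstile> A \<^bold>: TUniv k" and B: "A # \<Gamma> \<turnstile> B \<^bold>: TUniv k" and p: "inh (A # \<Gamma>) (is_prop B)"
  shows "inh \<Gamma> (is_prop (TPi A B))"
proof (rule is_propI)
  let ?P = "TPi A B"
  let ?G = "?P \<Up> 1 # ?P # \<Gamma>"
  have T: "\<Gamma> \<turnstile> ?P \<^bold>: TUniv k" by (rule ty_pi A B)+
  have w1: "wf_ctx (?P # \<Gamma>)" using T by (rule ctx_extend)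
  have w2: "wf_ctx ?G" by (rule ctx_extend weak_univ T w1)+
  have A2: "?G \<turnstile> A \<Up> 2 \<^bold>: TUniv k" by (rule weak_ty(2)[OF A w2]) simp
  have w3: "wf_ctx (A \<Up> 2 # ?G)" using A2 by (rule ctx_extend)
  have s: "subst_ok (A \<Up> 2 # ?G) (Var 0 \<bullet> sh 3) (A # \<Gamma>)"
    by (rule subst_ok_scons[OF subst_ok_sh(3)[OF w3]]) (rule var_ty w3 | simp)+
  have B2: "A \<Up> 2 # ?G \<turnstile> sub (Var 0 \<bullet> sh 3) B \<^bold>: TUniv k"
    using has_type_sub[OF B s] by simp
  have p2: "inh (A \<Up> 2 # ?G) (is_prop (sub (Var 0 \<bullet> sh 3) B))"
    using inh_weak[OF p s] by simp
  have v: "?G \<turnstile> Var 1 \<^bold>: TPi (A \<Up> 2) (sub (Var 0 \<bullet> sh 3) B)"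
      "?G \<turnstile> Var 0 \<^bold>: TPi (A \<Up> 2) (sub (Var 0 \<bullet> sh 3) B)"
    by (rule var_ty w2 | simp)+
  have "ideq ?G (TPi (A \<Up> 2) (sub (Var 0 \<bullet> sh 3) B)) (Var 1) (Var 0)"
    by (rule funext[OF A2 B2 v is_propD[OF p2 fam_app_ty[OF v(1) w3] fam_app_ty[OF v(2) w3]]])
  then show "ideq ?G (?P \<Up> 2) (Var 1) (Var 0)" by simp
qed

text \<open>After function extensionality in both arguments, two proofs give parallel paths in
  \<open>X\<close>. One of these proofs makes \<open>X\<close> a proposition, hence a set, so the
  paths agree.\<close>

lemma is_prop_is_prop:
  assumes X: "\<Gamma> \<turnstile> X \<^bold>: TUniv k"
  shows "inh \<Gamma> (is_prop (is_prop X))"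
proof (rule is_propI)
  let ?U = "is_prop X"
  let ?G = "is_prop X \<Up> 1 # is_prop X # \<Gamma>"
  have U: "\<Gamma> \<turnstile> ?U \<^bold>: TUniv k" using X by (rule is_prop_ty)
  have w1: "wf_ctx (?U # \<Gamma>)" using U by (rule ctx_extend)
  have w2: "wf_ctx ?G" by (rule ctx_extend weak_univ U w1)+
  have w3: "wf_ctx (X \<Up> 2 # ?G)" by (rule ctx_extend weak_ty(2)[OF X] w2 | simp only: sub.simps)+
  have w4: "wf_ctx (X \<Up> 3 # X \<Up> 2 # ?G)"
      by (rule ctx_extend weak_ty(3)[OF X] w3 | simp only: sub.simps)+
  have X2: "?G \<turnstile> X \<Up> 2 \<^bold>: TUniv k" and X3: "X \<Up> 2 # ?G \<turnstile> X \<Up> 3 \<^bold>: TUniv k"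
    and X4: "X \<Up> 3 # X \<Up> 2 # ?G \<turnstile> X \<Up> 4 \<^bold>: TUniv k"
    by (rule weak_ty(2-4)[OF X] w2 w3 w4 | simp)+
  let ?I = "TId (X \<Up> 4) (Var 1) (Var 0)"
  have I: "X \<Up> 3 # X \<Up> 2 # ?G \<turnstile> ?I \<^bold>: TUniv k"
    by (rule ty_id X4 var_ty w4 | simp)+
  have PI: "X \<Up> 2 # ?G \<turnstile> TPi (X \<Up> 3) ?I \<^bold>: TUniv k" by (rule ty_pi X3 I)+
  have uu: "inh (X \<Up> 3 # X \<Up> 2 # ?G) (is_prop (X \<Up> 4))"
    by (rule inhI, rule var_ty(4)[OF w4]) simp
  have v: "X \<Up> 3 # X \<Up> 2 # ?G \<turnstile> Var 3 \<^bold>: is_prop (X \<Up> 4)"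
      "X \<Up> 3 # X \<Up> 2 # ?G \<turnstile> Var 2 \<^bold>: is_prop (X \<Up> 4)"
    "X \<Up> 3 # X \<Up> 2 # ?G \<turnstile> Var 1 \<^bold>: X \<Up> 4" "X \<Up> 3 # X \<Up> 2 # ?G \<turnstile> Var 0 \<^bold>: X \<Up> 4"
    by (rule var_ty w4 | simp)+
  have eq: "ideq (X \<Up> 3 # X \<Up> 2 # ?G) ?I (Var 3 $ Var 1 $ Var 0) (Var 2 $ Var 1 $ Var 0)"
    by (rule prop_is_set[OF X4 uu v(3,4)]) (rule is_prop_app_ty v)+
  have v3: "?G \<turnstile> Var 1 \<^bold>: TPi (X \<Up> 2) (TPi (X \<Up> 3) ?I)" "?G \<turnstile> Var 0 \<^bold>: TPi (X \<Up> 2) (TPi (X \<Up> 3) ?I)"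
    by (rule var_ty w2 | simp add: is_prop_def')+
  have "ideq ?G (TPi (X \<Up> 2) (TPi (X \<Up> 3) ?I)) (Var 1) (Var 0)"
  proof (rule funext[OF X2 PI v3], rule funext[OF X3 I])
    show "X \<Up> 2 # ?G \<turnstile> Var 1 \<Up> 1 $ Var 0 \<^bold>: TPi (X \<Up> 3) ?I"
      "X \<Up> 2 # ?G \<turnstile> Var 0 \<Up> 1 $ Var 0 \<^bold>: TPi (X \<Up> 3) ?I"
      by (rule fam_app_ty v3 w3)+
  qed (use eq in simp)
  then show "ideq ?G (?U \<Up> 2) (Var 1) (Var 0)" by (simp add: is_prop_def')
qed

section \<open>Truncation, pairs and choice\<close>

lemma precomp_trunc_ty:
  assumes A: "\<Gamma> \<turnstile> A \<^bold>: TUniv k" and P: "\<Gamma> \<turnstile> P \<^bold>: TUniv k"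
  shows "\<Gamma> \<turnstile> precomp_trunc A P \<^bold>: arr (arr (TTrunc A) P) (arr A P)"
proof -
  let ?F = "arr (TTrunc A) P"
  have F: "\<Gamma> \<turnstile> ?F \<^bold>: TUniv k" by (rule arr_ty ty_trunc A P)+
  have w1: "wf_ctx (?F # \<Gamma>)" using F by (rule ctx_extend)
  have w2: "wf_ctx (A \<Up> 1 # ?F # \<Gamma>)" by (rule ctx_extend weak_univ A w1)+
  have "A \<Up> 1 # ?F # \<Gamma> \<turnstile> Var 1 $ TTruncIn (Var 0) \<^bold>: P \<Up> 2"
    by (rule arr_app_ty[where A = "TTrunc (A \<Up> 2)"] ty_trunc_in var_ty w2 | simp)+
  then show ?thesis
    unfolding precomp_trunc_def' arr_def'[of "arr (TTrunc A) P"]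
    by (intro ty_lam) (simp add: arr_def', intro ty_lam)
qed

text \<open>A right inverse of precomposition sends a map on \<open>A\<close> to a map on its
  truncation, which is then applied to \<open>x\<close>.\<close>

lemma trunc_elim:
  assumes A: "\<Gamma> \<turnstile> A \<^bold>: TUniv k" and P: "\<Gamma> \<turnstile> P \<^bold>: TUniv k" and h: "inh \<Gamma> (is_prop P)"
    and f: "inh (A # \<Gamma>) (P \<Up> 1)" and x: "\<Gamma> \<turnstile> x \<^bold>: TTrunc A"
  shows "inh \<Gamma> P"
proof -
  obtain h where h: "\<Gamma> \<turnstile> h \<^bold>: is_prop P" using h by (rule inhE)
  obtain f where f: "\<Gamma> \<turnstile> f \<^bold>: arr A P" using inh_lam[OF f] unfolding arr_def' by (rule inhE)
  obtain s where "\<Gamma> \<turnstile> s \<^bold>: arr (arr A P) (arr (TTrunc A) P)"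
    using is_equiv_section[OF _ _ precomp_trunc_ty[OF A P] inhI[OF ty_trunc_up[OF A P h]]]
      arr_ty ty_trunc A P by metis
  from arr_app_ty[OF arr_app_ty[OF this f] x] show ?thesis by (rule inhI)
qed

lemma sigma_ind:
  assumes A: "\<Gamma> \<turnstile> A \<^bold>: TUniv k" and B: "A # \<Gamma> \<turnstile> B \<^bold>: TUniv k" and C: "TSigma A B # \<Gamma> \<turnstile> C \<^bold>: TUniv k"
    and g: "inh (B # A # \<Gamma>) (sub (TPair (Var 1) (Var 0) \<bullet> sh 2) C)" and p: "\<Gamma> \<turnstile> p \<^bold>: TSigma A B"
  shows "inh \<Gamma> (inst C p)"
  using g ty_ind_sigma'[OF C _ p] unfolding inh_def by blast

text \<open>Dependent sums come without judgemental \<eta>. By the eliminator it suffices to treat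
  pairs, where the projections compute.\<close>

lemma pair_eta:
  assumes A: "\<Gamma> \<turnstile> A \<^bold>: TUniv k" and B: "A # \<Gamma> \<turnstile> B \<^bold>: TUniv k" and p: "\<Gamma> \<turnstile> p \<^bold>: TSigma A B"
  shows "ideq \<Gamma> (TSigma A B) (TPair (fst_tm A p) (snd_tm A B p)) p"
proof -
  \<comment> \<open>This and the next fact are stated for every context because the induction uses
    them in contexts with further variables.\<close>
  have pair: "\<Gamma> \<turnstile> TPair (fst_tm A p) (snd_tm A B p) \<^bold>: TSigma A B"
    if A: "\<Gamma> \<turnstile> A \<^bold>: TUniv k" and B: "A # \<Gamma> \<turnstile> B \<^bold>: TUniv k" and p: "\<Gamma> \<turnstile> p \<^bold>: TSigma A B" for \<Gamma> A B p
    by (rule ty_pair[OF B fst_ty[OF A B p] snd_ty[OF A B p]])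
  have pair_pair: "ideq \<Gamma> (TSigma A B) (TPair (fst_tm A (TPair a b)) (snd_tm A B (TPair a b)))
      (TPair a b)"
    if A: "\<Gamma> \<turnstile> A \<^bold>: TUniv k" and B: "A # \<Gamma> \<turnstile> B \<^bold>: TUniv k" and a: "\<Gamma> \<turnstile> a \<^bold>: A"
        and b: "\<Gamma> \<turnstile> b \<^bold>: inst B a" for \<Gamma> A B a b
  proof -
    have p: "\<Gamma> \<turnstile> TPair a b \<^bold>: TSigma A B" by (rule ty_pair[OF B a b])
    note e = inst_cong_ty[OF B fst_pair[OF A B a b] fst_ty[OF A B p] a]
    show ?thesis
      by (rule id_jeq[OF ty_sigma[OF A B] pair[OF A B p]
            cong_pair[OF B fst_pair[OF A B a b] eq_conv[OF snd_pair[OF A B a b] eq_sym[OF e]]]])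
  qed
  let ?S = "TSigma A B"
  have S: "\<Gamma> \<turnstile> ?S \<^bold>: TUniv k" by (rule ty_sigma A B)+
  have w: "wf_ctx (A # \<Gamma>)" "wf_ctx (B # A # \<Gamma>)" "wf_ctx (?S # \<Gamma>)"
    by (rule ctx_extend A B S)+
  have A1: "?S # \<Gamma> \<turnstile> A \<Up> 1 \<^bold>: TUniv k" by (rule weak_univ A w)+
  have w1: "wf_ctx (A \<Up> 1 # ?S # \<Gamma>)" using A1 by (rule ctx_extend)
  have B1: "A \<Up> 1 # ?S # \<Gamma> \<turnstile> sub (Var 0 \<bullet> sh 2) B \<^bold>: TUniv k"
    by (rule fam_ty[OF B subst_ok_sh(2)[OF w1]] var_ty w1 | simp)+
  have A2: "B # A # \<Gamma> \<turnstile> A \<Up> 2 \<^bold>: TUniv k" by (rule weak_ty(2)[OF A w(2)]) simp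
  have w2: "wf_ctx (A \<Up> 2 # B # A # \<Gamma>)" using A2 by (rule ctx_extend)
  have B2: "A \<Up> 2 # B # A # \<Gamma> \<turnstile> sub (Var 0 \<bullet> sh 3) B \<^bold>: TUniv k"
    by (rule fam_ty[OF B subst_ok_sh(3)[OF w2]] var_ty w2 | simp)+
  have v: "?S # \<Gamma> \<turnstile> Var 0 \<^bold>: TSigma (A \<Up> 1) (sub (Var 0 \<bullet> sh 2) B)"
    by (rule var_ty w | simp)+
  have C: "?S # \<Gamma> \<turnstile> TId (TSigma (A \<Up> 1) (sub (Var 0 \<bullet> sh 2) B))
     (TPair (fst_tm (A \<Up> 1) (Var 0)) (snd_tm (A \<Up> 1) (sub (Var 0 \<bullet> sh 2) B) (Var 0))) (Var 0) \<^bold>: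
         TUniv k"
    by (rule ty_id ty_sigma A1 B1 pair v)+
  have v2: "B # A # \<Gamma> \<turnstile> Var 1 \<^bold>: A \<Up> 2" "B # A # \<Gamma> \<turnstile> Var 0 \<^bold>: inst (sub (Var 0 \<bullet> sh 3) B) (Var 1)"
    by (rule var_ty w | simp)+
  show ?thesis
    using sigma_ind[OF A B C _ p] pair_pair[OF A2 B2 v2] by simp
qed

text \<open>To avoid following \<open>b\<close> along the path between first components, the
  transport motive at \<open>x\<close> asks for equality with every pair whose first component is
  \<open>x\<close>. At \<open>a\<close> itself the first components coincide, and the second ones
  agree because \<open>B\<close> is a proposition there.\<close>

lemma sigma_eq_pair:
  assumes A: "\<Gamma> \<turnstile> A \<^bold>: TUniv k" and B: "A # \<Gamma> \<turnstile> B \<^bold>: TUniv k" and pB: "inh (A # \<Gamma>) (is_prop B)"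
    and a: "\<Gamma> \<turnstile> a \<^bold>: A" and b: "\<Gamma> \<turnstile> b \<^bold>: inst B a"
    and a': "\<Gamma> \<turnstile> a' \<^bold>: A" and b': "\<Gamma> \<turnstile> b' \<^bold>: inst B a'"
    and e: "ideq \<Gamma> A a a'"
  shows "ideq \<Gamma> (TSigma A B) (TPair a b) (TPair a' b')"
proof -
  have 0: "ideq \<Gamma> (TSigma A B) (TPair a b) (TPair a b')"
    if A: "\<Gamma> \<turnstile> A \<^bold>: TUniv k" and B: "A # \<Gamma> \<turnstile> B \<^bold>: TUniv k" and pB: "inh (A # \<Gamma>) (is_prop B)"
      and a: "\<Gamma> \<turnstile> a \<^bold>: A" and b: "\<Gamma> \<turnstile> b \<^bold>: inst B a" and b': "\<Gamma> \<turnstile> b' \<^bold>: inst B a" for \<Gamma> A B a b b'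
  proof -
    have s: "subst_ok \<Gamma> (a \<bullet> Var) (A # \<Gamma>)"
      using subst_ok_scons[OF subst_ok_Var[OF wf_ctxI[OF a]]] a by simp
    have e: "ideq \<Gamma> (inst B a) b b'"
      by (rule is_propD[OF _ b b']) (use inh_weak[OF pB s] in simp)
    have Ba: "\<Gamma> \<turnstile> inst B a \<^bold>: TUniv k" using has_type_sub[OF B s] by simp
    have w: "wf_ctx (inst B a # \<Gamma>)" using Ba by (rule ctx_extend)
    have w': "wf_ctx (A \<Up> 1 # inst B a # \<Gamma>)" by (rule ctx_extend weak_univ A w)+
    have "inst B a # \<Gamma> \<turnstile> TPair (a \<Up> 1) (Var 0) \<^bold>: TSigma A B \<Up> 1"
      by simp (rule ty_pair fam_ty[OF B subst_ok_sh(2)[OF w']] weak_ty(1)[OF a] var_ty w w' | simp)+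
    from ap_id[OF Ba ty_sigma[OF A B] this b b' e] show ?thesis by simp
  qed
  have w: "wf_ctx (A # \<Gamma>)" and w': "wf_ctx (B # A # \<Gamma>)" by (rule ctx_extend A B)+
  have S: "\<Gamma> \<turnstile> TSigma A B \<^bold>: TUniv k" by (rule ty_sigma A B)+
  have A2: "B # A # \<Gamma> \<turnstile> A \<Up> 2 \<^bold>: TUniv k" by (rule weak_ty(2)[OF A w']) simp
  have w2: "wf_ctx (A \<Up> 2 # B # A # \<Gamma>)" using A2 by (rule ctx_extend)
  have B2: "A \<Up> 2 # B # A # \<Gamma> \<turnstile> sub (Var 0 \<bullet> sh 3) B \<^bold>: TUniv k"
    by (rule fam_ty[OF B subst_ok_sh(3)[OF w2]] var_ty w2 | simp)+
  have p1: "B # A # \<Gamma> \<turnstile> TPair a b \<Up> 2 \<^bold>: TSigma A B \<Up> 2"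
      by (rule weak_ty(2)[OF ty_pair[OF B a b] w' refl])
  have p2: "B # A # \<Gamma> \<turnstile> TPair (Var 1) (Var 0) \<^bold>: TSigma A B \<Up> 2"
    by simp (rule ty_pair B2 var_ty w' | simp)+
  have S2: "B # A # \<Gamma> \<turnstile> TSigma A B \<Up> 2 \<^bold>: TUniv k" by (rule weak_ty(2)[OF S w']) simp
  have D: "A # \<Gamma> \<turnstile> TPi B (TId (TSigma A B \<Up> 2) (TPair a b \<Up> 2) (TPair (Var 1) (Var 0))) \<^bold>: TUniv k"
    by (rule ty_pi[OF B] ty_id[OF S2] p1 p2)+
  have Ba: "\<Gamma> \<turnstile> inst B a \<^bold>: TUniv k" using inst_ty[OF B a] by simp
  have v: "wf_ctx (inst B a # \<Gamma>)" using Ba by (rule ctx_extend)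
  have A1: "inst B a # \<Gamma> \<turnstile> A \<Up> 1 \<^bold>: TUniv k" by (rule weak_univ A v)+
  have v1: "wf_ctx (A \<Up> 1 # inst B a # \<Gamma>)" using A1 by (rule ctx_extend)
  have s1: "subst_ok (A \<Up> 1 # inst B a # \<Gamma>) (Var 0 \<bullet> sh 2) (A # \<Gamma>)"
    by (rule subst_ok_scons subst_ok_sh(2) var_ty v1 | simp)+
  have "ideq (inst B a # \<Gamma>) (TSigma (A \<Up> 1) (sub (Var 0 \<bullet> sh 2) B)) (TPair (a \<Up> 1) (b \<Up> 1))
      (TPair (a \<Up> 1) (Var 0))"
  proof (rule 0[OF A1])
    show "A \<Up> 1 # inst B a # \<Gamma> \<turnstile> sub (Var 0 \<bullet> sh 2) B \<^bold>: TUniv k" using has_type_sub[OF B s1]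
        by simp
    show "inh (A \<Up> 1 # inst B a # \<Gamma>) (is_prop (sub (Var 0 \<bullet> sh 2) B))" using inh_weak[OF pB s1]
        by simp
  qed (rule weak_ty(1)[OF a] weak_ty(1)[OF b] var_ty v | simp)+
  then have "inh \<Gamma> (inst (TPi B (TId (TSigma A B \<Up> 2) (TPair a b \<Up> 2) (TPair (Var 1) (Var 0)))) a)"
    by simp (rule inh_lam)
  from inh_app[OF transport[OF A D a a' e this, simplified] b' refl] show ?thesis by simp
qed

lemma sigma_eq:
  assumes A: "\<Gamma> \<turnstile> A \<^bold>: TUniv k" and B: "A # \<Gamma> \<turnstile> B \<^bold>: TUniv k" and pB: "inh (A # \<Gamma>) (is_prop B)"
    and w: "\<Gamma> \<turnstile> w \<^bold>: TSigma A B" and w': "\<Gamma> \<turnstile> w' \<^bold>: TSigma A B"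
    and e: "ideq \<Gamma> A (fst_tm A w) (fst_tm A w')"
  shows "ideq \<Gamma> (TSigma A B) w w'"
proof -
  note S = ty_sigma[OF A B]
  note fw = fst_ty[OF A B w] fst_ty[OF A B w'] snd_ty[OF A B w] snd_ty[OF A B w']
  note pw = ty_pair[OF B fw(1,3)] ty_pair[OF B fw(2,4)]
  show ?thesis
    by (rule id_trans[OF S w pw(1) w' id_sym[OF S pw(1) w pair_eta[OF A B w]]
         id_trans[OF S pw w' sigma_eq_pair[OF A B pB fw(1,3,2,4) e] pair_eta[OF A B w']]])
qed

text \<open>A dependent sum carries its witness, so the function is the first projection under a
  \<lambda>; \<beta> turns the second projection into a statement about its values.\<close>

lemma choice:
  assumes X: "\<Gamma> \<turnstile> X \<^bold>: TUniv k" and Y: "X # \<Gamma> \<turnstile> Y \<^bold>: TUniv k" and Z: "Y # X # \<Gamma> \<turnstile> Z \<^bold>: TUniv k"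
    and t: "inh (X # \<Gamma>) (TSigma Y Z)"
  obtains h where "\<Gamma> \<turnstile> h \<^bold>: TPi X Y" "inh (X # \<Gamma>) (inst Z (h \<Up> 1 $ Var 0))"
proof -
  obtain t where t: "X # \<Gamma> \<turnstile> t \<^bold>: TSigma Y Z" using t by (rule inhE)
  note f = fst_ty[OF Y Z t] and s = snd_ty[OF Y Z t]
  let ?h = "TLam X (fst_tm Y t)"
  have h: "\<Gamma> \<turnstile> ?h \<^bold>: TPi X Y" using f by (rule ty_lam)
  have w: "wf_ctx (X # \<Gamma>)" using X by (rule ctx_extend)
  have w': "wf_ctx (X \<Up> 1 # X # \<Gamma>)" by (rule ctx_extend weak_univ X w)+
  have v: "X # \<Gamma> \<turnstile> Var 0 \<^bold>: X \<Up> 1" by (rule var_ty w refl)+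
  have f2: "X \<Up> 1 # X # \<Gamma> \<turnstile> sub (Var 0 \<bullet> sh 2) (fst_tm Y t) \<^bold>: sub (Var 0 \<bullet> sh 2) Y"
    by (rule fam_ty[OF f subst_ok_sh(2)[OF w']] var_ty w' | simp)+
  have e: "X # \<Gamma> \<turnstile> ?h \<Up> 1 $ Var 0 \<^bold>\<equiv> fst_tm Y t \<^bold>: Y"
    using beta_pi[OF f2 v] by simp
  have "inh (X # \<Gamma>) (inst Z (?h \<Up> 1 $ Var 0))"
    by (rule inh_conv[OF inhI[OF s] inst_cong_ty[OF Z eq_sym[OF e] f fam_app_ty[OF h w]]])
  with h show ?thesis by (rule that)
qed

section \<open>Cocones under a coherent map\<close>

text \<open>\<open>c\<close> is a term because cocones mention it in their types, whereas coherence
  is recorded as inhabited. As one HOL predicate, the data moves along a substitution in a single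
  step.\<close>

definition coherent_map :: "tm list \<Rightarrow> nat \<Rightarrow> tm \<Rightarrow> tm \<Rightarrow> tm \<Rightarrow> tm \<Rightarrow> bool" where
  "coherent_map \<Gamma> k A B f c \<longleftrightarrow> \<Gamma> \<turnstile> A \<^bold>: TUniv k \<and> \<Gamma> \<turnstile> B \<^bold>: TUniv k \<and> inh \<Gamma> (is_groupoid B) \<and>
     \<Gamma> \<turnstile> f \<^bold>: arr A B \<and> \<Gamma> \<turnstile> c \<^bold>: const_ty A B f \<and> inh \<Gamma> (coh_ty A B f c)"

lemma coherent_mapD:
  assumes "coherent_map \<Gamma> k A B f c"
  shows "\<Gamma> \<turnstile> A \<^bold>: TUniv k" "\<Gamma> \<turnstile> B \<^bold>: TUniv k" "inh \<Gamma> (is_groupoid B)"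
    "\<Gamma> \<turnstile> f \<^bold>: arr A B" "\<Gamma> \<turnstile> c \<^bold>: const_ty A B f" "inh \<Gamma> (coh_ty A B f c)"
  using assms by (auto simp: coherent_map_def)

lemma coherent_map_sub:
  assumes "coherent_map \<Gamma> k A B f c" "subst_ok \<Delta> \<sigma> \<Gamma>"
  shows "coherent_map \<Delta> k (sub \<sigma> A) (sub \<sigma> B) (sub \<sigma> f) (sub \<sigma> c)"
  using assms has_type_sub[of \<Gamma> _ _ \<Delta> \<sigma>] inh_weak[of \<Gamma> _ \<Delta> \<sigma>] unfolding coherent_map_def
  by (metis sub_defs1(1) sub_defs(1,5,6) sub.simps(2))

lemmas coherent_map_weak = coherent_map_sub[OF _ subst_ok_sh(1)]
    coherent_map_sub[OF _ subst_ok_sh(2)]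
  coherent_map_sub[OF _ subst_ok_sh(3)] coherent_map_sub[OF _ subst_ok_sh(4)]

lemma const_app_ty:
  "\<Gamma> \<turnstile> c \<^bold>: const_ty A B f \<Longrightarrow> \<Gamma> \<turnstile> a \<^bold>: A \<Longrightarrow> \<Gamma> \<turnstile> b \<^bold>: A \<Longrightarrow>
    \<Gamma> \<turnstile> c $ a $ b \<^bold>: TId B (f $ a) (f $ b)"
  unfolding const_ty_def' by (rule app_ty, rule app_ty) (assumption | simp)+

lemma coh_app:
  assumes "inh \<Gamma> (coh_ty A B f c)" "\<Gamma> \<turnstile> x \<^bold>: A" "\<Gamma> \<turnstile> y \<^bold>: A" "\<Gamma> \<turnstile> z \<^bold>: A"
  shows "ideq \<Gamma> (TId B (f $ x) (f $ z))
      (concat_path B (f $ x) (f $ y) (f $ z) (c $ x $ y) (c $ y $ z)) (c $ x $ z)"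
proof -
  from inh_app[OF inh_app[OF assms(1)[unfolded coh_ty_def'] assms(2) refl, simplified] assms(3)
      refl, simplified]
  show ?thesis using assms(4) by (elim inh_app) (assumption | simp)+
qed

definition leg :: "tm \<Rightarrow> tm \<Rightarrow> tm \<Rightarrow> tm \<Rightarrow> tm" where
  "leg A B f b = TPi A (TId (B \<Up> 1) (f \<Up> 1 $ Var 0) (b \<Up> 1))"

definition leg_coh :: "tm \<Rightarrow> tm \<Rightarrow> tm \<Rightarrow> tm \<Rightarrow> tm \<Rightarrow> tm \<Rightarrow> tm" where
  "leg_coh A B f c b p = TPi A (TPi (A \<Up> 1) (TId (TId (B \<Up> 2) (f \<Up> 2 $ Var 1) (b \<Up> 2))
     (concat_path (B \<Up> 2) (f \<Up> 2 $ Var 1) (f \<Up> 2 $ Var 0) (b \<Up> 2)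
        (c \<Up> 2 $ Var 1 $ Var 0) (p \<Up> 2 $ Var 0))
     (p \<Up> 2 $ Var 1)))"

definition cocone :: "tm \<Rightarrow> tm \<Rightarrow> tm \<Rightarrow> tm \<Rightarrow> tm \<Rightarrow> tm" where
  "cocone A B f c b = TSigma (leg A B f b)
      (leg_coh (A \<Up> 1) (B \<Up> 1) (f \<Up> 1) (c \<Up> 1) (b \<Up> 1) (Var 0))"

definition apex :: "tm \<Rightarrow> tm \<Rightarrow> tm \<Rightarrow> tm \<Rightarrow> tm" where
  "apex A B f c = TSigma B (cocone (A \<Up> 1) (B \<Up> 1) (f \<Up> 1) (c \<Up> 1) (Var 0))"

lemma sub_leg [simp]:
  "sub \<sigma> (leg A B f b) = leg (sub \<sigma> A) (sub \<sigma> B) (sub \<sigma> f) (sub \<sigma> b)"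
  "sub \<sigma> (leg_coh A B f c b p) = leg_coh (sub \<sigma> A) (sub \<sigma> B) (sub \<sigma> f) (sub \<sigma> c) (sub \<sigma> b)
      (sub \<sigma> p)"
  by (simp_all add: leg_def leg_coh_def)

lemma sub_cocone [simp]:
  "sub \<sigma> (cocone A B f c b) = cocone (sub \<sigma> A) (sub \<sigma> B) (sub \<sigma> f) (sub \<sigma> c) (sub \<sigma> b)"
  by (simp add: cocone_def)

lemma sub_apex [simp]:
  "sub \<sigma> (apex A B f c) = apex (sub \<sigma> A) (sub \<sigma> B) (sub \<sigma> f) (sub \<sigma> c)"
  by (simp add: apex_def)

lemma leg_app_ty: "\<Gamma> \<turnstile> p \<^bold>: leg A B f b \<Longrightarrow> \<Gamma> \<turnstile> a \<^bold>: A \<Longrightarrow> \<Gamma> \<turnstile> p $ a \<^bold>: TId B (f $ a) b"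
  unfolding leg_def by (erule app_ty) simp_all

lemma leg_coh_app:
  assumes "inh \<Gamma> (leg_coh A B f c b p)" "\<Gamma> \<turnstile> x \<^bold>: A" "\<Gamma> \<turnstile> y \<^bold>: A"
  shows "ideq \<Gamma> (TId B (f $ x) b) (concat_path B (f $ x) (f $ y) b (c $ x $ y) (p $ y)) (p $ x)"
  using inh_app[OF inh_app[OF assms(1)[unfolded leg_coh_def] assms(2) refl, simplified] assms(3)
      refl] by simp

lemmas app_rules = ty_id concat_ty const_app_ty leg_app_ty arr_app_ty

lemma leg_ty:
  assumes "\<Gamma> \<turnstile> A \<^bold>: TUniv k" "\<Gamma> \<turnstile> B \<^bold>: TUniv k" "\<Gamma> \<turnstile> f \<^bold>: arr A B" "\<Gamma> \<turnstile> b \<^bold>: B"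
  shows "\<Gamma> \<turnstile> leg A B f b \<^bold>: TUniv k" "A # \<Gamma> \<turnstile> TId (B \<Up> 1) (f \<Up> 1 $ Var 0) (b \<Up> 1) \<^bold>: TUniv k"
proof -
  have w: "wf_ctx (A # \<Gamma>)" using assms(1) by (rule ctx_extend)
  have f: "A # \<Gamma> \<turnstile> f \<Up> 1 \<^bold>: arr (A \<Up> 1) (B \<Up> 1)" by (rule weak_ty(1)[OF assms(3) w]) simp
  show *: "A # \<Gamma> \<turnstile> TId (B \<Up> 1) (f \<Up> 1 $ Var 0) (b \<Up> 1) \<^bold>: TUniv k"
    by (rule ty_id weak_univ assms w arr_app_ty f weak_ty(1)[OF assms(4) w] var_ty refl)+
  show "\<Gamma> \<turnstile> leg A B f b \<^bold>: TUniv k"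
    unfolding leg_def by (rule ty_pi assms *)+
qed

lemma leg_coh_body_ty:
  assumes D: "coherent_map \<Gamma> k A B f c" and b: "\<Gamma> \<turnstile> b \<^bold>: B" and p: "\<Gamma> \<turnstile> p \<^bold>: leg A B f b"
    and x: "\<Gamma> \<turnstile> x \<^bold>: A" and y: "\<Gamma> \<turnstile> y \<^bold>: A"
  shows "\<Gamma> \<turnstile> TId (TId B (f $ x) b)
    (concat_path B (f $ x) (f $ y) b (c $ x $ y) (p $ y)) (p $ x) \<^bold>: TUniv k"
    and "inh \<Gamma> (is_prop (TId (TId B (f $ x) b)
    (concat_path B (f $ x) (f $ y) b (c $ x $ y) (p $ y)) (p $ x)))"
proof -
  note d = coherent_mapD[OF D]
  show "\<Gamma> \<turnstile> TId (TId B (f $ x) b)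
    (concat_path B (f $ x) (f $ y) b (c $ x $ y) (p $ y)) (p $ x) \<^bold>: TUniv k"
    by (rule app_rules d b p x y)+
  show "inh \<Gamma> (is_prop (TId (TId B (f $ x) b)
    (concat_path B (f $ x) (f $ y) b (c $ x $ y) (p $ y)) (p $ x)))"
    by (rule groupoidD[OF d(3)]) (rule app_rules d b p x y)+
qed

lemma leg_coh_ty:
  assumes D: "coherent_map \<Gamma> k A B f c" and b: "\<Gamma> \<turnstile> b \<^bold>: B" and p: "\<Gamma> \<turnstile> p \<^bold>: leg A B f b"
  shows "\<Gamma> \<turnstile> leg_coh A B f c b p \<^bold>: TUniv k" "inh \<Gamma> (is_prop (leg_coh A B f c b p))"
proof -
  note d = coherent_mapD[OF D]
  have w1: "wf_ctx (A # \<Gamma>)" using d(1) by (rule ctx_extend)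
  have A1: "A # \<Gamma> \<turnstile> A \<Up> 1 \<^bold>: TUniv k" by (rule weak_univ d w1)+
  have w2: "wf_ctx (A \<Up> 1 # A # \<Gamma>)" using A1 by (rule ctx_extend)
  note D2 = coherent_map_weak(2)[OF D w2]
  have b2: "A \<Up> 1 # A # \<Gamma> \<turnstile> b \<Up> 2 \<^bold>: B \<Up> 2" by (rule weak_ty(2)[OF b w2 refl])
  have p2: "A \<Up> 1 # A # \<Gamma> \<turnstile> p \<Up> 2 \<^bold>: leg (A \<Up> 2) (B \<Up> 2) (f \<Up> 2) (b \<Up> 2)"
      by (rule weak_ty(2)[OF p w2]) simp
  have v: "A \<Up> 1 # A # \<Gamma> \<turnstile> Var 1 \<^bold>: A \<Up> 2" "A \<Up> 1 # A # \<Gamma> \<turnstile> Var 0 \<^bold>: A \<Up> 2"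
    by (rule var_ty w2 | simp)+
  note body = leg_coh_body_ty[OF D2 b2 p2 v]
  show "\<Gamma> \<turnstile> leg_coh A B f c b p \<^bold>: TUniv k"
    unfolding leg_coh_def by (rule ty_pi d A1 body)+
  show "inh \<Gamma> (is_prop (leg_coh A B f c b p))"
    unfolding leg_coh_def by (rule is_prop_pi[OF d(1)] is_prop_pi[OF A1] ty_pi A1 body)+
qed

lemma leg_coh_var_ty:
  assumes D: "coherent_map \<Gamma> k A B f c" and b: "\<Gamma> \<turnstile> b \<^bold>: B"
  shows "leg A B f b # \<Gamma> \<turnstile> leg_coh (A \<Up> 1) (B \<Up> 1) (f \<Up> 1) (c \<Up> 1) (b \<Up> 1) (Var 0) \<^bold>: TUniv k"
    and "inh (leg A B f b # \<Gamma>) (is_prop (leg_coh (A \<Up> 1) (B \<Up> 1) (f \<Up> 1) (c \<Up> 1) (b \<Up> 1) (Var 0)))"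
proof -
  have w: "wf_ctx (leg A B f b # \<Gamma>)" by (rule ctx_extend leg_ty coherent_mapD[OF D] b)+
  have v: "leg A B f b # \<Gamma> \<turnstile> Var 0 \<^bold>: leg (A \<Up> 1) (B \<Up> 1) (f \<Up> 1) (b \<Up> 1)"
    by (rule var_ty w | simp)+
  note * = leg_coh_ty[OF coherent_map_weak(1)[OF D w] weak_ty(1)[OF b w refl] v]
  show "leg A B f b # \<Gamma> \<turnstile> leg_coh (A \<Up> 1) (B \<Up> 1) (f \<Up> 1) (c \<Up> 1) (b \<Up> 1) (Var 0) \<^bold>: TUniv k"
    and "inh (leg A B f b # \<Gamma>) (is_prop (leg_coh (A \<Up> 1) (B \<Up> 1) (f \<Up> 1) (c \<Up> 1) (b \<Up> 1) (Var 0)))"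
    by (fact *)+
qed

lemma cocone_ty:
  assumes D: "coherent_map \<Gamma> k A B f c" and b: "\<Gamma> \<turnstile> b \<^bold>: B"
  shows "\<Gamma> \<turnstile> cocone A B f c b \<^bold>: TUniv k"
  unfolding cocone_def by (rule ty_sigma leg_ty leg_coh_var_ty[OF D b] coherent_mapD[OF D] b)+

lemma cocone_fst_ty:
  assumes D: "coherent_map \<Gamma> k A B f c" and b: "\<Gamma> \<turnstile> b \<^bold>: B" and w: "\<Gamma> \<turnstile> w \<^bold>: cocone A B f c b"
  shows "\<Gamma> \<turnstile> fst_tm (leg A B f b) w \<^bold>: leg A B f b"
    and "inh \<Gamma> (leg_coh A B f c b (fst_tm (leg A B f b) w))"
proof -
  note l = leg_ty(1)[OF coherent_mapD(1,2,4)[OF D] b]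
  show "\<Gamma> \<turnstile> fst_tm (leg A B f b) w \<^bold>: leg A B f b"
    using fst_ty[OF l leg_coh_var_ty(1)[OF D b] w[unfolded cocone_def]] .
  show "inh \<Gamma> (leg_coh A B f c b (fst_tm (leg A B f b) w))"
    using inhI[OF snd_ty[OF l leg_coh_var_ty(1)[OF D b] w[unfolded cocone_def]]] by simp
qed

text \<open>Pointwise equal legs are equal by function extensionality, and the conditions on them
  form a proposition, so \<open>sigma_eq\<close> applies.\<close>

lemma cocone_eq:
  assumes D: "coherent_map \<Gamma> k A B f c" and b: "\<Gamma> \<turnstile> b \<^bold>: B"
    and w: "\<Gamma> \<turnstile> w \<^bold>: cocone A B f c b" and w': "\<Gamma> \<turnstile> w' \<^bold>: cocone A B f c b"
    and e: "ideq (A # \<Gamma>) (TId (B \<Up> 1) (f \<Up> 1 $ Var 0) (b \<Up> 1)) (fst_tm (leg A B f b) w \<Up> 1 $ Var 0)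
        (fst_tm (leg A B f b) w' \<Up> 1 $ Var 0)"
  shows "ideq \<Gamma> (cocone A B f c b) w w'"
proof -
  note d = coherent_mapD[OF D]
  note l = leg_ty[OF d(1,2,4) b]
  note lc = leg_coh_var_ty[OF D b]
  have "ideq \<Gamma> (leg A B f b) (fst_tm (leg A B f b) w) (fst_tm (leg A B f b) w')"
    using funext[OF d(1) l(2) cocone_fst_ty(1)[OF D b w, unfolded leg_def[of A B f b]]
        cocone_fst_ty(1)[OF D b w', unfolded leg_def[of A B f b]]] e
    unfolding leg_def by blast
  from sigma_eq[OF l(1) lc w[unfolded cocone_def] w'[unfolded cocone_def] this]
  show ?thesis by (simp add: cocone_def)
qed

text \<open>
  At the vertex \<open>f a\<close>, a cocone whose leg at \<open>a\<close> is trivial is determined by \<open>c\<close>: its leg at \<open>x\<close>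
  is \<open>c x a\<close>.
\<close>

definition radial :: "tm \<Rightarrow> tm \<Rightarrow> tm \<Rightarrow> tm \<Rightarrow> tm \<Rightarrow> tm \<Rightarrow> tm" where
  "radial A B f c a w = TPi A (TId (TId (B \<Up> 1) (f \<Up> 1 $ Var 0) (f \<Up> 1 $ a \<Up> 1))
     (fst_tm (leg A B f (f $ a)) w \<Up> 1 $ Var 0) (c \<Up> 1 $ Var 0 $ a \<Up> 1))"

lemma sub_radial [simp]:
  "sub \<sigma> (radial A B f c a w) = radial (sub \<sigma> A) (sub \<sigma> B) (sub \<sigma> f) (sub \<sigma> c) (sub \<sigma> a) (sub \<sigma> w)"
  by (simp add: radial_def)

lemma radialD:
  assumes "inh \<Gamma> (radial A B f c a w)" "\<Gamma> \<turnstile> x \<^bold>: A"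
  shows "ideq \<Gamma> (TId B (f $ x) (f $ a)) (fst_tm (leg A B f (f $ a)) w $ x) (c $ x $ a)"
  using inh_app[OF assms(1)[unfolded radial_def] assms(2) refl] by simp

text \<open>The legs of both cocones at \<open>x\<close> are equal to \<open>c x a\<close>.\<close>

lemma radial_eq:
  assumes D: "coherent_map \<Gamma> k A B f c" and a: "\<Gamma> \<turnstile> a \<^bold>: A"
    and w: "\<Gamma> \<turnstile> w \<^bold>: cocone A B f c (f $ a)" and w': "\<Gamma> \<turnstile> w' \<^bold>: cocone A B f c (f $ a)"
    and r: "inh \<Gamma> (radial A B f c a w)" and r': "inh \<Gamma> (radial A B f c a w')"
  shows "ideq \<Gamma> (cocone A B f c (f $ a)) w w'"
proof -
  note d = coherent_mapD[OF D]
  have b: "\<Gamma> \<turnstile> f $ a \<^bold>: B" by (rule arr_app_ty d a)+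
  have wf: "wf_ctx (A # \<Gamma>)" using d(1) by (rule ctx_extend)
  note D1 = coherent_map_weak(1)[OF D wf]
  note d1 = coherent_mapD[OF D1]
  have v: "A # \<Gamma> \<turnstile> Var 0 \<^bold>: A \<Up> 1" by (rule var_ty wf refl)+
  have a1: "A # \<Gamma> \<turnstile> a \<Up> 1 \<^bold>: A \<Up> 1" by (rule weak_ty a wf refl)+
  have b1: "A # \<Gamma> \<turnstile> f \<Up> 1 $ a \<Up> 1 \<^bold>: B \<Up> 1" by (rule arr_app_ty d1 a1)+
  have w1: "A # \<Gamma> \<turnstile> w \<Up> 1 \<^bold>: cocone (A \<Up> 1) (B \<Up> 1) (f \<Up> 1) (c \<Up> 1) (f \<Up> 1 $ a \<Up> 1)"
    "A # \<Gamma> \<turnstile> w' \<Up> 1 \<^bold>: cocone (A \<Up> 1) (B \<Up> 1) (f \<Up> 1) (c \<Up> 1) (f \<Up> 1 $ a \<Up> 1)"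
    by (rule weak_ty(1)[OF w wf] weak_ty(1)[OF w' wf], simp)+
  have r1: "inh (A # \<Gamma>) (radial (A \<Up> 1) (B \<Up> 1) (f \<Up> 1) (c \<Up> 1) (a \<Up> 1) (w \<Up> 1))"
    "inh (A # \<Gamma>) (radial (A \<Up> 1) (B \<Up> 1) (f \<Up> 1) (c \<Up> 1) (a \<Up> 1) (w' \<Up> 1))"
    using inh_weak[OF r subst_ok_sh(1)[OF wf]] inh_weak[OF r' subst_ok_sh(1)[OF wf]] by simp_all
  note f1 = cocone_fst_ty(1)[OF D1 b1 w1(1)] cocone_fst_ty(1)[OF D1 b1 w1(2)]
  have T: "A # \<Gamma> \<turnstile> TId (B \<Up> 1) (f \<Up> 1 $ Var 0) (f \<Up> 1 $ a \<Up> 1) \<^bold>: TUniv k"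
    by (rule app_rules d1 v b1)+
  note ty = leg_app_ty[OF f1(1) v] leg_app_ty[OF f1(2) v] const_app_ty[OF d1(5) v a1]
  have "ideq (A # \<Gamma>) (TId (B \<Up> 1) (f \<Up> 1 $ Var 0) (f \<Up> 1 $ a \<Up> 1))
      (fst_tm (leg (A \<Up> 1) (B \<Up> 1) (f \<Up> 1) (f \<Up> 1 $ a \<Up> 1)) (w \<Up> 1) $ Var 0)
      (fst_tm (leg (A \<Up> 1) (B \<Up> 1) (f \<Up> 1) (f \<Up> 1 $ a \<Up> 1)) (w' \<Up> 1) $ Var 0)"
    by (rule id_trans[OF T ty(1,3,2) radialD[OF r1(1) v] id_sym[OF T ty(2,3) radialD[OF r1(2) v]]])
  then show ?thesis by (intro cocone_eq[OF D b w w']) simp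
qed

text \<open>The cocone condition at \<open>x\<close> and \<open>a\<close> reads
  \<open>c x a \<cdot> p a = p x\<close> for the legs \<open>p\<close>. If \<open>p a\<close> is
  trivial, the right unit law leaves \<open>c x a = p x\<close>.\<close>

lemma radialI:
  assumes D: "coherent_map \<Gamma> k A B f c" and a: "\<Gamma> \<turnstile> a \<^bold>: A"
    and w: "\<Gamma> \<turnstile> w \<^bold>: cocone A B f c (f $ a)"
    and e: "ideq \<Gamma> (TId B (f $ a) (f $ a)) (fst_tm (leg A B f (f $ a)) w $ a) (TRefl (f $ a))"
  shows "inh \<Gamma> (radial A B f c a w)"
proof -
  have *: "ideq \<Gamma> (TId B (f $ x) (f $ a)) (fst_tm (leg A B f (f $ a)) w $ x) (c $ x $ a)"
    if D: "coherent_map \<Gamma> k A B f c" and a: "\<Gamma> \<turnstile> a \<^bold>: A" and x: "\<Gamma> \<turnstile> x \<^bold>: A"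
    and w: "\<Gamma> \<turnstile> w \<^bold>: cocone A B f c (f $ a)"
    and e: "ideq \<Gamma> (TId B (f $ a) (f $ a)) (fst_tm (leg A B f (f $ a)) w $ a) (TRefl (f $ a))"
    for \<Gamma> A B f c a x w
  proof -
    note d = coherent_mapD[OF D]
    have b: "\<Gamma> \<turnstile> f $ a \<^bold>: B" and fx: "\<Gamma> \<turnstile> f $ x \<^bold>: B" by (rule arr_app_ty d a x)+
    note f = cocone_fst_ty[OF D b w]
    note ty = leg_app_ty[OF f(1) x] leg_app_ty[OF f(1) a] const_app_ty[OF d(5) x a] ty_refl[OF b]
    have T: "\<Gamma> \<turnstile> TId B (f $ x) (f $ a) \<^bold>: TUniv k" "\<Gamma> \<turnstile> TId B (f $ a) (f $ a) \<^bold>: TUniv k"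
      by (rule ty_id d b fx)+
    have C: "\<Gamma> \<turnstile> concat_path B (f $ x) (f $ a) (f $ a) (c $ x $ a)
        (fst_tm (leg A B f (f $ a)) w $ a) \<^bold>: TId B (f $ x) (f $ a)"
       "\<Gamma> \<turnstile> concat_path B (f $ x) (f $ a) (f $ a) (c $ x $ a) (TRefl (f $ a)) \<^bold>: TId B (f $ x)
           (f $ a)"
      by (rule concat_ty d b fx ty)+
    have "ideq \<Gamma> (TId B (f $ x) (f $ a)) (c $ x $ a) (c $ x $ a)"
      using inhI[OF ty_refl[OF ty(3)]] .
    from concat_id[OF d(2) fx b b ty(3,2,3,4) this e]
    have "ideq \<Gamma> (TId B (f $ x) (f $ a))
        (concat_path B (f $ x) (f $ a) (f $ a) (c $ x $ a) (fst_tm (leg A B f (f $ a)) w $ a))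
        (c $ x $ a)"
      by (rule id_trans[OF T(1) C(1,2) ty(3) _ concat_refl_right[OF d(2) fx b ty(3)]])
    from id_trans[OF T(1) ty(1) C(1) ty(3) id_sym[OF T(1) C(1) ty(1) leg_coh_app[OF f(2) x a]] this]
    show ?thesis .
  qed
  have wf: "wf_ctx (A # \<Gamma>)" using coherent_mapD(1)[OF D] by (rule ctx_extend)
  have "ideq (A # \<Gamma>) (TId (B \<Up> 1) (f \<Up> 1 $ Var 0) (f \<Up> 1 $ a \<Up> 1))
      (fst_tm (leg (A \<Up> 1) (B \<Up> 1) (f \<Up> 1) (f \<Up> 1 $ a \<Up> 1)) (w \<Up> 1) $ Var 0)
      (c \<Up> 1 $ Var 0 $ a \<Up> 1)"
  proof (rule *[OF coherent_map_weak(1)[OF D wf]])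
    show "A # \<Gamma> \<turnstile> w \<Up> 1 \<^bold>: cocone (A \<Up> 1) (B \<Up> 1) (f \<Up> 1) (c \<Up> 1) (f \<Up> 1 $ a \<Up> 1)"
      by (rule weak_ty(1)[OF w wf]) simp
    show "ideq (A # \<Gamma>) (TId (B \<Up> 1) (f \<Up> 1 $ a \<Up> 1) (f \<Up> 1 $ a \<Up> 1))
        (fst_tm (leg (A \<Up> 1) (B \<Up> 1) (f \<Up> 1) (f \<Up> 1 $ a \<Up> 1)) (w \<Up> 1) $ a \<Up> 1)
        (TRefl (f \<Up> 1 $ a \<Up> 1))"
      using inh_weak[OF e subst_ok_sh(1)[OF wf]] by simp
  qed (rule var_ty weak_ty(1)[OF a] wf refl)+
  then show ?thesis unfolding radial_def by (intro inh_lam) simp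
qed

section \<open>The centre of contraction\<close>

definition center_leg :: "tm \<Rightarrow> tm \<Rightarrow> tm \<Rightarrow> tm" where
  "center_leg A c a = TLam A (c \<Up> 1 $ Var 0 $ a \<Up> 1)"

lemma sub_center_leg [simp]: "sub \<sigma> (center_leg A c a) = center_leg (sub \<sigma> A) (sub \<sigma> c) (sub \<sigma> a)"
  by (simp add: center_leg_def)

lemma center_leg_ty:
  assumes D: "coherent_map \<Gamma> k A B f c" and a: "\<Gamma> \<turnstile> a \<^bold>: A"
  shows "\<Gamma> \<turnstile> center_leg A c a \<^bold>: leg A B f (f $ a)"
    and "\<Gamma> \<turnstile> x \<^bold>: A \<Longrightarrow> \<Gamma> \<turnstile> center_leg A c a $ x \<^bold>\<equiv> c $ x $ a \<^bold>: TId B (f $ x) (f $ a)"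
proof -
  have wf: "wf_ctx (A # \<Gamma>)" using coherent_mapD(1)[OF D] by (rule ctx_extend)
  have *: "A # \<Gamma> \<turnstile> c \<Up> 1 $ Var 0 $ a \<Up> 1 \<^bold>: TId (B \<Up> 1) (f \<Up> 1 $ Var 0) (f \<Up> 1 $ a \<Up> 1)"
    by (rule const_app_ty coherent_mapD[OF coherent_map_weak(1)[OF D wf]] var_ty weak_ty(1)[OF a] wf
        refl)+
  show "\<Gamma> \<turnstile> center_leg A c a \<^bold>: leg A B f (f $ a)"
    using ty_lam[OF *] by (simp add: center_leg_def leg_def)
  show "\<Gamma> \<turnstile> center_leg A c a $ x \<^bold>\<equiv> c $ x $ a \<^bold>: TId B (f $ x) (f $ a)" if "\<Gamma> \<turnstile> x \<^bold>: A"
    unfolding center_leg_def by (rule beta_pi_eq[OF * that]) simp_all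
qed

text \<open>After \<beta>, the condition at \<open>x\<close> and \<open>y\<close> is the coherence
  of \<open>c\<close> at \<open>x\<close>, \<open>y\<close> and \<open>a\<close>.\<close>

lemma center_leg_coh:
  assumes D: "coherent_map \<Gamma> k A B f c" and a: "\<Gamma> \<turnstile> a \<^bold>: A"
  shows "inh \<Gamma> (leg_coh A B f c (f $ a) (center_leg A c a))"
proof -
  have *: "ideq \<Gamma> (TId B (f $ x) (f $ a))
      (concat_path B (f $ x) (f $ y) (f $ a) (c $ x $ y) (center_leg A c a $ y))
      (center_leg A c a $ x)"
    if D: "coherent_map \<Gamma> k A B f c" and a: "\<Gamma> \<turnstile> a \<^bold>: A" and x: "\<Gamma> \<turnstile> x \<^bold>: A" and y: "\<Gamma> \<turnstile> y \<^bold>: A"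
        for \<Gamma> A B f c a x y
  proof -
    note d = coherent_mapD[OF D]
    note p = center_leg_ty[OF D a]
    have fa: "\<Gamma> \<turnstile> f $ a \<^bold>: B" by (rule arr_app_ty d a)+
    show ?thesis
      by (rule id_conv[OF coh_app[OF d(6) x y a]], rule ty_id, rule d, rule arr_app_ty, rule d, rule
          x, rule fa,
          rule concat_cong[OF d(2) fa])
         (rule eq_refl const_app_ty arr_app_ty d x y fa eq_sym[OF p(2)[OF y]]
             eq_sym[OF p(2)[OF x]])+
  qed
  note d = coherent_mapD[OF D]
  have w1: "wf_ctx (A # \<Gamma>)" using d(1) by (rule ctx_extend)
  have w2: "wf_ctx (A \<Up> 1 # A # \<Gamma>)" by (rule ctx_extend weak_univ d w1)+
  have "ideq (A \<Up> 1 # A # \<Gamma>) (TId (B \<Up> 2) (f \<Up> 2 $ Var 1) (f \<Up> 2 $ a \<Up> 2))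
      (concat_path (B \<Up> 2) (f \<Up> 2 $ Var 1) (f \<Up> 2 $ Var 0) (f \<Up> 2 $ a \<Up> 2)
      (c \<Up> 2 $ Var 1 $ Var 0) (center_leg (A \<Up> 2) (c \<Up> 2) (a \<Up> 2) $ Var 0))
          (center_leg (A \<Up> 2) (c \<Up> 2) (a \<Up> 2) $ Var 1)"
    by (rule *[OF coherent_map_weak(2)[OF D w2]]) (rule weak_ty(2)[OF a w2] var_ty w2 | simp)+
  then show ?thesis
    unfolding leg_coh_def by (intro inh_lam) simp
qed

text \<open>Projecting the legs out of the pair and applying them computes judgementally to
  \<open>c x a\<close>, so reflexivity witnesses \<open>radial\<close>.\<close>

lemma radial_center:
  assumes D: "coherent_map \<Gamma> k A B f c" and a: "\<Gamma> \<turnstile> a \<^bold>: A"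
  obtains w where "\<Gamma> \<turnstile> w \<^bold>: cocone A B f c (f $ a)" "inh \<Gamma> (radial A B f c a w)"
proof -
  have *: "ideq \<Gamma> (TId B (f $ x) (f $ a))
      (fst_tm (leg A B f (f $ a)) (TPair (center_leg A c a) q) $ x) (c $ x $ a)"
      and **: "\<Gamma> \<turnstile> TPair (center_leg A c a) q \<^bold>: cocone A B f c (f $ a)"
    if D: "coherent_map \<Gamma> k A B f c" and a: "\<Gamma> \<turnstile> a \<^bold>: A" and x: "\<Gamma> \<turnstile> x \<^bold>: A"
      and q: "\<Gamma> \<turnstile> q \<^bold>: leg_coh A B f c (f $ a) (center_leg A c a)" for \<Gamma> A B f c a x q
  proof -
    note d = coherent_mapD[OF D]
    note p = center_leg_ty[OF D a]
    have fa: "\<Gamma> \<turnstile> f $ a \<^bold>: B" and fx: "\<Gamma> \<turnstile> f $ x \<^bold>: B" by (rule arr_app_ty d a x)+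
    note l = leg_ty[OF d(1,2,4) fa] and lc = leg_coh_var_ty(1)[OF D fa]
    have q': "\<Gamma> \<turnstile> q \<^bold>: inst (leg_coh (A \<Up> 1) (B \<Up> 1) (f \<Up> 1) (c \<Up> 1) ((f $ a) \<Up> 1) (Var 0))
        (center_leg A c a)"
      using q by simp
    show w: "\<Gamma> \<turnstile> TPair (center_leg A c a) q \<^bold>: cocone A B f c (f $ a)"
      unfolding cocone_def by (rule ty_pair lc p q')+
    have "\<Gamma> \<turnstile> fst_tm (leg A B f (f $ a)) (TPair (center_leg A c a) q) $ x \<^bold>\<equiv> center_leg A c a $ x \<^bold>:
        TId B (f $ x) (f $ a)"
      using cong_app[OF fst_pair[OF l(1) lc p(1) q', unfolded leg_def[of A B f "f $ a"]]
          eq_refl[OF x]]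
      by (simp add: leg_def)
    from eq_trans[OF this p(2)[OF x]]
    show "ideq \<Gamma> (TId B (f $ x) (f $ a))
        (fst_tm (leg A B f (f $ a)) (TPair (center_leg A c a) q) $ x) (c $ x $ a)"
      by (intro id_jeq) (rule ty_id d fa fx leg_app_ty[OF cocone_fst_ty(1)[OF D fa w] x])+
  qed
  note d = coherent_mapD[OF D]
  obtain q where q: "\<Gamma> \<turnstile> q \<^bold>: leg_coh A B f c (f $ a) (center_leg A c a)"
    using center_leg_coh[OF D a] by (rule inhE)
  have wf: "wf_ctx (A # \<Gamma>)" using d(1) by (rule ctx_extend)
  have q1: "A # \<Gamma> \<turnstile> q \<Up> 1 \<^bold>: leg_coh (A \<Up> 1) (B \<Up> 1) (f \<Up> 1) (c \<Up> 1) (f \<Up> 1 $ a \<Up> 1)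
      (center_leg (A \<Up> 1) (c \<Up> 1) (a \<Up> 1))"
    by (rule weak_ty(1)[OF q wf]) simp
  show ?thesis
  proof (rule that)
    show "\<Gamma> \<turnstile> TPair (center_leg A c a) q \<^bold>: cocone A B f c (f $ a)"
      by (rule **[OF D a a q])
    show "inh \<Gamma> (radial A B f c a (TPair (center_leg A c a) q))"
      using *[OF coherent_map_weak(1)[OF D wf] weak_ty(1)[OF a wf refl] var_ty(1)[OF wf refl] q1]
      unfolding radial_def by (intro inh_lam) simp
  qed
qed

section \<open>The apex type is a proposition\<close>

lemma cocone_var_ty:
  assumes D: "coherent_map \<Gamma> k A B f c"
  shows "B # \<Gamma> \<turnstile> cocone (A \<Up> 1) (B \<Up> 1) (f \<Up> 1) (c \<Up> 1) (Var 0) \<^bold>: TUniv k"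
proof -
  have wf: "wf_ctx (B # \<Gamma>)" using coherent_mapD(2)[OF D] by (rule ctx_extend)
  show ?thesis by (rule cocone_ty[OF coherent_map_weak(1)[OF D wf]] var_ty wf refl)+
qed

lemma apex_ty: "coherent_map \<Gamma> k A B f c \<Longrightarrow> \<Gamma> \<turnstile> apex A B f c \<^bold>: TUniv k"
  unfolding apex_def by (intro ty_sigma cocone_var_ty coherent_mapD(2))

lemma apex_pair_ty:
  assumes D: "coherent_map \<Gamma> k A B f c" and b: "\<Gamma> \<turnstile> b \<^bold>: B" and w: "\<Gamma> \<turnstile> w \<^bold>: cocone A B f c b"
  shows "\<Gamma> \<turnstile> TPair b w \<^bold>: apex A B f c"
  unfolding apex_def by (rule ty_pair[OF cocone_var_ty[OF D] b]) (use w in simp)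

lemma apex_pair_eq:
  assumes D: "coherent_map \<Gamma> k A B f c" and b: "\<Gamma> \<turnstile> b \<^bold>: B"
    and w: "\<Gamma> \<turnstile> w \<^bold>: cocone A B f c b" and w': "\<Gamma> \<turnstile> w' \<^bold>: cocone A B f c b"
    and e: "ideq \<Gamma> (cocone A B f c b) w w'"
  shows "ideq \<Gamma> (apex A B f c) (TPair b w) (TPair b w')"
proof -
  have T: "\<Gamma> \<turnstile> cocone A B f c b \<^bold>: TUniv k" by (rule cocone_ty[OF D b])
  have wf: "wf_ctx (cocone A B f c b # \<Gamma>)" using T by (rule ctx_extend)
  have "cocone A B f c b # \<Gamma> \<turnstile> TPair (b \<Up> 1) (Var 0) \<^bold>: apex A B f c \<Up> 1"
    by simp (rule apex_pair_ty[OF coherent_map_weak(1)[OF D wf] weak_ty(1)[OF b wf refl]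
        var_ty(1)[OF wf]], simp)
  from ap_id[OF T apex_ty[OF D] this w w' e] show ?thesis by simp
qed

text \<open>
  Path induction on the leg at \<open>a\<close> of the second cocone, with that leg generalised to a
  variable.
\<close>

lemma apex_contr_pair:
  assumes D: "coherent_map \<Gamma> k A B f c" and a: "\<Gamma> \<turnstile> a \<^bold>: A"
    and w0: "\<Gamma> \<turnstile> w0 \<^bold>: cocone A B f c (f $ a)" and r: "inh \<Gamma> (radial A B f c a w0)"
    and b: "\<Gamma> \<turnstile> b \<^bold>: B" and w: "\<Gamma> \<turnstile> w \<^bold>: cocone A B f c b"
  shows "ideq \<Gamma> (apex A B f c) (TPair (f $ a) w0) (TPair b w)"
proof -
  note d = coherent_mapD[OF D]
  have fa: "\<Gamma> \<turnstile> f $ a \<^bold>: B" by (rule arr_app_ty d a)+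
  let ?G = "TId (B \<Up> 1) ((f $ a) \<Up> 1) (Var 0) # B # \<Gamma>"
  let ?W = "cocone (A \<Up> 2) (B \<Up> 2) (f \<Up> 2) (c \<Up> 2) (Var 1)"
  \<comment> \<open>\<open>?H\<close> ties the path variable to the leg at \<open>a\<close> of the
    varying cocone. The induction carries this link along, so that at reflexivity the leg is known
    to be trivial.\<close>
  let ?H = "TId (TId (B \<Up> 3) (f \<Up> 3 $ a \<Up> 3) (Var 2))
      (fst_tm (leg (A \<Up> 3) (B \<Up> 3) (f \<Up> 3) (Var 2)) (Var 0) $ a \<Up> 3) (Var 1)"
  let ?E = "TId (apex (A \<Up> 4) (B \<Up> 4) (f \<Up> 4) (c \<Up> 4)) (TPair (f \<Up> 4 $ a \<Up> 4) (w0 \<Up> 4))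
      (TPair (Var 3) (Var 1))"
  let ?C = "TPi ?W (TPi ?H ?E)"
  have wf1: "wf_ctx (B # \<Gamma>)" using d(2) by (rule ctx_extend)
  have wf2: "wf_ctx ?G" by (rule ctx_extend ty_id weak_univ d wf1 weak_ty(1)[OF fa] var_ty refl)+
  note D2 = coherent_map_weak(2)[OF D wf2]
  have W: "?G \<turnstile> ?W \<^bold>: TUniv k" by (rule cocone_ty[OF D2] var_ty wf2 refl)+
  have wf3: "wf_ctx (?W # ?G)" using W by (rule ctx_extend)
  note D3 = coherent_map_weak(3)[OF D wf3]
  have v3: "?W # ?G \<turnstile> Var 2 \<^bold>: B \<Up> 3" "?W # ?G \<turnstile> Var 1 \<^bold>: TId (B \<Up> 3) (f \<Up> 3 $ a \<Up> 3) (Var 2)"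
    "?W # ?G \<turnstile> Var 0 \<^bold>: cocone (A \<Up> 3) (B \<Up> 3) (f \<Up> 3) (c \<Up> 3) (Var 2)"
    "?W # ?G \<turnstile> a \<Up> 3 \<^bold>: A \<Up> 3"
    by (rule var_ty wf3 weak_ty(3)[OF a] | simp)+
  have H: "?W # ?G \<turnstile> ?H \<^bold>: TUniv k"
    by (rule app_rules cocone_fst_ty(1)[OF D3 v3(1,3)] coherent_mapD[OF D3] v3)+
  have wf4: "wf_ctx (?H # ?W # ?G)" using H by (rule ctx_extend)
  note D4 = coherent_map_weak(4)[OF D wf4]
  note d4 = coherent_mapD[OF D4]
  have v4: "?H # ?W # ?G \<turnstile> a \<Up> 4 \<^bold>: A \<Up> 4" by (rule weak_ty(4)[OF a wf4]) simp
  have v4': "?H # ?W # ?G \<turnstile> w0 \<Up> 4 \<^bold>: cocone (A \<Up> 4) (B \<Up> 4) (f \<Up> 4) (c \<Up> 4) (f \<Up> 4 $ a \<Up> 4)"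
    by (rule weak_ty(4)[OF w0 wf4]) simp
  have v4'': "?H # ?W # ?G \<turnstile> Var 3 \<^bold>: B \<Up> 4"
      "?H # ?W # ?G \<turnstile> Var 1 \<^bold>: cocone (A \<Up> 4) (B \<Up> 4) (f \<Up> 4) (c \<Up> 4) (Var 3)"
    by (rule var_ty wf4 | simp)+
  have E: "?H # ?W # ?G \<turnstile> ?E \<^bold>: TUniv k"
    by (rule ty_id apex_ty[OF D4] apex_pair_ty[OF D4] arr_app_ty d4 v4 v4' v4'')+
  have C: "?G \<turnstile> ?C \<^bold>: TUniv k" by (rule ty_pi W H E)+
  let ?W' = "cocone A B f c (f $ a)"
  let ?H' = "TId (TId (B \<Up> 1) (f \<Up> 1 $ a \<Up> 1) (f \<Up> 1 $ a \<Up> 1))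
     (fst_tm (leg (A \<Up> 1) (B \<Up> 1) (f \<Up> 1) (f \<Up> 1 $ a \<Up> 1)) (Var 0) $ a \<Up> 1) (TRefl (f \<Up> 1 $ a \<Up> 1))"
  have x1: "wf_ctx (?W' # \<Gamma>)" by (rule ctx_extend cocone_ty D fa)+
  note F1 = coherent_map_weak(1)[OF D x1]
  note g1 = coherent_mapD[OF F1]
  have a1: "?W' # \<Gamma> \<turnstile> a \<Up> 1 \<^bold>: A \<Up> 1" by (rule weak_ty(1)[OF a x1 refl])
  have fa1: "?W' # \<Gamma> \<turnstile> f \<Up> 1 $ a \<Up> 1 \<^bold>: B \<Up> 1" by (rule arr_app_ty g1 a1)+
  have u1: "?W' # \<Gamma> \<turnstile> Var 0 \<^bold>: cocone (A \<Up> 1) (B \<Up> 1) (f \<Up> 1) (c \<Up> 1) (f \<Up> 1 $ a \<Up> 1)"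
    by (rule var_ty x1 | simp)+
  have H': "?W' # \<Gamma> \<turnstile> ?H' \<^bold>: TUniv k"
    by (rule app_rules ty_refl cocone_fst_ty(1)[OF F1 fa1 u1] g1 a1 fa1)+
  have x2: "wf_ctx (?H' # ?W' # \<Gamma>)" using H' by (rule ctx_extend)
  note F2 = coherent_map_weak(2)[OF D x2]
  note g2 = coherent_mapD[OF F2]
  have a2: "?H' # ?W' # \<Gamma> \<turnstile> a \<Up> 2 \<^bold>: A \<Up> 2" by (rule weak_ty(2)[OF a x2 refl])
  have fa2: "?H' # ?W' # \<Gamma> \<turnstile> f \<Up> 2 $ a \<Up> 2 \<^bold>: B \<Up> 2" by (rule arr_app_ty g2 a2)+
  have u2: "?H' # ?W' # \<Gamma> \<turnstile> Var 1 \<^bold>: cocone (A \<Up> 2) (B \<Up> 2) (f \<Up> 2) (c \<Up> 2) (f \<Up> 2 $ a \<Up> 2)"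
    "?H' # ?W' # \<Gamma> \<turnstile> w0 \<Up> 2 \<^bold>: cocone (A \<Up> 2) (B \<Up> 2) (f \<Up> 2) (c \<Up> 2) (f \<Up> 2 $ a \<Up> 2)"
    by (rule var_ty weak_ty(2)[OF w0] x2 | simp)+
  have h2: "ideq (?H' # ?W' # \<Gamma>) (TId (B \<Up> 2) (f \<Up> 2 $ a \<Up> 2) (f \<Up> 2 $ a \<Up> 2))
      (fst_tm (leg (A \<Up> 2) (B \<Up> 2) (f \<Up> 2) (f \<Up> 2 $ a \<Up> 2)) (Var 1) $ a \<Up> 2)
      (TRefl (f \<Up> 2 $ a \<Up> 2))"
    by (rule inhI, rule var_ty(1)[OF x2]) simp
  have r2: "inh (?H' # ?W' # \<Gamma>) (radial (A \<Up> 2) (B \<Up> 2) (f \<Up> 2) (c \<Up> 2) (a \<Up> 2) (w0 \<Up> 2))"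
    using inh_weak[OF r subst_ok_sh(2)[OF x2]] by simp
  \<comment> \<open>In the base case both cocones sit at \<open>f a\<close>, and both are radial:
    \<open>w0\<close> by assumption, the other one by \<open>radialI\<close>.\<close>
  have "ideq (?H' # ?W' # \<Gamma>) (apex (A \<Up> 2) (B \<Up> 2) (f \<Up> 2) (c \<Up> 2)) (TPair (f \<Up> 2 $ a \<Up> 2) (w0 \<Up> 2))
      (TPair (f \<Up> 2 $ a \<Up> 2) (Var 1))"
    by (rule apex_pair_eq[OF F2 fa2 u2(2,1)
        radial_eq[OF F2 a2 u2(2,1) r2 radialI[OF F2 a2 u2(1) h2]]])
  then have base: "inh \<Gamma> (sub (TRefl (f $ a) \<bullet> f $ a \<bullet> Var) ?C)"
    by simp (intro inh_lam)
  let ?e = "fst_tm (leg A B f b) w $ a"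
  have e: "\<Gamma> \<turnstile> ?e \<^bold>: TId B (f $ a) b"
    by (rule leg_app_ty cocone_fst_ty D b w a)+
  from based_J[OF d(2) fa C base b e]
  have "inh \<Gamma> (sub (?e \<bullet> b \<bullet> Var) ?C)" .
  from inh_app[OF this[simplified] w refl] have "inh \<Gamma> (sub (w \<bullet> ?e \<bullet> b \<bullet> Var) (TPi ?H ?E))"
    by simp
  \<comment> \<open>The path used is the leg itself, so reflexivity proves the linking
    equation.\<close>
  from inh_app[OF this[simplified] ty_refl[OF e] refl] show ?thesis by simp
qed

lemma apex_contr:
  assumes D: "coherent_map \<Gamma> k A B f c" and a: "\<Gamma> \<turnstile> a \<^bold>: A"
    and w0: "\<Gamma> \<turnstile> w0 \<^bold>: cocone A B f c (f $ a)" and r: "inh \<Gamma> (radial A B f c a w0)"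
    and t: "\<Gamma> \<turnstile> t \<^bold>: apex A B f c"
  shows "ideq \<Gamma> (apex A B f c) (TPair (f $ a) w0) t"
proof -
  note d = coherent_mapD[OF D]
  have fa: "\<Gamma> \<turnstile> f $ a \<^bold>: B" by (rule arr_app_ty d a)+
  let ?W = "cocone (A \<Up> 1) (B \<Up> 1) (f \<Up> 1) (c \<Up> 1) (Var 0)"
  have t': "\<Gamma> \<turnstile> t \<^bold>: TSigma B ?W" using t by (simp add: apex_def)
  note f = fst_ty[OF d(2) cocone_var_ty[OF D] t']
  have s: "\<Gamma> \<turnstile> snd_tm B ?W t \<^bold>: cocone A B f c (fst_tm B t)"
    using snd_ty[OF d(2) cocone_var_ty[OF D] t'] by simp
  show ?thesis
    by (rule id_trans[OF apex_ty[OF D] apex_pair_ty[OF D fa w0] apex_pair_ty[OF D f s] t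
        apex_contr_pair[OF D a w0 r f s]
          pair_eta[OF d(2) cocone_var_ty[OF D] t', folded apex_def]])
qed

lemma apex_inh_and_prop:
  assumes D: "coherent_map \<Gamma> k A B f c" and a: "\<Gamma> \<turnstile> a \<^bold>: A"
  shows "inh \<Gamma> (apex A B f c)" and "inh \<Gamma> (is_prop (apex A B f c))"
proof -
  note d = coherent_mapD[OF D]
  have fa: "\<Gamma> \<turnstile> f $ a \<^bold>: B" by (rule arr_app_ty d a)+
  obtain w where w: "\<Gamma> \<turnstile> w \<^bold>: cocone A B f c (f $ a)" "inh \<Gamma> (radial A B f c a w)"
    using radial_center[OF D a] .
  show "inh \<Gamma> (apex A B f c)" using apex_pair_ty[OF D fa w(1)] by (rule inhI)
  let ?S = "apex A B f c"
  have x1: "wf_ctx (?S # \<Gamma>)" using apex_ty[OF D] by (rule ctx_extend)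
  have x2: "wf_ctx (?S \<Up> 1 # ?S # \<Gamma>)" by (rule ctx_extend weak_univ x1 apex_ty D)+
  note D2 = coherent_map_weak(2)[OF D x2]
  have a2: "?S \<Up> 1 # ?S # \<Gamma> \<turnstile> a \<Up> 2 \<^bold>: A \<Up> 2" by (rule weak_ty(2)[OF a x2 refl])
  have fa2: "?S \<Up> 1 # ?S # \<Gamma> \<turnstile> f \<Up> 2 $ a \<Up> 2 \<^bold>: B \<Up> 2" by (rule arr_app_ty coherent_mapD[OF D2] a2)+
  have w2: "?S \<Up> 1 # ?S # \<Gamma> \<turnstile> w \<Up> 2 \<^bold>: cocone (A \<Up> 2) (B \<Up> 2) (f \<Up> 2) (c \<Up> 2) (f \<Up> 2 $ a \<Up> 2)"
    by (rule weak_ty(2)[OF w(1) x2]) simp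
  have r2: "inh (?S \<Up> 1 # ?S # \<Gamma>) (radial (A \<Up> 2) (B \<Up> 2) (f \<Up> 2) (c \<Up> 2) (a \<Up> 2) (w \<Up> 2))"
    using inh_weak[OF w(2) subst_ok_sh(2)[OF x2]] by simp
  have v: "?S \<Up> 1 # ?S # \<Gamma> \<turnstile> Var 1 \<^bold>: apex (A \<Up> 2) (B \<Up> 2) (f \<Up> 2) (c \<Up> 2)"
    "?S \<Up> 1 # ?S # \<Gamma> \<turnstile> Var 0 \<^bold>: apex (A \<Up> 2) (B \<Up> 2) (f \<Up> 2) (c \<Up> 2)"
    by (rule var_ty x2 | simp)+
  note c = apex_contr[OF D2 a2 w2 r2]
  note t0 = apex_pair_ty[OF D2 fa2 w2]
  have "ideq (?S \<Up> 1 # ?S # \<Gamma>) (apex (A \<Up> 2) (B \<Up> 2) (f \<Up> 2) (c \<Up> 2)) (Var 1) (Var 0)"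
    by (rule id_trans[OF apex_ty[OF D2] v(1) t0 v(2) id_sym[OF apex_ty[OF D2] t0 v(1) c[OF v(1)]]
        c[OF v(2)]])
  then show "inh \<Gamma> (is_prop ?S)" by (intro is_propI) simp
qed

lemma apex_trunc:
  assumes D: "coherent_map \<Gamma> k A B f c" and x: "\<Gamma> \<turnstile> x \<^bold>: TTrunc A"
  shows "inh \<Gamma> (apex A B f c)" and "inh \<Gamma> (is_prop (apex A B f c))"
proof -
  note d = coherent_mapD[OF D]
  have wf: "wf_ctx (A # \<Gamma>)" using d(1) by (rule ctx_extend)
  note a = apex_inh_and_prop[OF coherent_map_weak(1)[OF D wf] var_ty(1)[OF wf refl]]
  note S = apex_ty[OF D]
  show p: "inh \<Gamma> (is_prop (apex A B f c))"
    by (rule trunc_elim[OF d(1) is_prop_ty[OF S] is_prop_is_prop[OF S] _ x]) (use a in simp)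
  \<comment> \<open>Elimination into the apex type becomes available only through
    \<open>p\<close>.\<close>
  show "inh \<Gamma> (apex A B f c)"
    by (rule trunc_elim[OF d(1) S p _ x]) (use a in simp)
qed

section \<open>Extensions to the truncation\<close>

text \<open>
  An extension \<open>h\<close> of a coherent map carries a cocone at \<open>h x\<close> for every \<open>x\<close> of the truncation,
  not just a homotopy on the elements of \<open>A\<close>; this is what makes it unique.
\<close>

definition extends :: "tm \<Rightarrow> tm \<Rightarrow> tm \<Rightarrow> tm \<Rightarrow> tm \<Rightarrow> tm" where
  "extends A B f c h = TPi (TTrunc A) (cocone (A \<Up> 1) (B \<Up> 1) (f \<Up> 1) (c \<Up> 1) (h \<Up> 1 $ Var 0))"

lemma sub_extends [simp]:
  "sub \<sigma> (extends A B f c h) = extends (sub \<sigma> A) (sub \<sigma> B) (sub \<sigma> f) (sub \<sigma> c) (sub \<sigma> h)"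
  by (simp add: extends_def)

lemma extends_ty:
  assumes D: "coherent_map \<Gamma> k A B f c" and h: "\<Gamma> \<turnstile> h \<^bold>: arr (TTrunc A) B"
  shows "\<Gamma> \<turnstile> extends A B f c h \<^bold>: TUniv k"
proof -
  have T: "\<Gamma> \<turnstile> TTrunc A \<^bold>: TUniv k" by (rule ty_trunc coherent_mapD[OF D])+
  have wf: "wf_ctx (TTrunc A # \<Gamma>)" using T by (rule ctx_extend)
  have "TTrunc A # \<Gamma> \<turnstile> h \<Up> 1 $ Var 0 \<^bold>: B \<Up> 1"
    by (rule arr_app_ty[where A = "TTrunc (A \<Up> 1)"] weak_ty(1)[OF h wf] var_ty wf | simp)+
  then show ?thesis
    unfolding extends_def by (rule ty_pi[OF T cocone_ty[OF coherent_map_weak(1)[OF D wf]]])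
qed

lemma extends_app:
  "inh \<Gamma> (extends A B f c h) \<Longrightarrow> \<Gamma> \<turnstile> x \<^bold>: TTrunc A \<Longrightarrow> inh \<Gamma> (cocone A B f c (h $ x))"
  unfolding extends_def by (erule inh_app, assumption) simp

text \<open>An element of the apex type for each \<open>x\<close> splits by choice into a value at
  \<open>x\<close> and a cocone over that value.\<close>

lemma extension_exists:
  assumes D: "coherent_map \<Gamma> k A B f c"
  obtains h where "\<Gamma> \<turnstile> h \<^bold>: arr (TTrunc A) B" "inh \<Gamma> (extends A B f c h)"
proof -
  have T: "\<Gamma> \<turnstile> TTrunc A \<^bold>: TUniv k" by (rule ty_trunc coherent_mapD[OF D])+
  have wf: "wf_ctx (TTrunc A # \<Gamma>)" using T by (rule ctx_extend)
  note D1 = coherent_map_weak(1)[OF D wf]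
  have "TTrunc A # \<Gamma> \<turnstile> Var 0 \<^bold>: TTrunc (A \<Up> 1)" by (rule var_ty wf | simp)+
  from apex_trunc(1)[OF D1 this] obtain h where h: "\<Gamma> \<turnstile> h \<^bold>: TPi (TTrunc A) (B \<Up> 1)"
    "inh (TTrunc A # \<Gamma>) (inst (cocone (A \<Up> 1 \<Up> 1) (B \<Up> 1 \<Up> 1) (f \<Up> 1 \<Up> 1) (c \<Up> 1 \<Up> 1) (Var 0))
        (h \<Up> 1 $ Var 0))"
    unfolding apex_def using choice[OF T coherent_mapD(2)[OF D1] cocone_var_ty[OF D1]] by metis
  show ?thesis
  proof (rule that)
    show "\<Gamma> \<turnstile> h \<^bold>: arr (TTrunc A) B" using h(1) by (simp add: arr_def')
    show "inh \<Gamma> (extends A B f c h)" unfolding extends_def using h(2) by (intro inh_lam) simp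
  qed
qed

text \<open>A value together with its cocone is an element of the apex type. In the presence of a
  point \<open>x\<close> of the truncation this type is a proposition, and the first projection of
  the resulting path compares the two values.\<close>

lemma extension_unique:
  assumes D: "coherent_map \<Gamma> k A B f c"
    and h: "\<Gamma> \<turnstile> h \<^bold>: arr (TTrunc A) B" and h': "\<Gamma> \<turnstile> h' \<^bold>: arr (TTrunc A) B"
    and e: "inh \<Gamma> (extends A B f c h)" and e': "inh \<Gamma> (extends A B f c h')"
  shows "ideq \<Gamma> (arr (TTrunc A) B) h h'"
proof -
  have *: "ideq \<Gamma> B (h $ x) (h' $ x)"
    if D: "coherent_map \<Gamma> k A B f c" and x: "\<Gamma> \<turnstile> x \<^bold>: TTrunc A"
    and h: "\<Gamma> \<turnstile> h \<^bold>: arr (TTrunc A) B" and h': "\<Gamma> \<turnstile> h' \<^bold>: arr (TTrunc A) B"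
    and e: "inh \<Gamma> (extends A B f c h)" and e': "inh \<Gamma> (extends A B f c h')" for \<Gamma> A B f c x h h'
  proof -
    note d = coherent_mapD[OF D]
    note S = apex_ty[OF D]
    obtain w where w: "\<Gamma> \<turnstile> w \<^bold>: cocone A B f c (h $ x)" using extends_app[OF e x] by (rule inhE)
    obtain w' where w': "\<Gamma> \<turnstile> w' \<^bold>: cocone A B f c (h' $ x)" using extends_app[OF e' x]
        by (rule inhE)
    have b: "\<Gamma> \<turnstile> h $ x \<^bold>: B" "\<Gamma> \<turnstile> h' $ x \<^bold>: B" by (rule arr_app_ty h h' x)+
    note t = apex_pair_ty[OF D b(1) w] apex_pair_ty[OF D b(2) w']
    have wf: "wf_ctx (apex A B f c # \<Gamma>)" using S by (rule ctx_extend)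
    note D1 = coherent_map_weak(1)[OF D wf]
    have f: "apex A B f c # \<Gamma> \<turnstile> fst_tm (B \<Up> 1) (Var 0) \<^bold>: B \<Up> 1"
      by (rule fst_ty[OF coherent_mapD(2)[OF D1] cocone_var_ty[OF D1]], fold apex_def)
          (rule var_ty wf | simp)+
    have "ideq \<Gamma> B (fst_tm B (TPair (h $ x) w)) (fst_tm B (TPair (h' $ x) w'))"
      using ap_id[OF S d(2) f t is_propD[OF apex_trunc(2)[OF D x] t]] by simp
    then show ?thesis
      by (rule id_conv[OF _ d(2)]) (rule fst_pair[OF d(2) cocone_var_ty[OF D]],
          (use b w w' in simp)+)+
  qed
  note d = coherent_mapD[OF D]
  have T: "\<Gamma> \<turnstile> TTrunc A \<^bold>: TUniv k" by (rule ty_trunc coherent_mapD[OF D])+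
  have wf: "wf_ctx (TTrunc A # \<Gamma>)" using T by (rule ctx_extend)
  have v: "TTrunc A # \<Gamma> \<turnstile> Var 0 \<^bold>: TTrunc (A \<Up> 1)"
      "TTrunc A # \<Gamma> \<turnstile> h \<Up> 1 \<^bold>: arr (TTrunc (A \<Up> 1)) (B \<Up> 1)"
    "TTrunc A # \<Gamma> \<turnstile> h' \<Up> 1 \<^bold>: arr (TTrunc (A \<Up> 1)) (B \<Up> 1)"
    by (rule var_ty weak_ty(1)[OF h] weak_ty(1)[OF h'] wf | simp)+
  have "ideq (TTrunc A # \<Gamma>) (B \<Up> 1) (h \<Up> 1 $ Var 0) (h' \<Up> 1 $ Var 0)"
    by (rule *[OF coherent_map_weak(1)[OF D wf] v])
      (use inh_weak[OF e subst_ok_sh(1)[OF wf]] inh_weak[OF e' subst_ok_sh(1)[OF wf]] in simp_all)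
  then show ?thesis
    using funext[OF T weak_univ[OF d(2) wf]] h h' unfolding arr_def' by blast
qed

section \<open>Equality of coherent maps\<close>

definition groupoid_pair :: "tm list \<Rightarrow> nat \<Rightarrow> tm \<Rightarrow> tm \<Rightarrow> bool" where
  "groupoid_pair \<Gamma> k A B \<longleftrightarrow> \<Gamma> \<turnstile> A \<^bold>: TUniv k \<and> \<Gamma> \<turnstile> B \<^bold>: TUniv k \<and> inh \<Gamma> (is_groupoid B)"

lemma groupoid_pairD:
  assumes "groupoid_pair \<Gamma> k A B"
  shows "\<Gamma> \<turnstile> A \<^bold>: TUniv k" "\<Gamma> \<turnstile> B \<^bold>: TUniv k" "inh \<Gamma> (is_groupoid B)"
  using assms by (auto simp: groupoid_pair_def)

lemma groupoid_pair_sub: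
  assumes "groupoid_pair \<Gamma> k A B" "subst_ok \<Delta> \<sigma> \<Gamma>"
  shows "groupoid_pair \<Delta> k (sub \<sigma> A) (sub \<sigma> B)"
  using assms has_type_sub[of \<Gamma> _ _ \<Delta> \<sigma>] inh_weak[of \<Gamma> _ \<Delta> \<sigma>] unfolding groupoid_pair_def
  by (metis sub_defs(1) sub.simps(2))

lemmas groupoid_pair_weak = groupoid_pair_sub[OF _ subst_ok_sh(1)]
    groupoid_pair_sub[OF _ subst_ok_sh(2)]
  groupoid_pair_sub[OF _ subst_ok_sh(3)] groupoid_pair_sub[OF _ subst_ok_sh(4)]

lemma const_ty_ty:
  assumes A: "\<Gamma> \<turnstile> A \<^bold>: TUniv k" and B: "\<Gamma> \<turnstile> B \<^bold>: TUniv k" and f: "\<Gamma> \<turnstile> f \<^bold>: arr A B"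
  shows "\<Gamma> \<turnstile> const_ty A B f \<^bold>: TUniv k" "A # \<Gamma> \<turnstile> A \<Up> 1 \<^bold>: TUniv k"
    "A \<Up> 1 # A # \<Gamma> \<turnstile> TId (B \<Up> 2) (f \<Up> 2 $ Var 1) (f \<Up> 2 $ Var 0) \<^bold>: TUniv k"
proof -
  have w1: "wf_ctx (A # \<Gamma>)" using A by (rule ctx_extend)
  show A1: "A # \<Gamma> \<turnstile> A \<Up> 1 \<^bold>: TUniv k" by (rule weak_univ A w1)+
  have w2: "wf_ctx (A \<Up> 1 # A # \<Gamma>)" using A1 by (rule ctx_extend)
  have f2: "A \<Up> 1 # A # \<Gamma> \<turnstile> f \<Up> 2 \<^bold>: arr (A \<Up> 2) (B \<Up> 2)" by (rule weak_ty(2)[OF f w2]) simp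
  have B2: "A \<Up> 1 # A # \<Gamma> \<turnstile> B \<Up> 2 \<^bold>: TUniv k" by (rule weak_ty(2)[OF B w2]) simp
  show *: "A \<Up> 1 # A # \<Gamma> \<turnstile> TId (B \<Up> 2) (f \<Up> 2 $ Var 1) (f \<Up> 2 $ Var 0) \<^bold>: TUniv k"
    by (rule ty_id B2 arr_app_ty[OF f2] var_ty w2 | simp)+
  show "\<Gamma> \<turnstile> const_ty A B f \<^bold>: TUniv k"
    unfolding const_ty_def' by (rule ty_pi A A1 *)+
qed

lemma coh_ty_ty:
  assumes D: "groupoid_pair \<Gamma> k A B" and f: "\<Gamma> \<turnstile> f \<^bold>: arr A B" and c: "\<Gamma> \<turnstile> c \<^bold>: const_ty A B f"
  shows "\<Gamma> \<turnstile> coh_ty A B f c \<^bold>: TUniv k" "inh \<Gamma> (is_prop (coh_ty A B f c))"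
proof -
  note d = groupoid_pairD[OF D]
  have w1: "wf_ctx (A # \<Gamma>)" using d(1) by (rule ctx_extend)
  have A1: "A # \<Gamma> \<turnstile> A \<Up> 1 \<^bold>: TUniv k" by (rule weak_univ d w1)+
  have w2: "wf_ctx (A \<Up> 1 # A # \<Gamma>)" using A1 by (rule ctx_extend)
  have A2: "A \<Up> 1 # A # \<Gamma> \<turnstile> A \<Up> 2 \<^bold>: TUniv k" by (rule weak_ty(2)[OF d(1) w2]) simp
  have w3: "wf_ctx (A \<Up> 2 # A \<Up> 1 # A # \<Gamma>)" using A2 by (rule ctx_extend)
  let ?G = "A \<Up> 2 # A \<Up> 1 # A # \<Gamma>"
  note d3 = groupoid_pairD[OF groupoid_pair_weak(3)[OF D w3]]
  have v: "?G \<turnstile> f \<Up> 3 \<^bold>: arr (A \<Up> 3) (B \<Up> 3)" "?G \<turnstile> c \<Up> 3 \<^bold>: const_ty (A \<Up> 3) (B \<Up> 3) (f \<Up> 3)"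
    "?G \<turnstile> Var 2 \<^bold>: A \<Up> 3" "?G \<turnstile> Var 1 \<^bold>: A \<Up> 3" "?G \<turnstile> Var 0 \<^bold>: A \<Up> 3"
    by (rule weak_ty(3)[OF f] weak_ty(3)[OF c] var_ty w3 | simp)+
  let ?T = "TId (TId (B \<Up> 3) (f \<Up> 3 $ Var 2) (f \<Up> 3 $ Var 0))
     (concat_path (B \<Up> 3) (f \<Up> 3 $ Var 2) (f \<Up> 3 $ Var 1) (f \<Up> 3 $ Var 0)
       (c \<Up> 3 $ Var 2 $ Var 1) (c \<Up> 3 $ Var 1 $ Var 0))
     (c \<Up> 3 $ Var 2 $ Var 0)"
  have T: "?G \<turnstile> ?T \<^bold>: TUniv k"
    by (rule ty_id concat_ty const_app_ty arr_app_ty d3 v)+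
  have P: "inh ?G (is_prop ?T)"
    by (rule groupoidD[OF d3(3)]) (rule concat_ty const_app_ty arr_app_ty d3 v)+
  have e: "coh_ty A B f c = TPi A (TPi (A \<Up> 1) (TPi (A \<Up> 2) ?T))"
    by (simp add: coh_ty_def')
  show "\<Gamma> \<turnstile> coh_ty A B f c \<^bold>: TUniv k" unfolding e by (rule ty_pi d A1 A2 T)+
  show "inh \<Gamma> (is_prop (coh_ty A B f c))"
    unfolding e by (rule is_prop_pi[OF d(1)] is_prop_pi[OF A1] is_prop_pi[OF A2] ty_pi A1 A2 T P)+
qed

text \<open>The fibre of \<open>coherent_maps\<close> over an underlying map, named so that it can
  vary with that map in an induction on homotopies.\<close>

definition coherence :: "tm \<Rightarrow> tm \<Rightarrow> tm \<Rightarrow> tm" where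
  "coherence A B f = TSigma (const_ty A B f) (coh_ty (A \<Up> 1) (B \<Up> 1) (f \<Up> 1) (Var 0))"

lemma sub_coherence [simp]: "sub \<sigma> (coherence A B f) = coherence (sub \<sigma> A) (sub \<sigma> B) (sub \<sigma> f)"
  by (simp add: coherence_def)

lemma coherent_maps_eq_sigma: "coherent_maps A B = TSigma (arr A B)
    (coherence (A \<Up> 1) (B \<Up> 1) (Var 0))"
  by (simp add: coherence_def coherent_maps_def')

abbreviation const_of :: "tm \<Rightarrow> tm \<Rightarrow> tm \<Rightarrow> tm \<Rightarrow> tm" where
  "const_of A B f w \<equiv> fst_tm (const_ty A B f) w"

lemma coh_var_ty:
  assumes D: "groupoid_pair \<Gamma> k A B" and f: "\<Gamma> \<turnstile> f \<^bold>: arr A B"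
  shows "const_ty A B f # \<Gamma> \<turnstile> coh_ty (A \<Up> 1) (B \<Up> 1) (f \<Up> 1) (Var 0) \<^bold>: TUniv k"
    "inh (const_ty A B f # \<Gamma>) (is_prop (coh_ty (A \<Up> 1) (B \<Up> 1) (f \<Up> 1) (Var 0)))"
proof -
  have w: "wf_ctx (const_ty A B f # \<Gamma>)" by (rule ctx_extend const_ty_ty groupoid_pairD[OF D] f)+
  have "const_ty A B f # \<Gamma> \<turnstile> f \<Up> 1 \<^bold>: arr (A \<Up> 1) (B \<Up> 1)"
    "const_ty A B f # \<Gamma> \<turnstile> Var 0 \<^bold>: const_ty (A \<Up> 1) (B \<Up> 1) (f \<Up> 1)"
    by (rule weak_ty(1)[OF f] var_ty w | simp)+
  from coh_ty_ty[OF groupoid_pair_weak(1)[OF D w] this]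
  show "const_ty A B f # \<Gamma> \<turnstile> coh_ty (A \<Up> 1) (B \<Up> 1) (f \<Up> 1) (Var 0) \<^bold>: TUniv k"
    "inh (const_ty A B f # \<Gamma>) (is_prop (coh_ty (A \<Up> 1) (B \<Up> 1) (f \<Up> 1) (Var 0)))" .
qed

lemma coherence_ty:
  assumes D: "groupoid_pair \<Gamma> k A B" and f: "\<Gamma> \<turnstile> f \<^bold>: arr A B"
  shows "\<Gamma> \<turnstile> coherence A B f \<^bold>: TUniv k"
  unfolding coherence_def by (rule ty_sigma const_ty_ty coh_var_ty[OF D] f groupoid_pairD[OF D])+

lemma coherence_var_ty:
  assumes D: "groupoid_pair \<Gamma> k A B"
  shows "arr A B # \<Gamma> \<turnstile> coherence (A \<Up> 1) (B \<Up> 1) (Var 0) \<^bold>: TUniv k"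
proof -
  have w: "wf_ctx (arr A B # \<Gamma>)" by (rule ctx_extend arr_ty groupoid_pairD[OF D])+
  show ?thesis by (rule coherence_ty[OF groupoid_pair_weak(1)[OF D w]] var_ty w | simp)+
qed

lemma coherent_maps_ty:
  assumes D: "groupoid_pair \<Gamma> k A B"
  shows "\<Gamma> \<turnstile> coherent_maps A B \<^bold>: TUniv k"
  unfolding coherent_maps_eq_sigma
      by (rule ty_sigma arr_ty coherence_var_ty groupoid_pairD[OF D] D)+

lemma coherent_pair_ty:
  assumes D: "groupoid_pair \<Gamma> k A B" and f: "\<Gamma> \<turnstile> f \<^bold>: arr A B" and w: "\<Gamma> \<turnstile> w \<^bold>: coherence A B f"
  shows "\<Gamma> \<turnstile> TPair f w \<^bold>: coherent_maps A B"
  unfolding coherent_maps_eq_sigma by (rule ty_pair[OF coherence_var_ty[OF D] f]) (use w in simp)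

lemma coherence_fst:
  assumes D: "groupoid_pair \<Gamma> k A B" and f: "\<Gamma> \<turnstile> f \<^bold>: arr A B" and w: "\<Gamma> \<turnstile> w \<^bold>: coherence A B f"
  shows "\<Gamma> \<turnstile> const_of A B f w \<^bold>: const_ty A B f"
    and "coherent_map \<Gamma> k A B f (const_of A B f w)"
proof -
  note d = groupoid_pairD[OF D]
  note c = const_ty_ty(1)[OF d(1,2) f]
  show 1: "\<Gamma> \<turnstile> const_of A B f w \<^bold>: const_ty A B f"
    using fst_ty[OF c coh_var_ty(1)[OF D f] w[unfolded coherence_def]] .
  have "inh \<Gamma> (coh_ty A B f (const_of A B f w))"
    using inhI[OF snd_ty[OF c coh_var_ty(1)[OF D f] w[unfolded coherence_def]]] by simp
  with 1 d f show "coherent_map \<Gamma> k A B f (const_of A B f w)"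
    by (auto simp: coherent_map_def)
qed

text \<open>With \<open>f\<close> fixed, coherence is a proposition because \<open>B\<close> is a
  groupoid, so the values of the constancy proofs are all that has to be compared.\<close>

lemma coherence_eq:
  assumes D: "groupoid_pair \<Gamma> k A B" and f: "\<Gamma> \<turnstile> f \<^bold>: arr A B" and w: "\<Gamma> \<turnstile> w \<^bold>: coherence A B f"
    and w': "\<Gamma> \<turnstile> w' \<^bold>: coherence A B f"
    and e: "ideq (A \<Up> 1 # A # \<Gamma>) (TId (B \<Up> 2) (f \<Up> 2 $ Var 1) (f \<Up> 2 $ Var 0))
        (const_of A B f w \<Up> 2 $ Var 1 $ Var 0) (const_of A B f w' \<Up> 2 $ Var 1 $ Var 0)"
  shows "ideq \<Gamma> (coherent_maps A B) (TPair f w) (TPair f w')"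
proof -
  note d = groupoid_pairD[OF D]
  note c = const_ty_ty[OF d(1,2) f]
  let ?I = "TId (B \<Up> 2) (f \<Up> 2 $ Var 1) (f \<Up> 2 $ Var 0)"
  have w1: "wf_ctx (A # \<Gamma>)" using d(1) by (rule ctx_extend)
  have PI: "A # \<Gamma> \<turnstile> TPi (A \<Up> 1) ?I \<^bold>: TUniv k" by (rule ty_pi c)+
  have cw: "\<Gamma> \<turnstile> const_of A B f w \<^bold>: TPi A (TPi (A \<Up> 1) ?I)"
      "\<Gamma> \<turnstile> const_of A B f w' \<^bold>: TPi A (TPi (A \<Up> 1) ?I)"
    using coherence_fst(1)[OF D f w] coherence_fst(1)[OF D f w'] unfolding const_ty_def' .
  have "ideq \<Gamma> (TPi A (TPi (A \<Up> 1) ?I)) (const_of A B f w) (const_of A B f w')"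
    by (rule funext[OF d(1) PI cw funext[OF c(2,3) fam_app_ty[OF cw(1) w1]
        fam_app_ty[OF cw(2) w1]]])
      (use e in simp)
  then have cc: "ideq \<Gamma> (const_ty A B f) (const_of A B f w) (const_of A B f w')"
    by (simp add: const_ty_def')
  have ww: "ideq \<Gamma> (coherence A B f) w w'"
    using sigma_eq[OF c(1) coh_var_ty[OF D f] w[unfolded coherence_def] w'[unfolded coherence_def]
        cc]
    by (simp add: coherence_def)
  note W = coherence_ty[OF D f]
  have v: "wf_ctx (coherence A B f # \<Gamma>)" using W by (rule ctx_extend)
  have "coherence A B f # \<Gamma> \<turnstile> TPair (f \<Up> 1) (Var 0) \<^bold>: coherent_maps A B \<Up> 1"
    by simp (rule coherent_pair_ty[OF groupoid_pair_weak(1)[OF D v]] weak_ty(1)[OF f v] var_ty v |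
        simp)+
  from ap_id[OF W coherent_maps_ty[OF D] this w w' ww] show ?thesis by simp
qed

text \<open>The naturality squares \<open>c x y \<cdot> P y = P x \<cdot> d x y\<close>. They say,
  without mentioning transport, that the homotopy \<open>P\<close> carries \<open>c\<close> to
  \<open>d\<close>.\<close>

definition natural :: "tm \<Rightarrow> tm \<Rightarrow> tm \<Rightarrow> tm \<Rightarrow> tm \<Rightarrow> tm \<Rightarrow> tm \<Rightarrow> tm" where
  "natural A B f c g d P = TPi A (TPi (A \<Up> 1) (TId (TId (B \<Up> 2) (f \<Up> 2 $ Var 1) (g \<Up> 2 $ Var 0))
     (concat_path (B \<Up> 2) (f \<Up> 2 $ Var 1) (f \<Up> 2 $ Var 0) (g \<Up> 2 $ Var 0)
       (c \<Up> 2 $ Var 1 $ Var 0) (P \<Up> 2 $ Var 0))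
     (concat_path (B \<Up> 2) (f \<Up> 2 $ Var 1) (g \<Up> 2 $ Var 1) (g \<Up> 2 $ Var 0)
       (P \<Up> 2 $ Var 1) (d \<Up> 2 $ Var 1 $ Var 0))))"

lemma sub_natural [simp]:
  "sub \<sigma> (natural A B f c g d P) = natural (sub \<sigma> A) (sub \<sigma> B) (sub \<sigma> f) (sub \<sigma> c) (sub \<sigma> g)
      (sub \<sigma> d) (sub \<sigma> P)"
  by (simp add: natural_def)

lemma natural_app:
  assumes "inh \<Gamma> (natural A B f c g d P)" "\<Gamma> \<turnstile> x \<^bold>: A" "\<Gamma> \<turnstile> y \<^bold>: A"
  shows "ideq \<Gamma> (TId B (f $ x) (g $ y)) (concat_path B (f $ x) (f $ y) (g $ y) (c $ x $ y) (P $ y))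
      (concat_path B (f $ x) (g $ x) (g $ y) (P $ x) (d $ x $ y))"
  using inh_app[OF inh_app[OF assms(1)[unfolded natural_def] assms(2) refl, simplified] assms(3)
      refl] by simp

lemma hom_app_ty: "\<Gamma> \<turnstile> P \<^bold>: homotopy A (B \<Up> 1) f g \<Longrightarrow> \<Gamma> \<turnstile> a \<^bold>: A \<Longrightarrow> \<Gamma> \<turnstile> P $ a \<^bold>: TId B (f $ a)
    (g $ a)"
  unfolding homotopy_def' by (erule app_ty) simp_all

lemma natural_ty:
  assumes D: "groupoid_pair \<Gamma> k A B" and f: "\<Gamma> \<turnstile> f \<^bold>: arr A B" and c: "\<Gamma> \<turnstile> c \<^bold>: const_ty A B f"
    and g: "\<Gamma> \<turnstile> g \<^bold>: arr A B" and e: "\<Gamma> \<turnstile> d \<^bold>: const_ty A B g"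
        and P: "\<Gamma> \<turnstile> P \<^bold>: homotopy A (B \<Up> 1) f g"
  shows "\<Gamma> \<turnstile> natural A B f c g d P \<^bold>: TUniv k"
proof -
  note d = groupoid_pairD[OF D]
  have w1: "wf_ctx (A # \<Gamma>)" using d(1) by (rule ctx_extend)
  have A1: "A # \<Gamma> \<turnstile> A \<Up> 1 \<^bold>: TUniv k" by (rule weak_univ d w1)+
  have w2: "wf_ctx (A \<Up> 1 # A # \<Gamma>)" using A1 by (rule ctx_extend)
  let ?G = "A \<Up> 1 # A # \<Gamma>"
  note d2 = groupoid_pairD[OF groupoid_pair_weak(2)[OF D w2]]
  have v: "?G \<turnstile> f \<Up> 2 \<^bold>: arr (A \<Up> 2) (B \<Up> 2)" "?G \<turnstile> c \<Up> 2 \<^bold>: const_ty (A \<Up> 2) (B \<Up> 2) (f \<Up> 2)"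
    "?G \<turnstile> g \<Up> 2 \<^bold>: arr (A \<Up> 2) (B \<Up> 2)" "?G \<turnstile> d \<Up> 2 \<^bold>: const_ty (A \<Up> 2) (B \<Up> 2) (g \<Up> 2)"
    "?G \<turnstile> P \<Up> 2 \<^bold>: homotopy (A \<Up> 2) (B \<Up> 2 \<Up> 1) (f \<Up> 2) (g \<Up> 2)"
    "?G \<turnstile> Var 1 \<^bold>: A \<Up> 2" "?G \<turnstile> Var 0 \<^bold>: A \<Up> 2"
    by (rule weak_ty(2)[OF f] weak_ty(2)[OF c] weak_ty(2)[OF g] weak_ty(2)[OF e] weak_ty(2)[OF P]
        var_ty w2 | simp)+
  show ?thesis
    unfolding natural_def
    by (rule ty_pi d(1) A1 ty_id concat_ty const_app_ty hom_app_ty arr_app_ty d2 v)+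
qed

lemma homotopy_refl_app:
  assumes A: "\<Gamma> \<turnstile> A \<^bold>: TUniv k" and f: "\<Gamma> \<turnstile> f \<^bold>: arr A B" and a: "\<Gamma> \<turnstile> a \<^bold>: A"
  shows "\<Gamma> \<turnstile> TLam A (TRefl (f \<Up> 1 $ Var 0)) $ a \<^bold>\<equiv> TRefl (f $ a) \<^bold>: TId B (f $ a) (f $ a)"
proof -
  have w: "wf_ctx (A # \<Gamma>)" using A by (rule ctx_extend)
  have "A # \<Gamma> \<turnstile> TRefl (f \<Up> 1 $ Var 0) \<^bold>: TId (B \<Up> 1) (f \<Up> 1 $ Var 0) (f \<Up> 1 $ Var 0)"
    by (rule ty_refl fam_app_ty f[unfolded arr_def'] w)+
  from beta_pi[OF this a] show ?thesis by simp
qed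

text \<open>Over the trivial homotopy the square reads
  \<open>c x y \<cdot> refl = refl \<cdot> d x y\<close>, and the unit laws leave
  \<open>c x y = d x y\<close>.\<close>

lemma coherent_maps_eq_refl:
  assumes D: "groupoid_pair \<Gamma> k A B" and f: "\<Gamma> \<turnstile> f \<^bold>: arr A B"
    and w: "\<Gamma> \<turnstile> w \<^bold>: coherence A B f" and w': "\<Gamma> \<turnstile> w' \<^bold>: coherence A B f"
    and n: "inh \<Gamma> (natural A B f (const_of A B f w) f (const_of A B f w')
        (TLam A (TRefl (f \<Up> 1 $ Var 0))))"
  shows "ideq \<Gamma> (coherent_maps A B) (TPair f w) (TPair f w')"
proof -
  have *: "ideq \<Gamma> (TId B (f $ x) (f $ y)) (c $ x $ y) (d $ x $ y)"
    if D: "groupoid_pair \<Gamma> k A B" and f: "\<Gamma> \<turnstile> f \<^bold>: arr A B"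
    and c: "\<Gamma> \<turnstile> c \<^bold>: const_ty A B f" and c': "\<Gamma> \<turnstile> d \<^bold>: const_ty A B f" and x: "\<Gamma> \<turnstile> x \<^bold>: A"
        and y: "\<Gamma> \<turnstile> y \<^bold>: A"
    and n: "inh \<Gamma> (natural A B f c f d (TLam A (TRefl (f \<Up> 1 $ Var 0))))" for \<Gamma> A B f c d x y
  proof -
    note d = groupoid_pairD[OF D]
    have fx: "\<Gamma> \<turnstile> f $ x \<^bold>: B" and fy: "\<Gamma> \<turnstile> f $ y \<^bold>: B" by (rule arr_app_ty f x y)+
    have cxy: "\<Gamma> \<turnstile> c $ x $ y \<^bold>: TId B (f $ x) (f $ y)" "\<Gamma> \<turnstile> d $ x $ y \<^bold>: TId B (f $ x) (f $ y)"
      by (rule const_app_ty c c' x y)+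
    have T: "\<Gamma> \<turnstile> TId B (f $ x) (f $ y) \<^bold>: TUniv k" by (rule ty_id d fx fy)+
    note r = homotopy_refl_app[OF d(1) f x] homotopy_refl_app[OF d(1) f y]
    have "ideq \<Gamma> (TId B (f $ x) (f $ y))
        (concat_path B (f $ x) (f $ y) (f $ y) (c $ x $ y) (TRefl (f $ y))) (d $ x $ y)"
    proof (rule id_conv[OF natural_app[OF n x y] T])
      show "\<Gamma> \<turnstile> concat_path B (f $ x) (f $ y) (f $ y) (c $ x $ y)
          (TLam A (TRefl (f \<Up> 1 $ Var 0)) $ y) \<^bold>\<equiv>
         concat_path B (f $ x) (f $ y) (f $ y) (c $ x $ y) (TRefl (f $ y)) \<^bold>: TId B (f $ x) (f $ y)"
        by (rule concat_cong[OF d(2) fy] eq_refl fx fy cxy r)+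
      have "\<Gamma> \<turnstile> concat_path B (f $ x) (f $ x) (f $ y) (TLam A (TRefl (f \<Up> 1 $ Var 0)) $ x)
          (d $ x $ y) \<^bold>\<equiv>
         concat_path B (f $ x) (f $ x) (f $ y) (TRefl (f $ x)) (d $ x $ y) \<^bold>: TId B (f $ x) (f $ y)"
        by (rule concat_cong[OF d(2) fy] eq_refl fx fy cxy r)+
      then show "\<Gamma> \<turnstile> concat_path B (f $ x) (f $ x) (f $ y) (TLam A (TRefl (f \<Up> 1 $ Var 0)) $ x)
          (d $ x $ y) \<^bold>\<equiv>
         d $ x $ y \<^bold>: TId B (f $ x) (f $ y)"
        by (rule eq_trans[OF _ concat_refl_jeq[OF d(2) fx fy cxy(2)]])
    qed
    moreover have C: "\<Gamma> \<turnstile> concat_path B (f $ x) (f $ y) (f $ y) (c $ x $ y) (TRefl (f $ y)) \<^bold>: TId B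
        (f $ x) (f $ y)"
      by (rule concat_ty ty_refl d fx fy cxy)+
    ultimately show ?thesis
      using id_trans[OF T cxy(1) C cxy(2)
          id_sym[OF T C cxy(1) concat_refl_right[OF d(2) fx fy cxy(1)]]] by blast
  qed
  note d = groupoid_pairD[OF D]
  have w1: "wf_ctx (A # \<Gamma>)" using d(1) by (rule ctx_extend)
  have w2: "wf_ctx (A \<Up> 1 # A # \<Gamma>)" by (rule ctx_extend weak_univ d w1)+
  note s = subst_ok_sh(2)[OF w2]
  have "ideq (A \<Up> 1 # A # \<Gamma>) (TId (B \<Up> 2) (f \<Up> 2 $ Var 1) (f \<Up> 2 $ Var 0))
      (const_of A B f w \<Up> 2 $ Var 1 $ Var 0) (const_of A B f w' \<Up> 2 $ Var 1 $ Var 0)"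
  proof (rule *[OF groupoid_pair_weak(2)[OF D w2]])
    show "inh (A \<Up> 1 # A # \<Gamma>) (natural (A \<Up> 2) (B \<Up> 2) (f \<Up> 2) (const_of A B f w \<Up> 2) (f \<Up> 2)
        (const_of A B f w' \<Up> 2)
        (TLam (A \<Up> 2) (TRefl (f \<Up> 2 \<Up> 1 $ Var 0))))"
      using inh_weak[OF n s] by simp
    show "A \<Up> 1 # A # \<Gamma> \<turnstile> f \<Up> 2 \<^bold>: arr (A \<Up> 2) (B \<Up> 2)" using has_type_sub[OF f s] by simp
    show "A \<Up> 1 # A # \<Gamma> \<turnstile> const_of A B f w \<Up> 2 \<^bold>: const_ty (A \<Up> 2) (B \<Up> 2) (f \<Up> 2)"
      using has_type_sub[OF coherence_fst(1)[OF D f w] s] by simp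
    show "A \<Up> 1 # A # \<Gamma> \<turnstile> const_of A B f w' \<Up> 2 \<^bold>: const_ty (A \<Up> 2) (B \<Up> 2) (f \<Up> 2)"
      using has_type_sub[OF coherence_fst(1)[OF D f w'] s] by simp
  qed (rule var_ty w2 | simp)+
  then show ?thesis by (rule coherence_eq[OF D f w w'])
qed

text \<open>Induction on the homotopy reduces this to \<open>coherent_maps_eq_refl\<close>. As
  \<open>u\<close> depends on \<open>g\<close>, and naturality on \<open>g\<close>, \<open>u\<close>
  and \<open>P\<close>, the motive quantifies over both \<open>u\<close> and the naturality
  proof.\<close>

lemma coherent_maps_eq:
  assumes D: "groupoid_pair \<Gamma> k A B" and f: "\<Gamma> \<turnstile> f \<^bold>: arr A B" and w: "\<Gamma> \<turnstile> w \<^bold>: coherence A B f"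
    and g: "\<Gamma> \<turnstile> g \<^bold>: arr A B" and u: "\<Gamma> \<turnstile> u \<^bold>: coherence A B g"
    and P: "\<Gamma> \<turnstile> P \<^bold>: homotopy A (B \<Up> 1) f g"
    and n: "inh \<Gamma> (natural A B f (const_of A B f w) g (const_of A B g u) P)"
  shows "ideq \<Gamma> (coherent_maps A B) (TPair f w) (TPair g u)"
proof -
  note d = groupoid_pairD[OF D]
  note c = coherence_fst(1)[OF D f w]
  have wA: "wf_ctx (A # \<Gamma>)" using d(1) by (rule ctx_extend)
  have B1: "A # \<Gamma> \<turnstile> B \<Up> 1 \<^bold>: TUniv k" by (rule weak_univ d wA)+
  let ?F = "TPi A (B \<Up> 1)"
  let ?Q = "homotopy (A \<Up> 1) (sub (Var 0 \<bullet> sh 2) (B \<Up> 1)) (f \<Up> 1) (Var 0)"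
  have F: "\<Gamma> \<turnstile> ?F \<^bold>: TUniv k" by (rule ty_pi d B1)+
  have w1: "wf_ctx (?F # \<Gamma>)" using F by (rule ctx_extend)
  have v1: "?F # \<Gamma> \<turnstile> f \<Up> 1 \<^bold>: arr (A \<Up> 1) (B \<Up> 1)" "?F # \<Gamma> \<turnstile> Var 0 \<^bold>: arr (A \<Up> 1) (B \<Up> 1)"
    by (rule weak_ty(1)[OF f w1] var_ty w1 | simp add: arr_def')+
  note d1 = groupoid_pairD[OF groupoid_pair_weak(1)[OF D w1]]
  have Q: "?F # \<Gamma> \<turnstile> ?Q \<^bold>: TUniv k"
    by (rule homotopy_ty[OF d1(1)], simp, rule weak_ty(2)[OF d(2)], rule ctx_extend[OF d1(1)], simp)
       (use v1 in \<open>simp_all add: arr_def'\<close>)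
  let ?G = "?Q # ?F # \<Gamma>"
  let ?U = "coherence (A \<Up> 2) (B \<Up> 2) (Var 1)"
  let ?N = "natural (A \<Up> 3) (B \<Up> 3) (f \<Up> 3) (const_of A B f w \<Up> 3) (Var 2)
      (const_of (A \<Up> 3) (B \<Up> 3) (Var 2) (Var 0)) (Var 1)"
  let ?E = "TId (coherent_maps (A \<Up> 4) (B \<Up> 4)) (TPair (f \<Up> 4) (w \<Up> 4)) (TPair (Var 3) (Var 1))"
  let ?C = "TPi ?U (TPi ?N ?E)"
  have w2: "wf_ctx ?G" using Q by (rule ctx_extend)
  have g2: "?G \<turnstile> Var 1 \<^bold>: arr (A \<Up> 2) (B \<Up> 2)" by (rule var_ty w2 | simp add: arr_def')+
  have U: "?G \<turnstile> ?U \<^bold>: TUniv k" by (rule coherence_ty[OF groupoid_pair_weak(2)[OF D w2] g2])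
  have w3: "wf_ctx (?U # ?G)" using U by (rule ctx_extend)
  note D3 = groupoid_pair_weak(3)[OF D w3]
  have v3: "?U # ?G \<turnstile> f \<Up> 3 \<^bold>: arr (A \<Up> 3) (B \<Up> 3)"
    "?U # ?G \<turnstile> const_of A B f w \<Up> 3 \<^bold>: const_ty (A \<Up> 3) (B \<Up> 3) (f \<Up> 3)"
    using weak_ty(3)[OF f w3] weak_ty(3)[OF c w3] by simp_all
  have g3: "?U # ?G \<turnstile> Var 2 \<^bold>: arr (A \<Up> 3) (B \<Up> 3)"
      "?U # ?G \<turnstile> Var 0 \<^bold>: coherence (A \<Up> 3) (B \<Up> 3) (Var 2)"
    "?U # ?G \<turnstile> Var 1 \<^bold>: homotopy (A \<Up> 3) (B \<Up> 3 \<Up> 1) (f \<Up> 3) (Var 2)"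
    by (rule var_ty w3 | simp add: arr_def')+
  have N: "?U # ?G \<turnstile> ?N \<^bold>: TUniv k"
    by (rule natural_ty[OF D3 v3 g3(1) coherence_fst(1)[OF D3 g3(1,2)] g3(3)])
  have w4: "wf_ctx (?N # ?U # ?G)" using N by (rule ctx_extend)
  note D4 = groupoid_pair_weak(4)[OF D w4]
  have v4: "?N # ?U # ?G \<turnstile> f \<Up> 4 \<^bold>: arr (A \<Up> 4) (B \<Up> 4)"
    "?N # ?U # ?G \<turnstile> w \<Up> 4 \<^bold>: coherence (A \<Up> 4) (B \<Up> 4) (f \<Up> 4)"
    using weak_ty(4)[OF f w4] weak_ty(4)[OF w w4] by simp_all
  have g4: "?N # ?U # ?G \<turnstile> Var 3 \<^bold>: arr (A \<Up> 4) (B \<Up> 4)"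
      "?N # ?U # ?G \<turnstile> Var 1 \<^bold>: coherence (A \<Up> 4) (B \<Up> 4) (Var 3)"
    by (rule var_ty w4 | simp add: arr_def')+
  have E: "?N # ?U # ?G \<turnstile> ?E \<^bold>: TUniv k"
    by (rule ty_id coherent_maps_ty[OF D4] coherent_pair_ty[OF D4] v4 g4)+
  have C: "?G \<turnstile> ?C \<^bold>: TUniv k" by (rule ty_pi U N E)+
  let ?R = "TLam A (TRefl (f \<Up> 1 $ Var 0))"
  let ?U' = "coherence A B f"
  let ?N' = "natural (A \<Up> 1) (B \<Up> 1) (f \<Up> 1) (const_of A B f w \<Up> 1) (f \<Up> 1)
      (const_of (A \<Up> 1) (B \<Up> 1) (f \<Up> 1) (Var 0)) (?R \<Up> 1)"
  have R: "\<Gamma> \<turnstile> ?R \<^bold>: homotopy A (B \<Up> 1) f f" by (rule refl_homotopy_ty d f[unfolded arr_def'])+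
  have x1: "wf_ctx (?U' # \<Gamma>)" by (rule ctx_extend coherence_ty D f)+
  note D1 = groupoid_pair_weak(1)[OF D x1]
  have y1: "?U' # \<Gamma> \<turnstile> f \<Up> 1 \<^bold>: arr (A \<Up> 1) (B \<Up> 1)"
    "?U' # \<Gamma> \<turnstile> const_of A B f w \<Up> 1 \<^bold>: const_ty (A \<Up> 1) (B \<Up> 1) (f \<Up> 1)"
    "?U' # \<Gamma> \<turnstile> ?R \<Up> 1 \<^bold>: homotopy (A \<Up> 1) (B \<Up> 1 \<Up> 1) (f \<Up> 1) (f \<Up> 1)"
    using weak_ty(1)[OF f x1] weak_ty(1)[OF c x1] weak_ty(1)[OF R x1] by simp_all
  have y1': "?U' # \<Gamma> \<turnstile> Var 0 \<^bold>: coherence (A \<Up> 1) (B \<Up> 1) (f \<Up> 1)" by (rule var_ty x1 | simp)+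
  have x2: "wf_ctx (?N' # ?U' # \<Gamma>)"
    by (rule ctx_extend[OF natural_ty[OF D1 y1(1,2,1) coherence_fst(1)[OF D1 y1(1) y1'] y1(3)]])
  note D2 = groupoid_pair_weak(2)[OF D x2]
  have y2: "?N' # ?U' # \<Gamma> \<turnstile> f \<Up> 2 \<^bold>: arr (A \<Up> 2) (B \<Up> 2)"
    "?N' # ?U' # \<Gamma> \<turnstile> w \<Up> 2 \<^bold>: coherence (A \<Up> 2) (B \<Up> 2) (f \<Up> 2)"
    using weak_ty(2)[OF f x2] weak_ty(2)[OF w x2] by simp_all
  have y2': "?N' # ?U' # \<Gamma> \<turnstile> Var 1 \<^bold>: coherence (A \<Up> 2) (B \<Up> 2) (f \<Up> 2)" by (rule var_ty x2 | simp)+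
  have n2: "inh (?N' # ?U' # \<Gamma>) (natural (A \<Up> 2) (B \<Up> 2) (f \<Up> 2)
      (const_of (A \<Up> 2) (B \<Up> 2) (f \<Up> 2) (w \<Up> 2)) (f \<Up> 2)
     (const_of (A \<Up> 2) (B \<Up> 2) (f \<Up> 2) (Var 1)) (TLam (A \<Up> 2) (TRefl (f \<Up> 2 \<Up> 1 $ Var 0))))"
    by (rule inhI, rule var_ty(1)[OF x2]) simp
  have "inh \<Gamma> (sub (?R \<bullet> f \<bullet> Var) ?C)"
    using coherent_maps_eq_refl[OF D2 y2 y2' n2] by simp (intro inh_lam, simp)
  from homotopy_ind[OF d(1) B1 f[unfolded arr_def'] g[unfolded arr_def'] P C this]
  have "inh \<Gamma> (sub (P \<bullet> g \<bullet> Var) ?C)" .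
  from inh_app[OF this[simplified] u refl] have "inh \<Gamma> (sub (u \<bullet> P \<bullet> g \<bullet> Var) (TPi ?N ?E))" by simp
  moreover obtain n where "\<Gamma> \<turnstile> n \<^bold>: natural A B f (const_of A B f w) g (const_of A B g u) P" using n
      by (rule inhE)
  ultimately show ?thesis by simp (erule inh_app, assumption, simp)
qed

section \<open>Restriction of maps on the truncation\<close>

text \<open>Unlike \<open>ap_id\<close>, which asserts existence, this path is a term that can occur
  in types and that computes at reflexivity.\<close>

definition ap_tm :: "tm \<Rightarrow> tm \<Rightarrow> tm \<Rightarrow> tm \<Rightarrow> tm \<Rightarrow> tm" where
  "ap_tm B h x y e = TJ (TId (B \<Up> 3) (h \<Up> 3 $ Var 2) (h \<Up> 3 $ Var 1)) (TRefl (h \<Up> 1 $ Var 0)) x y e"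

lemma sub_ap_tm [simp]: "sub \<sigma> (ap_tm B h x y e) = ap_tm (sub \<sigma> B) (sub \<sigma> h) (sub \<sigma> x) (sub \<sigma> y)
    (sub \<sigma> e)"
  by (simp add: ap_tm_def)

lemma ap_tm_ty:
  assumes X: "\<Gamma> \<turnstile> X \<^bold>: TUniv k" and B: "\<Gamma> \<turnstile> B \<^bold>: TUniv k" and h: "\<Gamma> \<turnstile> h \<^bold>: arr X B"
      and x: "\<Gamma> \<turnstile> x \<^bold>: X"
  shows "\<Gamma> \<turnstile> y \<^bold>: X \<Longrightarrow> \<Gamma> \<turnstile> e \<^bold>: TId X x y \<Longrightarrow> \<Gamma> \<turnstile> ap_tm B h x y e \<^bold>: TId B (h $ x) (h $ y)"
    and "\<Gamma> \<turnstile> ap_tm B h x x (TRefl x) \<^bold>\<equiv> TRefl (h $ x) \<^bold>: TId B (h $ x) (h $ x)"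
proof -
  have w1: "wf_ctx (X # \<Gamma>)" using X by (rule ctx_extend)
  have w2: "wf_ctx (X \<Up> 1 # X # \<Gamma>)" by (rule ctx_extend weak_univ X w1)+
  have w3: "wf_ctx (TId (X \<Up> 2) (Var 1) (Var 0) # X \<Up> 1 # X # \<Gamma>)" by (rule ty_rules X w2 | simp)+
  have "TId (X \<Up> 2) (Var 1) (Var 0) # X \<Up> 1 # X # \<Gamma> \<turnstile> h \<Up> 3 \<^bold>: arr (X \<Up> 3) (B \<Up> 3)"
    "X # \<Gamma> \<turnstile> h \<Up> 1 \<^bold>: arr (X \<Up> 1) (B \<Up> 1)"
    using weak_ty(3)[OF h w3] weak_ty(1)[OF h w1] by simp_all
  note hh = arr_app_ty[OF this(1)] arr_app_ty[OF this(2)]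
  have C: "TId (X \<Up> 2) (Var 1) (Var 0) # X \<Up> 1 # X # \<Gamma> \<turnstile> TId (B \<Up> 3) (h \<Up> 3 $ Var 2)
      (h \<Up> 3 $ Var 1) \<^bold>: TUniv k"
    by (rule ty_id hh weak_ty(3)[OF B] var_ty w3 | simp)+
  have c: "X # \<Gamma> \<turnstile> TRefl (h \<Up> 1 $ Var 0) \<^bold>:
      sub (TRefl (Var 0) \<bullet> Var 0 \<bullet> Var 0 \<bullet> sh 1) (TId (B \<Up> 3) (h \<Up> 3 $ Var 2) (h \<Up> 3 $ Var 1))"
    by simp (rule ty_refl hh var_ty w1 refl)+
  show "\<Gamma> \<turnstile> y \<^bold>: X \<Longrightarrow> \<Gamma> \<turnstile> e \<^bold>: TId X x y \<Longrightarrow> \<Gamma> \<turnstile> ap_tm B h x y e \<^bold>: TId B (h $ x) (h $ y)"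
    using ty_J'[OF C c x] by (simp add: ap_tm_def)
  show "\<Gamma> \<turnstile> ap_tm B h x x (TRefl x) \<^bold>\<equiv> TRefl (h $ x) \<^bold>: TId B (h $ x) (h $ x)"
    using beta_J'[OF C c x] by (simp add: ap_tm_def)
qed

definition trunc_path :: "tm \<Rightarrow> tm \<Rightarrow> tm \<Rightarrow> tm \<Rightarrow> tm" where
  "trunc_path B h x y = ap_tm B h x y (TTruncEq x y)"

lemma sub_trunc_path [simp]: "sub \<sigma> (trunc_path B h x y) = trunc_path (sub \<sigma> B) (sub \<sigma> h) (sub \<sigma> x)
    (sub \<sigma> y)"
  by (simp add: trunc_path_def)

lemma trunc_path_ty:
  assumes "\<Gamma> \<turnstile> A \<^bold>: TUniv k" and "\<Gamma> \<turnstile> B \<^bold>: TUniv k" and "\<Gamma> \<turnstile> h \<^bold>: arr (TTrunc A) B"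
    and "\<Gamma> \<turnstile> x \<^bold>: TTrunc A" and "\<Gamma> \<turnstile> y \<^bold>: TTrunc A"
  shows "\<Gamma> \<turnstile> trunc_path B h x y \<^bold>: TId B (h $ x) (h $ y)"
  unfolding trunc_path_def by (rule ap_tm_ty[where X = "TTrunc A"] ty_trunc ty_trunc_eq assms)+

text \<open>The path from \<open>y\<close> to \<open>z\<close> is generalised to an arbitrary path
  \<open>e : y = y'\<close>. The claim becomes
  \<open>trunc_path x y \<cdot> ap h e = trunc_path x y'\<close>, which path induction reduces to
  the right unit law. In this way the paths \<open>TTruncEq\<close> never have to be composed in the
  truncation.\<close>

lemma trunc_path_concat:
  assumes A: "\<Gamma> \<turnstile> A \<^bold>: TUniv k" and B: "\<Gamma> \<turnstile> B \<^bold>: TUniv k" and h: "\<Gamma> \<turnstile> h \<^bold>: arr (TTrunc A) B"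
    and x: "\<Gamma> \<turnstile> x \<^bold>: TTrunc A" and y: "\<Gamma> \<turnstile> y \<^bold>: TTrunc A" and z: "\<Gamma> \<turnstile> z \<^bold>: TTrunc A"
  shows "ideq \<Gamma> (TId B (h $ x) (h $ z))
      (concat_path B (h $ x) (h $ y) (h $ z) (trunc_path B h x y) (trunc_path B h y z))
      (trunc_path B h x z)"
proof -
  let ?X = "TTrunc A"
  let ?G = "TId (?X \<Up> 1) (y \<Up> 1) (Var 0) # ?X # \<Gamma>"
  let ?C = "TId (TId (B \<Up> 2) (h \<Up> 2 $ x \<Up> 2) (h \<Up> 2 $ Var 1))
     (concat_path (B \<Up> 2) (h \<Up> 2 $ x \<Up> 2) (h \<Up> 2 $ y \<Up> 2) (h \<Up> 2 $ Var 1)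
        (trunc_path (B \<Up> 2) (h \<Up> 2) (x \<Up> 2) (y \<Up> 2))
            (ap_tm (B \<Up> 2) (h \<Up> 2) (y \<Up> 2) (Var 1) (Var 0)))
     (trunc_path (B \<Up> 2) (h \<Up> 2) (x \<Up> 2) (Var 1))"
  have X: "\<Gamma> \<turnstile> ?X \<^bold>: TUniv k" by (rule ty_trunc A)+
  have w1: "wf_ctx (?X # \<Gamma>)" using X by (rule ctx_extend)
  have w2: "wf_ctx ?G" by (rule ctx_extend ty_id weak_univ X weak_ty(1)[OF y] w1 var_ty refl)+
  have v: "?G \<turnstile> A \<Up> 2 \<^bold>: TUniv k" "?G \<turnstile> B \<Up> 2 \<^bold>: TUniv k"
      "?G \<turnstile> h \<Up> 2 \<^bold>: arr (TTrunc (A \<Up> 2)) (B \<Up> 2)"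
    "?G \<turnstile> x \<Up> 2 \<^bold>: TTrunc (A \<Up> 2)" "?G \<turnstile> y \<Up> 2 \<^bold>: TTrunc (A \<Up> 2)" "?G \<turnstile> Var 1 \<^bold>: TTrunc (A \<Up> 2)"
    "?G \<turnstile> Var 0 \<^bold>: TId (TTrunc (A \<Up> 2)) (y \<Up> 2) (Var 1)"
    by (rule weak_ty(2)[OF A] weak_ty(2)[OF B] weak_ty(2)[OF h] weak_ty(2)[OF x] weak_ty(2)[OF y]
        var_ty w2 | simp)+
  have X2: "?G \<turnstile> TTrunc (A \<Up> 2) \<^bold>: TUniv k" by (rule ty_trunc v)+
  have C: "?G \<turnstile> ?C \<^bold>: TUniv k"
    by (rule ty_id concat_ty trunc_path_ty[OF v(1,2,3)] ap_tm_ty[OF X2 v(2,3)] arr_app_ty[OF v(3)]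
        v)+
  have hx: "\<Gamma> \<turnstile> h $ x \<^bold>: B" and hy: "\<Gamma> \<turnstile> h $ y \<^bold>: B" by (rule arr_app_ty h x y)+
  have m: "\<Gamma> \<turnstile> trunc_path B h x y \<^bold>: TId B (h $ x) (h $ y)" by (rule trunc_path_ty[OF A B h x y])
  have T: "\<Gamma> \<turnstile> TId B (h $ x) (h $ y) \<^bold>: TUniv k" by (rule ty_id B hx hy)+
  have "ideq \<Gamma> (TId B (h $ x) (h $ y))
      (concat_path B (h $ x) (h $ y) (h $ y) (trunc_path B h x y) (ap_tm B h y y (TRefl y)))
      (trunc_path B h x y)"
    by (rule id_conv[OF concat_refl_right[OF B hx hy m] T
        concat_cong[OF B hy eq_refl[OF hx] eq_refl[OF hy] eq_refl[OF hy] eq_refl[OF m]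
        eq_sym[OF ap_tm_ty(2)[OF X B h y]]] eq_refl[OF m]])
  then have base: "inh \<Gamma> (sub (TRefl y \<bullet> y \<bullet> Var) ?C)" by simp
  from based_J[OF X y C base z ty_trunc_eq[OF y z]] show ?thesis
    by (simp add: trunc_path_def[of B h y z])
qed

text \<open>Values of a restriction are equal to values of \<open>h\<close> judgementally but not
  syntactically, and \<open>concat_path\<close> mentions its endpoints. So endpoints and paths are
  replaced together.\<close>

lemma trunc_path_concat_conv:
  assumes A: "\<Gamma> \<turnstile> A \<^bold>: TUniv k" and B: "\<Gamma> \<turnstile> B \<^bold>: TUniv k" and h: "\<Gamma> \<turnstile> h \<^bold>: arr (TTrunc A) B"
    and x: "\<Gamma> \<turnstile> x \<^bold>: TTrunc A" and y: "\<Gamma> \<turnstile> y \<^bold>: TTrunc A" and z: "\<Gamma> \<turnstile> z \<^bold>: TTrunc A"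
    and b3: "\<Gamma> \<turnstile> b3 \<^bold>: B"
    and e1: "\<Gamma> \<turnstile> b1 \<^bold>\<equiv> h $ x \<^bold>: B" and e2: "\<Gamma> \<turnstile> b2 \<^bold>\<equiv> h $ y \<^bold>: B" and e3: "\<Gamma> \<turnstile> b3 \<^bold>\<equiv> h $ z \<^bold>: B"
    and p: "\<Gamma> \<turnstile> p \<^bold>\<equiv> trunc_path B h x y \<^bold>: TId B b1 b2"
        and q: "\<Gamma> \<turnstile> q \<^bold>\<equiv> trunc_path B h y z \<^bold>: TId B b2 b3"
    and r: "\<Gamma> \<turnstile> r \<^bold>\<equiv> trunc_path B h x z \<^bold>: TId B b1 b3"
  shows "ideq \<Gamma> (TId B b1 b3) (concat_path B b1 b2 b3 p q) r"
  by (rule inh_conv[OF trunc_path_concat[OF A B h x y z]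
        eq_sym[OF cong_id[OF cong_id[OF eq_refl[OF B] e1 e3] concat_cong[OF B b3 e1 e2 e3 p q] r]]])

text \<open>
  The two equations are judgemental, so the values of a restriction can be replaced inside
  types.
\<close>

definition restricts :: "tm list \<Rightarrow> tm \<Rightarrow> tm \<Rightarrow> tm \<Rightarrow> tm \<Rightarrow> tm \<Rightarrow> bool" where
  "restricts \<Gamma> A B h f c \<longleftrightarrow>
    A # \<Gamma> \<turnstile> f \<Up> 1 $ Var 0 \<^bold>\<equiv> h \<Up> 1 $ TTruncIn (Var 0) \<^bold>: B \<Up> 1 \<and>
    A \<Up> 1 # A # \<Gamma> \<turnstile> c \<Up> 2 $ Var 1 $ Var 0 \<^bold>\<equiv>
      trunc_path (B \<Up> 2) (h \<Up> 2) (TTruncIn (Var 1)) (TTruncIn (Var 0)) \<^bold>: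
      TId (B \<Up> 2) (f \<Up> 2 $ Var 1) (f \<Up> 2 $ Var 0)"

text \<open>The equations are given at variables, so every instance in every context arises by
  substitution.\<close>

lemma restricts_app:
  assumes r: "restricts \<Gamma> A B h f c" and s: "subst_ok \<Delta> \<sigma> \<Gamma>" and a: "\<Delta> \<turnstile> a \<^bold>: sub \<sigma> A"
  shows "\<Delta> \<turnstile> sub \<sigma> f $ a \<^bold>\<equiv> sub \<sigma> h $ TTruncIn a \<^bold>: sub \<sigma> B"
    and "\<Delta> \<turnstile> b \<^bold>: sub \<sigma> A \<Longrightarrow> \<Delta> \<turnstile> sub \<sigma> c $ a $ b \<^bold>\<equiv>
      trunc_path (sub \<sigma> B) (sub \<sigma> h) (TTruncIn a) (TTruncIn b) \<^bold>: TId (sub \<sigma> B) (sub \<sigma> f $ a)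
          (sub \<sigma> f $ b)"
proof -
  have s1: "subst_ok \<Delta> (a \<bullet> \<sigma>) (A # \<Gamma>)" by (rule subst_ok_scons s a)+
  show "\<Delta> \<turnstile> sub \<sigma> f $ a \<^bold>\<equiv> sub \<sigma> h $ TTruncIn a \<^bold>: sub \<sigma> B"
    using jeq_sub[OF conjunct1[OF r[unfolded restricts_def]] s1] by simp
  assume b: "\<Delta> \<turnstile> b \<^bold>: sub \<sigma> A"
  have "subst_ok \<Delta> (b \<bullet> a \<bullet> \<sigma>) (A \<Up> 1 # A # \<Gamma>)" by (rule subst_ok_scons s1)+ (use b in simp)
  from jeq_sub[OF conjunct2[OF r[unfolded restricts_def]] this]
  show "\<Delta> \<turnstile> sub \<sigma> c $ a $ b \<^bold>\<equiv>
      trunc_path (sub \<sigma> B) (sub \<sigma> h) (TTruncIn a) (TTruncIn b) \<^bold>: TId (sub \<sigma> B) (sub \<sigma> f $ a)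
          (sub \<sigma> f $ b)"
    by simp
qed

lemma restricts_sub:
  assumes r: "restricts \<Gamma> A B h f c" and s: "subst_ok \<Delta> \<sigma> \<Gamma>" and A: "\<Delta> \<turnstile> sub \<sigma> A \<^bold>: TUniv k"
  shows "restricts \<Delta> (sub \<sigma> A) (sub \<sigma> B) (sub \<sigma> h) (sub \<sigma> f) (sub \<sigma> c)"
proof -
  note s1 = subst_ok_lift[OF s A]
  have w: "wf_ctx (sub \<sigma> A # \<Delta>)" using A by (rule ctx_extend)
  have s2: "subst_ok (sub \<sigma> A \<Up> 1 # sub \<sigma> A # \<Delta>) (lift (lift \<sigma>)) (A \<Up> 1 # A # \<Gamma>)"
    using subst_ok_lift[OF s1, of "A \<Up> 1" k] weak_univ[OF A w] by simp
  show ?thesis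
    using jeq_sub[OF conjunct1[OF r[unfolded restricts_def]] s1]
        jeq_sub[OF conjunct2[OF r[unfolded restricts_def]] s2]
    by (simp add: restricts_def)
qed

lemma restricts_app':
  assumes r: "restricts \<Gamma> A B h f c" and a: "\<Gamma> \<turnstile> a \<^bold>: A"
  shows "\<Gamma> \<turnstile> f $ a \<^bold>\<equiv> h $ TTruncIn a \<^bold>: B"
    and "\<Gamma> \<turnstile> b \<^bold>: A \<Longrightarrow> \<Gamma> \<turnstile> c $ a $ b \<^bold>\<equiv>
      trunc_path B h (TTruncIn a) (TTruncIn b) \<^bold>: TId B (f $ a) (f $ b)"
  using restricts_app[OF r subst_ok_Var[OF wf_ctxI[OF a]]] a by simp_all

definition restrict_fun :: "tm \<Rightarrow> tm \<Rightarrow> tm" where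
  "restrict_fun A h = TLam A (h \<Up> 1 $ TTruncIn (Var 0))"

definition restrict_const :: "tm \<Rightarrow> tm \<Rightarrow> tm \<Rightarrow> tm" where
  "restrict_const A B h = TLam A (TLam (A \<Up> 1)
      (trunc_path (B \<Up> 2) (h \<Up> 2) (TTruncIn (Var 1)) (TTruncIn (Var 0))))"

lemma sub_restrict [simp]:
  "sub \<sigma> (restrict_fun A h) = restrict_fun (sub \<sigma> A) (sub \<sigma> h)"
  "sub \<sigma> (restrict_const A B h) = restrict_const (sub \<sigma> A) (sub \<sigma> B) (sub \<sigma> h)"
  by (simp_all add: restrict_fun_def restrict_const_def)

lemma restrict_fun_ty:
  assumes A: "\<Gamma> \<turnstile> A \<^bold>: TUniv k" and h: "\<Gamma> \<turnstile> h \<^bold>: arr (TTrunc A) B"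
  shows "\<Gamma> \<turnstile> restrict_fun A h \<^bold>: arr A B"
    and "\<Gamma> \<turnstile> a \<^bold>: A \<Longrightarrow> \<Gamma> \<turnstile> restrict_fun A h $ a \<^bold>\<equiv> h $ TTruncIn a \<^bold>: B"
proof -
  have w: "wf_ctx (A # \<Gamma>)" using A by (rule ctx_extend)
  have *: "A # \<Gamma> \<turnstile> h \<Up> 1 $ TTruncIn (Var 0) \<^bold>: B \<Up> 1"
    by (rule arr_app_ty[where A = "TTrunc (A \<Up> 1)"] weak_ty(1)[OF h w] ty_trunc_in var_ty w | simp)+
  show "\<Gamma> \<turnstile> restrict_fun A h \<^bold>: arr A B"
    unfolding restrict_fun_def arr_def' using * by (rule ty_lam)
  show "\<Gamma> \<turnstile> restrict_fun A h $ a \<^bold>\<equiv> h $ TTruncIn a \<^bold>: B" if "\<Gamma> \<turnstile> a \<^bold>: A"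
    unfolding restrict_fun_def by (rule beta_pi_eq[OF * that]) simp_all
qed

lemma trunc_path_restrict_ty:
  assumes A: "\<Gamma> \<turnstile> A \<^bold>: TUniv k" and B: "\<Gamma> \<turnstile> B \<^bold>: TUniv k" and h: "\<Gamma> \<turnstile> h \<^bold>: arr (TTrunc A) B"
    and a: "\<Gamma> \<turnstile> a \<^bold>: A" and b: "\<Gamma> \<turnstile> b \<^bold>: A"
  shows "\<Gamma> \<turnstile> trunc_path B h (TTruncIn a) (TTruncIn b) \<^bold>: TId B (restrict_fun A h $ a)
      (restrict_fun A h $ b)"
proof -
  note e = restrict_fun_ty(2)[OF A h]
  have "\<Gamma> \<turnstile> trunc_path B h (TTruncIn a) (TTruncIn b) \<^bold>: TId B (h $ TTruncIn a) (h $ TTruncIn b)"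
    by (rule trunc_path_ty[OF A B h] ty_trunc_in a b)+
  then show ?thesis
    by (rule ty_conv[OF _ cong_id[OF eq_refl[OF B] eq_sym[OF e[OF a]] eq_sym[OF e[OF b]]]])
qed

lemma restrict_const_ty:
  assumes A: "\<Gamma> \<turnstile> A \<^bold>: TUniv k" and B: "\<Gamma> \<turnstile> B \<^bold>: TUniv k" and h: "\<Gamma> \<turnstile> h \<^bold>: arr (TTrunc A) B"
  shows "\<Gamma> \<turnstile> restrict_const A B h \<^bold>: const_ty A B (restrict_fun A h)"
    and "\<Gamma> \<turnstile> a \<^bold>: A \<Longrightarrow> \<Gamma> \<turnstile> b \<^bold>: A \<Longrightarrow> \<Gamma> \<turnstile> restrict_const A B h $ a $ b \<^bold>\<equiv>
      trunc_path B h (TTruncIn a) (TTruncIn b) \<^bold>: TId B (restrict_fun A h $ a)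
          (restrict_fun A h $ b)"
proof -
  have w1: "wf_ctx (A # \<Gamma>)" using A by (rule ctx_extend)
  have A1: "A # \<Gamma> \<turnstile> A \<Up> 1 \<^bold>: TUniv k" by (rule weak_univ A w1)+
  have w2: "wf_ctx (A \<Up> 1 # A # \<Gamma>)" using A1 by (rule ctx_extend)
  let ?G = "A \<Up> 1 # A # \<Gamma>"
  have *: "?G \<turnstile> trunc_path (B \<Up> 2) (h \<Up> 2) (TTruncIn (Var 1)) (TTruncIn (Var 0)) \<^bold>:
     TId (B \<Up> 2) (restrict_fun (A \<Up> 2) (h \<Up> 2) $ Var 1) (restrict_fun (A \<Up> 2) (h \<Up> 2) $ Var 0)"
    by (rule trunc_path_restrict_ty)
        (rule weak_ty(2)[OF A] weak_ty(2)[OF B] weak_ty(2)[OF h] var_ty w2 | simp)+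
  show "\<Gamma> \<turnstile> restrict_const A B h \<^bold>: const_ty A B (restrict_fun A h)"
    unfolding restrict_const_def const_ty_def' using * by simp (intro ty_lam)
  show "\<Gamma> \<turnstile> restrict_const A B h $ a $ b \<^bold>\<equiv>
      trunc_path B h (TTruncIn a) (TTruncIn b) \<^bold>: TId B (restrict_fun A h $ a)
          (restrict_fun A h $ b)"
    if "\<Gamma> \<turnstile> a \<^bold>: A" "\<Gamma> \<turnstile> b \<^bold>: A"
    unfolding restrict_const_def using beta2[OF A A1 * that(1)] that(2) by simp
qed

text \<open>After \<beta>, coherence is the composition law \<open>trunc_path_concat\<close> at
  three points of the form \<open>|a|\<close>.\<close>

lemma restrict_coh:
  assumes A: "\<Gamma> \<turnstile> A \<^bold>: TUniv k" and B: "\<Gamma> \<turnstile> B \<^bold>: TUniv k" and h: "\<Gamma> \<turnstile> h \<^bold>: arr (TTrunc A) B"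
  shows "inh \<Gamma> (coh_ty A B (restrict_fun A h) (restrict_const A B h))"
proof -
  have w1: "wf_ctx (A # \<Gamma>)" using A by (rule ctx_extend)
  have w2: "wf_ctx (A \<Up> 1 # A # \<Gamma>)" by (rule ctx_extend weak_univ A w1)+
  have w3: "wf_ctx (A \<Up> 2 # A \<Up> 1 # A # \<Gamma>)"
      by (rule ctx_extend weak_ty(2)[OF A w2] | simp only: sub.simps)+
  let ?G = "A \<Up> 2 # A \<Up> 1 # A # \<Gamma>"
  have v: "?G \<turnstile> A \<Up> 3 \<^bold>: TUniv k" "?G \<turnstile> B \<Up> 3 \<^bold>: TUniv k"
      "?G \<turnstile> h \<Up> 3 \<^bold>: arr (TTrunc (A \<Up> 3)) (B \<Up> 3)"
    "?G \<turnstile> Var 2 \<^bold>: A \<Up> 3" "?G \<turnstile> Var 1 \<^bold>: A \<Up> 3" "?G \<turnstile> Var 0 \<^bold>: A \<Up> 3"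
    by (rule weak_ty(3)[OF A] weak_ty(3)[OF B] weak_ty(3)[OF h] var_ty w3 | simp)+
  let ?f = "restrict_fun (A \<Up> 3) (h \<Up> 3)" and ?c = "restrict_const (A \<Up> 3) (B \<Up> 3) (h \<Up> 3)"
  have "ideq ?G (TId (B \<Up> 3) (?f $ Var 2) (?f $ Var 0))
      (concat_path (B \<Up> 3) (?f $ Var 2) (?f $ Var 1) (?f $ Var 0)
       (?c $ Var 2 $ Var 1) (?c $ Var 1 $ Var 0)) (?c $ Var 2 $ Var 0)"
    by (rule trunc_path_concat_conv[OF v(1-3)])
      (rule ty_trunc_in restrict_fun_ty(2)[OF v(1,3)] restrict_const_ty(2)[OF v(1-3)] v
        arr_app_ty[OF restrict_fun_ty(1)[OF v(1,3)]])+
  then show ?thesis unfolding coh_ty_def' by simp (intro inh_lam)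
qed

text \<open>The constancy proof is read off from the pair \<open>w\<close> by a projection.
  \<open>fst_pair\<close> returns the term put into the pair, so the computation rules stay
  judgemental.\<close>

lemma restriction_exists:
  assumes D: "groupoid_pair \<Gamma> k A B" and h: "\<Gamma> \<turnstile> h \<^bold>: arr (TTrunc A) B"
  obtains f w where "\<Gamma> \<turnstile> f \<^bold>: arr A B" "\<Gamma> \<turnstile> w \<^bold>: coherence A B f"
      "restricts \<Gamma> A B h f (const_of A B f w)"
proof -
  let ?f = restrict_fun and ?c = restrict_const
  have *: "\<Gamma> \<turnstile> TPair (?c A B h) q \<^bold>: coherence A B (?f A h)"
      "\<Gamma> \<turnstile> const_of A B (?f A h) (TPair (?c A B h) q) \<^bold>\<equiv> ?c A B h \<^bold>: const_ty A B (?f A h)"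
    if D: "groupoid_pair \<Gamma> k A B" and h: "\<Gamma> \<turnstile> h \<^bold>: arr (TTrunc A) B"
      and q: "\<Gamma> \<turnstile> q \<^bold>: coh_ty A B (?f A h) (?c A B h)" for \<Gamma> A B h q
  proof -
    note d = groupoid_pairD[OF D]
    note f = restrict_fun_ty(1)[OF d(1) h] and c = restrict_const_ty(1)[OF d(1,2) h]
    note C = const_ty_ty(1)[OF d(1,2) f] and K = coh_var_ty(1)[OF D f]
    have q': "\<Gamma> \<turnstile> q \<^bold>: inst (coh_ty (A \<Up> 1) (B \<Up> 1) (?f A h \<Up> 1) (Var 0)) (?c A B h)" using q
        by simp
    show "\<Gamma> \<turnstile> TPair (?c A B h) q \<^bold>: coherence A B (?f A h)"
      unfolding coherence_def by (rule ty_pair[OF K c q'])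
    show "\<Gamma> \<turnstile> const_of A B (?f A h) (TPair (?c A B h) q) \<^bold>\<equiv> ?c A B h \<^bold>: const_ty A B (?f A h)"
      by (rule fst_pair[OF C K c q'])
  qed
  note d = groupoid_pairD[OF D]
  obtain q where q: "\<Gamma> \<turnstile> q \<^bold>: coh_ty A B (?f A h) (?c A B h)" using restrict_coh[OF d(1,2) h]
      by (rule inhE)
  have w1: "wf_ctx (A # \<Gamma>)" using d(1) by (rule ctx_extend)
  have w2: "wf_ctx (A \<Up> 1 # A # \<Gamma>)" by (rule ctx_extend weak_univ d w1)+
  let ?G = "A \<Up> 1 # A # \<Gamma>"
  have v1: "A # \<Gamma> \<turnstile> A \<Up> 1 \<^bold>: TUniv k" "A # \<Gamma> \<turnstile> h \<Up> 1 \<^bold>: arr (TTrunc (A \<Up> 1)) (B \<Up> 1)"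
      "A # \<Gamma> \<turnstile> Var 0 \<^bold>: A \<Up> 1"
    by (rule weak_univ d weak_ty(1)[OF h] var_ty w1 | simp)+
  note D2 = groupoid_pair_weak(2)[OF D w2]
  have v2: "?G \<turnstile> h \<Up> 2 \<^bold>: arr (TTrunc (A \<Up> 2)) (B \<Up> 2)" "?G \<turnstile> Var 1 \<^bold>: A \<Up> 2" "?G \<turnstile> Var 0 \<^bold>: A \<Up> 2"
    "?G \<turnstile> q \<Up> 2 \<^bold>: coh_ty (A \<Up> 2) (B \<Up> 2) (?f (A \<Up> 2) (h \<Up> 2)) (?c (A \<Up> 2) (B \<Up> 2) (h \<Up> 2))"
    by (rule weak_ty(2)[OF h] weak_ty(2)[OF q] var_ty w2 | simp)+
  note d2 = groupoid_pairD[OF D2]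
  have "?G \<turnstile> const_of (A \<Up> 2) (B \<Up> 2) (?f (A \<Up> 2) (h \<Up> 2))
      (TPair (?c (A \<Up> 2) (B \<Up> 2) (h \<Up> 2)) (q \<Up> 2)) $ Var 1 \<^bold>\<equiv> ?c (A \<Up> 2) (B \<Up> 2) (h \<Up> 2) $ Var 1 \<^bold>:
     TPi (A \<Up> 2) (TId (B \<Up> 3) (?f (A \<Up> 3) (h \<Up> 3) $ Var 2) (?f (A \<Up> 3) (h \<Up> 3) $ Var 0))"
    using cong_app[OF *(2)[OF D2 v2(1,4), unfolded const_ty_def'] eq_refl[OF v2(2)]]
        by (simp add: const_ty_def')
  from cong_app[OF this eq_refl[OF v2(3)]]
  have "?G \<turnstile> const_of (A \<Up> 2) (B \<Up> 2) (?f (A \<Up> 2) (h \<Up> 2))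
      (TPair (?c (A \<Up> 2) (B \<Up> 2) (h \<Up> 2)) (q \<Up> 2)) $ Var 1 $ Var 0 \<^bold>\<equiv>
     ?c (A \<Up> 2) (B \<Up> 2) (h \<Up> 2) $ Var 1 $ Var 0 \<^bold>: TId (B \<Up> 2) (?f (A \<Up> 2) (h \<Up> 2) $ Var 1)
         (?f (A \<Up> 2) (h \<Up> 2) $ Var 0)"
    by simp
  from eq_trans[OF this restrict_const_ty(2)[OF d2(1,2) v2(1-3)]]
  have "restricts \<Gamma> A B h (?f A h) (const_of A B (?f A h) (TPair (?c A B h) q))"
    using restrict_fun_ty(2)[OF v1] by (simp add: restricts_def)
  then show ?thesis by (rule that[OF restrict_fun_ty(1)[OF d(1) h] *(1)[OF D h q]])
qed

text \<open>The leg at \<open>a\<close> over \<open>x\<close> is \<open>ap h\<close> along the path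
  from \<open>|a|\<close> to \<open>x\<close> that the truncation provides. The cocone condition is
  again the composition law \<open>trunc_path_concat\<close>.\<close>

lemma restriction_extends:
  assumes D: "coherent_map \<Gamma> k A B f c" and h: "\<Gamma> \<turnstile> h \<^bold>: arr (TTrunc A) B"
      and r: "restricts \<Gamma> A B h f c"
  shows "inh \<Gamma> (extends A B f c h)"
proof -
  let ?p = "\<lambda>A B h x. TLam A (trunc_path (B \<Up> 1) (h \<Up> 1) (TTruncIn (Var 0)) (x \<Up> 1))"
  have p: "\<Gamma> \<turnstile> ?p A B h x \<^bold>: leg A B f (h $ x)"
    "\<And>a. \<Gamma> \<turnstile> a \<^bold>: A \<Longrightarrow> \<Gamma> \<turnstile> ?p A B h x $ a \<^bold>\<equiv> trunc_path B h (TTruncIn a) x \<^bold>: TId B (f $ a) (h $ x)"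
    if D: "coherent_map \<Gamma> k A B f c" and h: "\<Gamma> \<turnstile> h \<^bold>: arr (TTrunc A) B"
        and r: "restricts \<Gamma> A B h f c"
    and x: "\<Gamma> \<turnstile> x \<^bold>: TTrunc A" for \<Gamma> A B f c h x
  proof -
    note d = coherent_mapD[OF D]
    have w: "wf_ctx (A # \<Gamma>)" using d(1) by (rule ctx_extend)
    note d1 = coherent_mapD[OF coherent_map_weak(1)[OF D w]]
    have v: "A # \<Gamma> \<turnstile> h \<Up> 1 \<^bold>: arr (TTrunc (A \<Up> 1)) (B \<Up> 1)" "A # \<Gamma> \<turnstile> x \<Up> 1 \<^bold>: TTrunc (A \<Up> 1)"
        "A # \<Gamma> \<turnstile> Var 0 \<^bold>: A \<Up> 1"
      by (rule weak_ty(1)[OF h] weak_ty(1)[OF x] var_ty w | simp)+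
    have hx: "A # \<Gamma> \<turnstile> h \<Up> 1 $ x \<Up> 1 \<^bold>: B \<Up> 1" by (rule arr_app_ty v)+
    have e: "A # \<Gamma> \<turnstile> TId (B \<Up> 1) (h \<Up> 1 $ TTruncIn (Var 0)) (h \<Up> 1 $ x \<Up> 1) \<^bold>\<equiv>
       TId (B \<Up> 1) (f \<Up> 1 $ Var 0) (h \<Up> 1 $ x \<Up> 1) \<^bold>: TUniv k"
      by (rule cong_id[OF eq_refl[OF d1(2)]
          eq_sym[OF restricts_app(1)[OF r subst_ok_sh(1)[OF w] v(3)]] eq_refl[OF hx]])
    have *: "A # \<Gamma> \<turnstile> trunc_path (B \<Up> 1) (h \<Up> 1) (TTruncIn (Var 0)) (x \<Up> 1) \<^bold>: TId (B \<Up> 1)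
        (f \<Up> 1 $ Var 0) (h \<Up> 1 $ x \<Up> 1)"
      by (rule ty_conv[OF trunc_path_ty[OF d1(1,2) v(1) ty_trunc_in[OF v(3)] v(2)] e])
    show "\<Gamma> \<turnstile> ?p A B h x \<^bold>: leg A B f (h $ x)" using ty_lam[OF *] by (simp add: leg_def)
    show "\<Gamma> \<turnstile> ?p A B h x $ a \<^bold>\<equiv> trunc_path B h (TTruncIn a) x \<^bold>: TId B (f $ a) (h $ x)"
        if "\<Gamma> \<turnstile> a \<^bold>: A" for a
      by (rule beta_pi_eq[OF * that]) simp_all
  qed
  have coc: "inh \<Gamma> (cocone A B f c (h $ x))"
    if D: "coherent_map \<Gamma> k A B f c" and h: "\<Gamma> \<turnstile> h \<^bold>: arr (TTrunc A) B"
        and r: "restricts \<Gamma> A B h f c"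
    and x: "\<Gamma> \<turnstile> x \<^bold>: TTrunc A" for \<Gamma> A B f c h x
  proof -
    note d = coherent_mapD[OF D]
    have w1: "wf_ctx (A # \<Gamma>)" using d(1) by (rule ctx_extend)
    have w2: "wf_ctx (A \<Up> 1 # A # \<Gamma>)" by (rule ctx_extend weak_univ d w1)+
    let ?G = "A \<Up> 1 # A # \<Gamma>"
    note D2 = coherent_map_weak(2)[OF D w2]
    note d2 = coherent_mapD[OF D2]
    note r2 = restricts_sub[OF r subst_ok_sh(2)[OF w2] d2(1)]
    have v: "?G \<turnstile> h \<Up> 2 \<^bold>: arr (TTrunc (A \<Up> 2)) (B \<Up> 2)" "?G \<turnstile> x \<Up> 2 \<^bold>: TTrunc (A \<Up> 2)"
        "?G \<turnstile> Var 1 \<^bold>: A \<Up> 2" "?G \<turnstile> Var 0 \<^bold>: A \<Up> 2"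
      by (rule weak_ty(2)[OF h] weak_ty(2)[OF x] var_ty w2 | simp)+
    have hx: "?G \<turnstile> h \<Up> 2 $ x \<Up> 2 \<^bold>: B \<Up> 2" by (rule arr_app_ty v)+
    note p2 = p(2)[OF D2 v(1) r2 v(2)]
    have "ideq ?G (TId (B \<Up> 2) (f \<Up> 2 $ Var 1) (h \<Up> 2 $ x \<Up> 2))
        (concat_path (B \<Up> 2) (f \<Up> 2 $ Var 1) (f \<Up> 2 $ Var 0) (h \<Up> 2 $ x \<Up> 2)
        (c \<Up> 2 $ Var 1 $ Var 0) (?p (A \<Up> 2) (B \<Up> 2) (h \<Up> 2) (x \<Up> 2) $ Var 0))
            (?p (A \<Up> 2) (B \<Up> 2) (h \<Up> 2) (x \<Up> 2) $ Var 1)"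
      by (rule trunc_path_concat_conv[OF d2(1,2) v(1) ty_trunc_in[OF v(3)] ty_trunc_in[OF v(4)] v(2)
          hx])
         (rule restricts_app'[OF r2] eq_refl[OF hx] p2 v)+
    then have "inh \<Gamma> (leg_coh A B f c (h $ x) (?p A B h x))"
      unfolding leg_coh_def by (intro inh_lam) simp
    then obtain q where "\<Gamma> \<turnstile> q \<^bold>: leg_coh A B f c (h $ x) (?p A B h x)" by (rule inhE)
    then have q: "\<Gamma> \<turnstile> q \<^bold>: inst (leg_coh (A \<Up> 1) (B \<Up> 1) (f \<Up> 1) (c \<Up> 1) ((h $ x) \<Up> 1) (Var 0))
        (?p A B h x)"
      by simp
    have "\<Gamma> \<turnstile> TPair (?p A B h x) q \<^bold>: cocone A B f c (h $ x)"
      unfolding cocone_def by (rule ty_pair[OF leg_coh_var_ty(1)[OF D arr_app_ty[OF h x]]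
          p(1)[OF D h r x] q])
    then show ?thesis by (rule inhI)
  qed
  note d = coherent_mapD[OF D]
  have T: "\<Gamma> \<turnstile> TTrunc A \<^bold>: TUniv k" by (rule ty_trunc d)+
  have w: "wf_ctx (TTrunc A # \<Gamma>)" using T by (rule ctx_extend)
  note D1 = coherent_map_weak(1)[OF D w]
  have v: "TTrunc A # \<Gamma> \<turnstile> h \<Up> 1 \<^bold>: arr (TTrunc (A \<Up> 1)) (B \<Up> 1)"
      "TTrunc A # \<Gamma> \<turnstile> Var 0 \<^bold>: TTrunc (A \<Up> 1)"
    by (rule weak_ty(1)[OF h] var_ty w | simp)+
  show ?thesis
    unfolding extends_def
    by (rule inh_lam[OF coc[OF D1 v(1)
        restricts_sub[OF r subst_ok_sh(1)[OF w] coherent_mapD(1)[OF D1]] v(2)]])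
qed

section \<open>Comparing a coherent map with the restriction of its extension\<close>

definition reach :: "tm \<Rightarrow> tm \<Rightarrow> tm \<Rightarrow> tm \<Rightarrow> tm \<Rightarrow> tm \<Rightarrow> tm \<Rightarrow> tm" where
  "reach A B f h E x a = fst_tm (leg A B f (h $ x)) (E $ x) $ a"

lemma sub_reach [simp]:
  "sub \<sigma> (reach A B f h E x a) = reach (sub \<sigma> A) (sub \<sigma> B) (sub \<sigma> f) (sub \<sigma> h) (sub \<sigma> E) (sub \<sigma> x)
      (sub \<sigma> a)"
  by (simp add: reach_def)

lemma extends_app_ty: "\<Gamma> \<turnstile> E \<^bold>: extends A B f c h \<Longrightarrow> \<Gamma> \<turnstile> x \<^bold>: TTrunc A \<Longrightarrow> \<Gamma> \<turnstile> E $ x \<^bold>: cocone A B f c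
    (h $ x)"
  unfolding extends_def by (erule app_ty) simp_all

lemma reach_ty:
  assumes D: "coherent_map \<Gamma> k A B f c" and h: "\<Gamma> \<turnstile> h \<^bold>: arr (TTrunc A) B"
      and E: "\<Gamma> \<turnstile> E \<^bold>: extends A B f c h"
    and x: "\<Gamma> \<turnstile> x \<^bold>: TTrunc A" and a: "\<Gamma> \<turnstile> a \<^bold>: A"
  shows "\<Gamma> \<turnstile> reach A B f h E x a \<^bold>: TId B (f $ a) (h $ x)"
  unfolding reach_def
  by (rule leg_app_ty[OF cocone_fst_ty(1)[OF D arr_app_ty[OF h x] extends_app_ty[OF E x]] a])

text \<open>Path induction on a path from \<open>x\<close> to a free endpoint. At reflexivity the
  right-hand side is the leg at \<open>a\<close> by the unit law, and the claim is the cocone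
  condition over \<open>x\<close>.\<close>

lemma reach_natural:
  assumes D: "coherent_map \<Gamma> k A B f c" and h: "\<Gamma> \<turnstile> h \<^bold>: arr (TTrunc A) B"
      and E: "\<Gamma> \<turnstile> E \<^bold>: extends A B f c h"
    and x: "\<Gamma> \<turnstile> x \<^bold>: TTrunc A" and y: "\<Gamma> \<turnstile> y \<^bold>: TTrunc A" and a: "\<Gamma> \<turnstile> a \<^bold>: A" and b: "\<Gamma> \<turnstile> b \<^bold>: A"
  shows "ideq \<Gamma> (TId B (f $ a) (h $ y))
      (concat_path B (f $ a) (f $ b) (h $ y) (c $ a $ b) (reach A B f h E y b))
      (concat_path B (f $ a) (h $ x) (h $ y) (reach A B f h E x a) (trunc_path B h x y))"
proof -
  note d = coherent_mapD[OF D]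
  let ?X = "TTrunc A"
  let ?G = "TId (?X \<Up> 1) (x \<Up> 1) (Var 0) # ?X # \<Gamma>"
  let ?C = "TId (TId (B \<Up> 2) (f \<Up> 2 $ a \<Up> 2) (h \<Up> 2 $ Var 1))
     (concat_path (B \<Up> 2) (f \<Up> 2 $ a \<Up> 2) (f \<Up> 2 $ b \<Up> 2) (h \<Up> 2 $ Var 1)
        (c \<Up> 2 $ a \<Up> 2 $ b \<Up> 2) (reach (A \<Up> 2) (B \<Up> 2) (f \<Up> 2) (h \<Up> 2) (E \<Up> 2) (Var 1) (b \<Up> 2)))
     (concat_path (B \<Up> 2) (f \<Up> 2 $ a \<Up> 2) (h \<Up> 2 $ x \<Up> 2) (h \<Up> 2 $ Var 1)
        (reach (A \<Up> 2) (B \<Up> 2) (f \<Up> 2) (h \<Up> 2) (E \<Up> 2) (x \<Up> 2) (a \<Up> 2))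
            (ap_tm (B \<Up> 2) (h \<Up> 2) (x \<Up> 2) (Var 1) (Var 0)))"
  have X: "\<Gamma> \<turnstile> ?X \<^bold>: TUniv k" by (rule ty_trunc d)+
  have w1: "wf_ctx (?X # \<Gamma>)" using X by (rule ctx_extend)
  have w2: "wf_ctx ?G" by (rule ctx_extend ty_id weak_univ X weak_ty(1)[OF x] w1 var_ty refl)+
  note D2 = coherent_map_weak(2)[OF D w2]
  note d2 = coherent_mapD[OF D2]
  have v: "?G \<turnstile> h \<Up> 2 \<^bold>: arr (TTrunc (A \<Up> 2)) (B \<Up> 2)"
    "?G \<turnstile> E \<Up> 2 \<^bold>: extends (A \<Up> 2) (B \<Up> 2) (f \<Up> 2) (c \<Up> 2) (h \<Up> 2)"
    "?G \<turnstile> x \<Up> 2 \<^bold>: TTrunc (A \<Up> 2)" "?G \<turnstile> Var 1 \<^bold>: TTrunc (A \<Up> 2)"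
    "?G \<turnstile> Var 0 \<^bold>: TId (TTrunc (A \<Up> 2)) (x \<Up> 2) (Var 1)" "?G \<turnstile> a \<Up> 2 \<^bold>: A \<Up> 2" "?G \<turnstile> b \<Up> 2 \<^bold>: A \<Up> 2"
    by (rule weak_ty(2)[OF h] weak_ty(2)[OF E] weak_ty(2)[OF x] weak_ty(2)[OF a] weak_ty(2)[OF b]
        var_ty w2 | simp)+
  have X2: "?G \<turnstile> TTrunc (A \<Up> 2) \<^bold>: TUniv k" by (rule ty_trunc d2)+
  have C: "?G \<turnstile> ?C \<^bold>: TUniv k"
    by (rule ty_id concat_ty const_app_ty reach_ty[OF D2 v(1,2)] ap_tm_ty[OF X2 d2(2) v(1)]
        arr_app_ty[OF v(1)] arr_app_ty[OF d2(4)] d2(2,5) v)+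
  have fa: "\<Gamma> \<turnstile> f $ a \<^bold>: B" and fb: "\<Gamma> \<turnstile> f $ b \<^bold>: B" and hx: "\<Gamma> \<turnstile> h $ x \<^bold>: B"
      by (rule arr_app_ty d h x a b)+
  note r = reach_ty[OF D h E x a] reach_ty[OF D h E x b] and cab = const_app_ty[OF d(5) a b]
  have T: "\<Gamma> \<turnstile> TId B (f $ a) (h $ x) \<^bold>: TUniv k" by (rule ty_id d fa hx)+
  let ?l = "concat_path B (f $ a) (f $ b) (h $ x) (c $ a $ b) (reach A B f h E x b)"
  let ?m = "concat_path B (f $ a) (h $ x) (h $ x) (reach A B f h E x a) (TRefl (h $ x))"
  have l: "\<Gamma> \<turnstile> ?l \<^bold>: TId B (f $ a) (h $ x)" and m: "\<Gamma> \<turnstile> ?m \<^bold>: TId B (f $ a) (h $ x)"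
    by (rule concat_ty ty_refl d fa fb hx r cab)+
  have "ideq \<Gamma> (TId B (f $ a) (h $ x)) ?l ?m"
    using id_trans[OF T l r(1) m leg_coh_app[OF cocone_fst_ty(2)[OF D hx extends_app_ty[OF E x]] a
        b, folded reach_def]
      id_sym[OF T m r(1) concat_refl_right[OF d(2) fa hx r(1)]]] .
  then have "ideq \<Gamma> (TId B (f $ a) (h $ x)) ?l
      (concat_path B (f $ a) (h $ x) (h $ x) (reach A B f h E x a) (ap_tm B h x x (TRefl x)))"
    by (rule id_conv[OF _ T eq_refl[OF l]
        concat_cong[OF d(2) hx eq_refl[OF fa] eq_refl[OF hx] eq_refl[OF hx] eq_refl[OF r(1)]
        eq_sym[OF ap_tm_ty(2)[OF X d(2) h x]]]])
  then have "inh \<Gamma> (sub (TRefl x \<bullet> x \<bullet> Var) ?C)" by simp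
  from based_J[OF X x C this y ty_trunc_eq[OF x y]] show ?thesis by (simp add: trunc_path_def)
qed

text \<open>The homotopy at \<open>a\<close> is the leg at \<open>a\<close> of the cocone over
  \<open>|a|\<close>: it ends in \<open>h |a|\<close>, which is \<open>g a\<close> judgementally.
  Its naturality is \<open>reach_natural\<close> at \<open>|a|\<close> and \<open>|b|\<close>, where
  \<open>trunc_path\<close> is the constancy proof of the restriction.\<close>

lemma restriction_unique:
  assumes D: "groupoid_pair \<Gamma> k A B" and h: "\<Gamma> \<turnstile> h \<^bold>: arr (TTrunc A) B"
    and f: "\<Gamma> \<turnstile> f \<^bold>: arr A B" and w: "\<Gamma> \<turnstile> w \<^bold>: coherence A B f"
    and E: "inh \<Gamma> (extends A B f (const_of A B f w) h)"
    and g: "\<Gamma> \<turnstile> g \<^bold>: arr A B" and u: "\<Gamma> \<turnstile> u \<^bold>: coherence A B g"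
    and r: "restricts \<Gamma> A B h g (const_of A B g u)"
  shows "ideq \<Gamma> (coherent_maps A B) (TPair f w) (TPair g u)"
proof -
  let ?P = "\<lambda>A B f h E. TLam A (reach (A \<Up> 1) (B \<Up> 1) (f \<Up> 1) (h \<Up> 1) (E \<Up> 1) (TTruncIn (Var 0))
      (Var 0))"
  have P: "\<Gamma> \<turnstile> ?P A B f h E \<^bold>: homotopy A (B \<Up> 1) f g"
    "\<And>a. \<Gamma> \<turnstile> a \<^bold>: A \<Longrightarrow> \<Gamma> \<turnstile> ?P A B f h E $ a \<^bold>\<equiv> reach A B f h E (TTruncIn a) a \<^bold>: TId B (f $ a)
        (g $ a)"
    if D: "coherent_map \<Gamma> k A B f c" and h: "\<Gamma> \<turnstile> h \<^bold>: arr (TTrunc A) B"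
        and E: "\<Gamma> \<turnstile> E \<^bold>: extends A B f c h"
      and r: "restricts \<Gamma> A B h g d" for \<Gamma> A B f c h E g d
  proof -
    note d = coherent_mapD[OF D]
    have w: "wf_ctx (A # \<Gamma>)" using d(1) by (rule ctx_extend)
    note D1 = coherent_map_weak(1)[OF D w]
    note d1 = coherent_mapD[OF D1]
    have v: "A # \<Gamma> \<turnstile> h \<Up> 1 \<^bold>: arr (TTrunc (A \<Up> 1)) (B \<Up> 1)"
      "A # \<Gamma> \<turnstile> E \<Up> 1 \<^bold>: extends (A \<Up> 1) (B \<Up> 1) (f \<Up> 1) (c \<Up> 1) (h \<Up> 1)" "A # \<Gamma> \<turnstile> Var 0 \<^bold>: A \<Up> 1"
      by (rule weak_ty(1)[OF h] weak_ty(1)[OF E] var_ty w | simp)+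
    have f0: "A # \<Gamma> \<turnstile> f \<Up> 1 $ Var 0 \<^bold>: B \<Up> 1" by (rule arr_app_ty d1 v)+
    have *: "A # \<Gamma> \<turnstile> reach (A \<Up> 1) (B \<Up> 1) (f \<Up> 1) (h \<Up> 1) (E \<Up> 1) (TTruncIn (Var 0)) (Var 0) \<^bold>:
       TId (B \<Up> 1) (f \<Up> 1 $ Var 0) (g \<Up> 1 $ Var 0)"
      by (rule ty_conv[OF reach_ty[OF D1 v(1,2) ty_trunc_in[OF v(3)] v(3)]
            cong_id[OF eq_refl[OF d1(2)] eq_refl[OF f0]
                eq_sym[OF restricts_app(1)[OF r subst_ok_sh(1)[OF w] v(3)]]]])
    show "\<Gamma> \<turnstile> ?P A B f h E \<^bold>: homotopy A (B \<Up> 1) f g" unfolding homotopy_def' using *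
        by (rule ty_lam)
    show "\<Gamma> \<turnstile> ?P A B f h E $ a \<^bold>\<equiv> reach A B f h E (TTruncIn a) a \<^bold>: TId B (f $ a) (g $ a)"
        if "\<Gamma> \<turnstile> a \<^bold>: A" for a
      by (rule beta_pi_eq[OF * that]) simp_all
  qed
  have nat: "ideq \<Gamma> (TId B (f $ a) (g $ b))
      (concat_path B (f $ a) (f $ b) (g $ b) (c $ a $ b) (?P A B f h E $ b))
      (concat_path B (f $ a) (g $ a) (g $ b) (?P A B f h E $ a) (d $ a $ b))"
    if D: "coherent_map \<Gamma> k A B f c" and h: "\<Gamma> \<turnstile> h \<^bold>: arr (TTrunc A) B"
        and E: "\<Gamma> \<turnstile> E \<^bold>: extends A B f c h"
      and r: "restricts \<Gamma> A B h g d" and g: "\<Gamma> \<turnstile> g \<^bold>: arr A B"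
      and a: "\<Gamma> \<turnstile> a \<^bold>: A" and b: "\<Gamma> \<turnstile> b \<^bold>: A" for \<Gamma> A B f c h E g d a b
  proof -
    note e = coherent_mapD[OF D]
    have fg: "\<Gamma> \<turnstile> f $ a \<^bold>: B" "\<Gamma> \<turnstile> f $ b \<^bold>: B" "\<Gamma> \<turnstile> g $ b \<^bold>: B" by (rule arr_app_ty e g a b)+
    note ga = restricts_app'(1)[OF r a] and gb = restricts_app'(1)[OF r b]
        and dab = restricts_app'(2)[OF r a b]
    note Pa = P(2)[OF D h E r a] and Pb = P(2)[OF D h E r b] and cab = const_app_ty[OF e(5) a b]
    show ?thesis
      by (rule inh_conv[OF reach_natural[OF D h E ty_trunc_in[OF a] ty_trunc_in[OF b] a b]
            eq_sym[OF cong_id[OF cong_id[OF eq_refl[OF e(2)] eq_refl[OF fg(1)] gb]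
              concat_cong[OF e(2) fg(3) eq_refl[OF fg(1)] eq_refl[OF fg(2)] gb eq_refl[OF cab] Pb]
              concat_cong[OF e(2) fg(3) eq_refl[OF fg(1)] ga gb Pa dab]]]])
  qed
  obtain E where E: "\<Gamma> \<turnstile> E \<^bold>: extends A B f (const_of A B f w) h" using E by (rule inhE)
  note M = coherence_fst(2)[OF D f w]
  note d = groupoid_pairD[OF D]
  have w1: "wf_ctx (A # \<Gamma>)" using d(1) by (rule ctx_extend)
  have w2: "wf_ctx (A \<Up> 1 # A # \<Gamma>)" by (rule ctx_extend weak_univ d w1)+
  let ?G = "A \<Up> 1 # A # \<Gamma>"
  note M2 = coherent_map_weak(2)[OF M w2]
  note r2 = restricts_sub[OF r subst_ok_sh(2)[OF w2] coherent_mapD(1)[OF M2]]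
  have v: "?G \<turnstile> h \<Up> 2 \<^bold>: arr (TTrunc (A \<Up> 2)) (B \<Up> 2)"
    "?G \<turnstile> E \<Up> 2 \<^bold>: extends (A \<Up> 2) (B \<Up> 2) (f \<Up> 2) (const_of A B f w \<Up> 2) (h \<Up> 2)"
    "?G \<turnstile> g \<Up> 2 \<^bold>: arr (A \<Up> 2) (B \<Up> 2)" "?G \<turnstile> Var 1 \<^bold>: A \<Up> 2" "?G \<turnstile> Var 0 \<^bold>: A \<Up> 2"
    by (rule weak_ty(2)[OF h] weak_ty(2)[OF E] weak_ty(2)[OF g] var_ty w2 | simp)+
  have "inh \<Gamma> (natural A B f (const_of A B f w) g (const_of A B g u) (?P A B f h E))"
    using nat[OF M2 v(1,2) r2 v(3-5)] unfolding natural_def by (intro inh_lam) simp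
  then show ?thesis by (rule coherent_maps_eq[OF D f w g u P(1)[OF M h E r]])
qed

text \<open>With the family abstracted to a \<lambda>-term, the computation rules of the two
  projections enter through the congruence rule for application, and \<beta> returns to instances on
  both sides.\<close>

lemma subst_pair_jeq:
  assumes A: "\<Gamma> \<turnstile> A \<^bold>: TUniv k" and B: "A # \<Gamma> \<turnstile> B \<^bold>: TUniv k" and C: "B # A # \<Gamma> \<turnstile> C \<^bold>: TUniv k"
    and a: "\<Gamma> \<turnstile> a \<^bold>: A" and b: "\<Gamma> \<turnstile> b \<^bold>: inst B a"
  shows "\<Gamma> \<turnstile> sub (snd_tm A B (TPair a b) \<bullet> fst_tm A (TPair a b) \<bullet> Var) C \<^bold>\<equiv> sub (b \<bullet> a \<bullet> Var) C \<^bold>: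
      TUniv k"
proof -
  let ?p = "TPair a b"
  let ?L = "TLam A (TLam B C)"
  have p: "\<Gamma> \<turnstile> ?p \<^bold>: TSigma A B" using B a b by (rule ty_pair)
  have L: "\<Gamma> \<turnstile> ?L \<^bold>: TPi A (TPi B (TUniv k))" by (intro ty_lam C)
  note f = fst_ty[OF A B p] and s = snd_ty[OF A B p]
  have "\<Gamma> \<turnstile> ?L $ a \<^bold>\<equiv> ?L $ fst_tm A ?p \<^bold>: TPi (inst B a) (TUniv k)"
    using cong_app[OF eq_refl[OF L] eq_sym[OF fst_pair[OF A B a b]]] by simp
  from cong_app[OF this eq_sym[OF snd_pair[OF A B a b]]]
  have "\<Gamma> \<turnstile> ?L $ a $ b \<^bold>\<equiv> ?L $ fst_tm A ?p $ snd_tm A B ?p \<^bold>: TUniv k" by simp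
  moreover have "\<Gamma> \<turnstile> ?L $ a $ b \<^bold>\<equiv> sub (b \<bullet> a \<bullet> Var) C \<^bold>: TUniv k"
    "\<Gamma> \<turnstile> ?L $ fst_tm A ?p $ snd_tm A B ?p \<^bold>\<equiv> sub (snd_tm A B ?p \<bullet> fst_tm A ?p \<bullet> Var) C \<^bold>: TUniv k"
    using beta2[OF A B C a b] beta2[OF A B C f s] by simp_all
  ultimately show ?thesis by (meson eq_sym eq_trans)
qed

section \<open>The equivalence\<close>

abbreviation underlying_map :: "tm \<Rightarrow> tm \<Rightarrow> tm \<Rightarrow> tm" where
  "underlying_map A B s \<equiv> fst_tm (arr A B) s"

abbreviation coherence_of :: "tm \<Rightarrow> tm \<Rightarrow> tm \<Rightarrow> tm" where
  "coherence_of A B s \<equiv> snd_tm (arr A B) (coherence (A \<Up> 1) (B \<Up> 1) (Var 0)) s"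

text \<open>The relation from which both directions of the equivalence are chosen. Its argument
  \<open>s\<close> remains unsplit because choice and the inverse laws deal with a variable of type
  \<open>coherent_maps A B\<close>.\<close>

definition ext_rel :: "tm \<Rightarrow> tm \<Rightarrow> tm \<Rightarrow> tm \<Rightarrow> tm" where
  "ext_rel A B h s = extends A B (underlying_map A B s)
      (const_of A B (underlying_map A B s) (coherence_of A B s)) h"

lemma sub_ext_rel [simp]:
  "sub \<sigma> (ext_rel A B h s) = ext_rel (sub \<sigma> A) (sub \<sigma> B) (sub \<sigma> h) (sub \<sigma> s)"
  by (simp add: ext_rel_def)

lemma coherent_maps_parts:
  assumes D: "groupoid_pair \<Gamma> k A B" and s: "\<Gamma> \<turnstile> s \<^bold>: coherent_maps A B"
  shows "\<Gamma> \<turnstile> underlying_map A B s \<^bold>: arr A B"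
      and "\<Gamma> \<turnstile> coherence_of A B s \<^bold>: coherence A B (underlying_map A B s)"
    and "ideq \<Gamma> (coherent_maps A B) (TPair (underlying_map A B s) (coherence_of A B s)) s"
proof -
  have F: "\<Gamma> \<turnstile> arr A B \<^bold>: TUniv k" by (rule arr_ty groupoid_pairD[OF D])+
  note U = coherence_var_ty[OF D]
  note s' = s[unfolded coherent_maps_eq_sigma]
  show "\<Gamma> \<turnstile> underlying_map A B s \<^bold>: arr A B" by (rule fst_ty[OF F U s'])
  show "\<Gamma> \<turnstile> coherence_of A B s \<^bold>: coherence A B (underlying_map A B s)" using snd_ty[OF F U s']
      by simp
  show "ideq \<Gamma> (coherent_maps A B) (TPair (underlying_map A B s) (coherence_of A B s)) s"
    using pair_eta[OF F U s'] by (simp add: coherent_maps_eq_sigma)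
qed

lemma ext_rel_ty:
  assumes D: "groupoid_pair \<Gamma> k A B" and h: "\<Gamma> \<turnstile> h \<^bold>: arr (TTrunc A) B"
      and s: "\<Gamma> \<turnstile> s \<^bold>: coherent_maps A B"
  shows "\<Gamma> \<turnstile> ext_rel A B h s \<^bold>: TUniv k"
  unfolding ext_rel_def
  by (rule extends_ty[OF coherence_fst(2)[OF D coherent_maps_parts(1,2)[OF D s]] h])

text \<open>\<open>ext_rel\<close> inspects its argument through projections; on a pair,
  \<open>subst_pair_jeq\<close> computes them.\<close>

lemma ext_rel_pair:
  assumes D: "groupoid_pair \<Gamma> k A B" and h: "\<Gamma> \<turnstile> h \<^bold>: arr (TTrunc A) B"
    and f: "\<Gamma> \<turnstile> f \<^bold>: arr A B" and w: "\<Gamma> \<turnstile> w \<^bold>: coherence A B f"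
    and e: "inh \<Gamma> (extends A B f (const_of A B f w) h)"
  shows "inh \<Gamma> (ext_rel A B h (TPair f w))"
proof -
  have F: "\<Gamma> \<turnstile> arr A B \<^bold>: TUniv k" by (rule arr_ty groupoid_pairD[OF D])+
  note U = coherence_var_ty[OF D]
  let ?G = "coherence (A \<Up> 1) (B \<Up> 1) (Var 0) # arr A B # \<Gamma>"
  have w2: "wf_ctx ?G" using U by (rule ctx_extend)
  note D2 = groupoid_pair_weak(2)[OF D w2]
  have v: "?G \<turnstile> Var 1 \<^bold>: arr (A \<Up> 2) (B \<Up> 2)" "?G \<turnstile> Var 0 \<^bold>: coherence (A \<Up> 2) (B \<Up> 2) (Var 1)"
    "?G \<turnstile> h \<Up> 2 \<^bold>: arr (TTrunc (A \<Up> 2)) (B \<Up> 2)"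
    by (rule weak_ty(2)[OF h] var_ty w2 | simp)+
  note C = extends_ty[OF coherence_fst(2)[OF D2 v(1,2)] v(3)]
  have w': "\<Gamma> \<turnstile> w \<^bold>: inst (coherence (A \<Up> 1) (B \<Up> 1) (Var 0)) f" using w by simp
  show ?thesis
    using inh_conv[OF _ eq_sym[OF subst_pair_jeq[OF F U C f w']]] e by (simp add: ext_rel_def)
qed

text \<open>Both coherent maps are equal to the restriction of \<open>h\<close>.\<close>

lemma ext_rel_map_unique:
  assumes D: "groupoid_pair \<Gamma> k A B" and h: "\<Gamma> \<turnstile> h \<^bold>: arr (TTrunc A) B"
    and s: "\<Gamma> \<turnstile> s \<^bold>: coherent_maps A B" and t: "\<Gamma> \<turnstile> t \<^bold>: coherent_maps A B"
    and es: "inh \<Gamma> (ext_rel A B h s)" and et: "inh \<Gamma> (ext_rel A B h t)"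
  shows "ideq \<Gamma> (coherent_maps A B) s t"
proof -
  obtain f w where r: "\<Gamma> \<turnstile> f \<^bold>: arr A B" "\<Gamma> \<turnstile> w \<^bold>: coherence A B f"
      "restricts \<Gamma> A B h f (const_of A B f w)"
    using restriction_exists[OF D h] .
  note S = coherent_maps_ty[OF D]
  note p = coherent_pair_ty[OF D r(1,2)]
  have *: "ideq \<Gamma> (coherent_maps A B) s (TPair f w)"
    if s: "\<Gamma> \<turnstile> s \<^bold>: coherent_maps A B" and e: "inh \<Gamma> (ext_rel A B h s)" for s
  proof -
    note c = coherent_maps_parts[OF D s]
    note q = coherent_pair_ty[OF D c(1,2)]
    show ?thesis
      by (rule id_trans[OF S s q p id_sym[OF S q s c(3)]
          restriction_unique[OF D h c(1,2) e[unfolded ext_rel_def] r]])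
  qed
  show ?thesis by (rule id_trans[OF S s p t *[OF s es] id_sym[OF S t p *[OF t et]]])
qed

theorem trunc_coherent_maps_equiv:
  assumes D: "groupoid_pair \<Gamma> k A B"
  shows "inh \<Gamma> (equiv_ty (arr (TTrunc A) B) (coherent_maps A B))"
proof -
  let ?H = "arr (TTrunc A) B" and ?S = "coherent_maps A B"
  note d = groupoid_pairD[OF D]
  have H: "\<Gamma> \<turnstile> ?H \<^bold>: TUniv k" by (rule arr_ty ty_trunc d)+
  have S: "\<Gamma> \<turnstile> ?S \<^bold>: TUniv k" by (rule coherent_maps_ty[OF D])
  have wH: "wf_ctx (?H # \<Gamma>)" and wS: "wf_ctx (?S # \<Gamma>)" by (rule ctx_extend H S)+
  have wSH: "wf_ctx (?S \<Up> 1 # ?H # \<Gamma>)" and wHS: "wf_ctx (?H \<Up> 1 # ?S # \<Gamma>)"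
      by (rule ctx_extend weak_univ H S wH wS)+
  note DH = groupoid_pair_weak(1)[OF D wH] and DS = groupoid_pair_weak(1)[OF D wS]
  have vH: "?H # \<Gamma> \<turnstile> Var 0 \<^bold>: arr (TTrunc (A \<Up> 1)) (B \<Up> 1)" by (rule var_ty wH | simp)+
  have vS: "?S # \<Gamma> \<turnstile> Var 0 \<^bold>: coherent_maps (A \<Up> 1) (B \<Up> 1)" by (rule var_ty wS | simp)+
  have RH: "?S \<Up> 1 # ?H # \<Gamma> \<turnstile> ext_rel (A \<Up> 2) (B \<Up> 2) (Var 1) (Var 0) \<^bold>: TUniv k"
    by (rule ext_rel_ty[OF groupoid_pair_weak(2)[OF D wSH]]) (rule var_ty wSH | simp)+
  have RS: "?H \<Up> 1 # ?S # \<Gamma> \<turnstile> ext_rel (A \<Up> 2) (B \<Up> 2) (Var 0) (Var 1) \<^bold>: TUniv k"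
    by (rule ext_rel_ty[OF groupoid_pair_weak(2)[OF D wHS]]) (rule var_ty wHS | simp)+
  \<comment> \<open>Totality from the side of \<open>h\<close>: every map is an extension of its
    restriction.\<close>
  have "inh (?H # \<Gamma>) (TSigma (?S \<Up> 1) (ext_rel (A \<Up> 2) (B \<Up> 2) (Var 1) (Var 0)))"
  proof -
    obtain f w where r: "?H # \<Gamma> \<turnstile> f \<^bold>: arr (A \<Up> 1) (B \<Up> 1)"
        "?H # \<Gamma> \<turnstile> w \<^bold>: coherence (A \<Up> 1) (B \<Up> 1) f"
      "restricts (?H # \<Gamma>) (A \<Up> 1) (B \<Up> 1) (Var 0) f (const_of (A \<Up> 1) (B \<Up> 1) f w)"
      using restriction_exists[OF DH vH] .
    obtain e where "?H # \<Gamma> \<turnstile> e \<^bold>: ext_rel (A \<Up> 1) (B \<Up> 1) (Var 0) (TPair f w)"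
      using ext_rel_pair[OF DH vH r(1,2)
          restriction_extends[OF coherence_fst(2)[OF DH r(1,2)] vH r(3)]] by (rule inhE)
    then show ?thesis
      by (intro inhI[OF ty_pair[OF RH, of "TPair f w" e]])
          (use coherent_pair_ty[OF DH r(1,2)] in simp_all)
  qed
  from choice[OF H weak_univ[OF S wH] RH this] obtain F where F: "\<Gamma> \<turnstile> F \<^bold>: arr ?H ?S"
    "inh (?H # \<Gamma>) (ext_rel (A \<Up> 1) (B \<Up> 1) (Var 0) (F \<Up> 1 $ Var 0))"
    by (auto simp: arr_def'[of ?H])
  \<comment> \<open>Totality from the side of coherent maps, by
    \<open>extension_exists\<close>.\<close>
  have "inh (?S # \<Gamma>) (TSigma (?H \<Up> 1) (ext_rel (A \<Up> 2) (B \<Up> 2) (Var 0) (Var 1)))"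
  proof -
    note c = coherent_maps_parts(1,2)[OF DS vS]
    obtain h where h: "?S # \<Gamma> \<turnstile> h \<^bold>: arr (TTrunc (A \<Up> 1)) (B \<Up> 1)"
        "inh (?S # \<Gamma>) (ext_rel (A \<Up> 1) (B \<Up> 1) h (Var 0))"
      using extension_exists[OF coherence_fst(2)[OF DS c]] unfolding ext_rel_def .
    obtain e where "?S # \<Gamma> \<turnstile> e \<^bold>: ext_rel (A \<Up> 1) (B \<Up> 1) h (Var 0)" using h(2) by (rule inhE)
    then show ?thesis by (intro inhI[OF ty_pair[OF RS, of h e]]) (use h(1) in simp_all)
  qed
  from choice[OF S weak_univ[OF H wS] RS this] obtain G where G: "\<Gamma> \<turnstile> G \<^bold>: arr ?S ?H"
    "inh (?S # \<Gamma>) (ext_rel (A \<Up> 1) (B \<Up> 1) (G \<Up> 1 $ Var 0) (Var 0))"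
    by (auto simp: arr_def'[of ?S])
  \<comment> \<open>\<open>F\<close> and \<open>G\<close> live in \<Gamma>, but the inverse laws
    concern a variable in an extended context. Hence typing and relatedness are recorded for every
    substitution.\<close>
  have FG_ty: "\<Delta> \<turnstile> sub \<sigma> F \<^bold>: arr (arr (TTrunc (sub \<sigma> A)) (sub \<sigma> B))
      (coherent_maps (sub \<sigma> A) (sub \<sigma> B))"
    "\<Delta> \<turnstile> sub \<sigma> G \<^bold>: arr (coherent_maps (sub \<sigma> A) (sub \<sigma> B)) (arr (TTrunc (sub \<sigma> A)) (sub \<sigma> B))"
    if "subst_ok \<Delta> \<sigma> \<Gamma>" for \<Delta> \<sigma>
    using has_type_sub[OF F(1) that] has_type_sub[OF G(1) that] by simp_all
  have F_rel: "inh \<Delta> (ext_rel (sub \<sigma> A) (sub \<sigma> B) h (sub \<sigma> F $ h))"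
    if s: "subst_ok \<Delta> \<sigma> \<Gamma>" and h: "\<Delta> \<turnstile> h \<^bold>: arr (TTrunc (sub \<sigma> A)) (sub \<sigma> B)" for \<Delta> \<sigma> h
    using inh_weak[OF F(2) subst_ok_scons[OF s, of h ?H]] h by simp
  have G_rel: "inh \<Delta> (ext_rel (sub \<sigma> A) (sub \<sigma> B) (sub \<sigma> G $ s) s)"
    if s: "subst_ok \<Delta> \<sigma> \<Gamma>" and h: "\<Delta> \<turnstile> s \<^bold>: coherent_maps (sub \<sigma> A) (sub \<sigma> B)" for \<Delta> \<sigma> s
    using inh_weak[OF G(2) subst_ok_scons[OF s, of _ ?S]] h by simp
  note sH = subst_ok_sh(1)[OF wH] and sS = subst_ok_sh(1)[OF wS]
  note FH = arr_app_ty[OF FG_ty(1)[OF sH] vH] and GS = arr_app_ty[OF FG_ty(2)[OF sS] vS]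
  note GFH = arr_app_ty[OF FG_ty(2)[OF sH] FH] and FGS = arr_app_ty[OF FG_ty(1)[OF sS] GS]
  \<comment> \<open>For a coherent map \<open>s\<close>, both \<open>F (G s)\<close> and
    \<open>s\<close> are related to \<open>G s\<close>, which determines its coherent map.\<close>
  have "ideq (?S # \<Gamma>) (?S \<Up> 1) (F \<Up> 1 $ (G \<Up> 1 $ Var 0)) (Var 0)"
    using ext_rel_map_unique[OF DS GS FGS vS F_rel[OF sS GS] G_rel[OF sS vS]] by simp
  \<comment> \<open>Both \<open>G (F h)\<close> and \<open>h\<close> are related to
    \<open>F h\<close>, which determines its extension.\<close>
  moreover have "ideq (?H # \<Gamma>) (?H \<Up> 1) (G \<Up> 1 $ (F \<Up> 1 $ Var 0)) (Var 0)"
    using extension_unique[OF coherence_fst(2)[OF DH coherent_maps_parts(1,2)[OF DH FH]] GFH vH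
      G_rel[OF sH FH, unfolded ext_rel_def] F_rel[OF sH vH, unfolded ext_rel_def]] by simp
  ultimately have "inh \<Gamma> (is_equiv ?H ?S F)" by (rule is_equivI[OF H S F(1) G(1)])
  then obtain e where e: "\<Gamma> \<turnstile> e \<^bold>: is_equiv ?H ?S F" by (rule inhE)
  have wA: "wf_ctx (arr ?H ?S # \<Gamma>)" by (rule ctx_extend arr_ty H S)+
  have "arr ?H ?S # \<Gamma> \<turnstile> is_equiv (?H \<Up> 1) (?S \<Up> 1) (Var 0) \<^bold>: TUniv k"
    by (rule is_equiv_ty weak_univ H S wA)+ (rule var_ty wA | simp)+
  from ty_pair[OF this F(1), of e] e have "\<Gamma> \<turnstile> TPair F e \<^bold>: equiv_ty ?H ?S"
    by (simp add: equiv_ty_def')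
  then show ?thesis by (rule inhI)
qed

lemma ty_univ_mono: "\<Gamma> \<turnstile> A \<^bold>: TUniv i \<Longrightarrow> i \<le> k \<Longrightarrow> \<Gamma> \<turnstile> A \<^bold>: TUniv k"
  by (induction k rule: nat_induct) (auto simp: le_Suc_eq intro: ty_cumul)

theorem theorem2p3:
  fixes i j :: nat
  shows "\<exists>t. [] \<turnstile> t \<^bold>:
    TPi (TUniv i) (TPi (TUniv j)
      (arr (is_groupoid (Var 0))
        (equiv_ty (arr (TTrunc (Var 1)) (Var 0)) (coherent_maps (Var 1) (Var 0)))))"
proof -
  \<comment> \<open>The preceding development keeps \<open>A\<close> and \<open>B\<close> in one
    universe; cumulativity lifts both to the larger of the two levels.\<close>
  let ?k = "max i j"
  let ?\<Gamma> = "[TUniv j, TUniv i]" and ?\<Delta> = "[is_groupoid (Var 0), TUniv j, TUniv i]"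
  have w1: "wf_ctx [TUniv i]" by (rule ctx_extend ty_univ ctx_empty)+
  have w2: "wf_ctx ?\<Gamma>" by (rule ctx_extend ty_univ w1)+
  have "?\<Gamma> \<turnstile> is_groupoid (Var 0) \<^bold>: TUniv j"
    by (rule is_groupoid_ty var_ty w2 | simp)+
  then have w3: "wf_ctx ?\<Delta>" by (rule ctx_extend)
  have "?\<Delta> \<turnstile> Var 2 \<^bold>: TUniv i" "?\<Delta> \<turnstile> Var 1 \<^bold>: TUniv j" by (rule var_ty w3 | simp)+
  then have "?\<Delta> \<turnstile> Var 2 \<^bold>: TUniv ?k" "?\<Delta> \<turnstile> Var 1 \<^bold>: TUniv ?k"
    by (auto elim: ty_univ_mono)
  moreover have "inh ?\<Delta> (is_groupoid (Var 1))" by (rule inhI, rule var_ty(1)[OF w3]) simp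
  ultimately have "groupoid_pair ?\<Delta> ?k (Var 2) (Var 1)" by (simp add: groupoid_pair_def)
  from trunc_coherent_maps_equiv[OF this]
  have "inh [] (TPi (TUniv i) (TPi (TUniv j)
      (TPi (is_groupoid (Var 0)) (equiv_ty (arr (TTrunc (Var 2)) (Var 1))
      (coherent_maps (Var 2) (Var 1))))))"
    by (intro inh_lam)
  then show ?thesis by (simp add: arr_def'[of "is_groupoid (Var 0)"] inh_def)
qed

end
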